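(* Let $k\ge 1$ be a fixed integer, $A_1,\dots,A_k\in\mathbb{P}$ and $\mu:=\frac{1}{k}\sum_{i=1}^k\delta_{A_i}$. Let $S_1:=A_1$ and $S_{n+1}:=S_n\#_{\frac{1}{n+1}}A_{\overline{n+1}}$ for $n\ge 1$, where $\overline{n}$ denotes the residue of $n$ modulo $k$, with residue $0$ identified with $k$. Then $S_n\to\Lambda(\mu)$ in $d_\infty$ as $n\to\infty$.
   Context: $\mathcal{H}$ is a Hilbert space (possibly infinite dimensional), and $\mathbb{P}$ is the cone of bounded self-adjoint positive definite invertible operators on $\mathcal{H}$; $\|\cdot\|$ is the operator norm. The Thompson metric on $\mathbb{P}$ is $d_\infty(A,B):=\|\log(A^{-1/2}BA^{-1/2})\|$. For $A,B\in\mathbb{P}$, $t\in[0,1]$, $A\#_tB:=A^{1/2}(A^{-1/2}BA^{-1/2})^tA^{1/2}$. For $X,A\in\mathbb{P}$, $\log_XA:=X^{1/2}\log(X^{-1/2}AX^{-1/2})X^{1/2}$. For $\mu=\frac1k\sum_{i=1}^k\delta_{A_i}$, the Karcher mean $\Lambda(\mu)\in\mathbb{P}$ is the unique solution $X\in\mathbb{P}$ of the Karcher equation $\int_{\mathbb{P}}\log_XA\,d\mu(A)=\frac1k\sum_{i=1}^k\log_XA_i=0$ (existence and uniqueness are known). *)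

theory Defs
  imports "HOL-Analysis.Analysis" "HOL-Computational_Algebra.Polynomial"
begin

text \<open>
  A Hilbert space over a scalar field \<open>K\<close>, where \<open>K\<close> is \<open>\<real>\<close> or \<open>\<complex>\<close> (as a subset of the complex
  numbers). The library only has real inner product spaces, so the carrier is the type \<open>'h\<close> with
  its complete real inner product structure, and the scalar multiplication by \<open>K\<close> and the
  \<open>K\<close>-valued inner product are given on top of it. The last assumption says that the norm of
  \<open>'h\<close> is the one induced by \<open>ip\<close>, so every real or complex Hilbert space is of this form.
  Values of \<open>smul c\<close> for \<open>c \<notin> K\<close> are irrelevant.
\<close>

locale hilbert_space =
  fixes K :: "complex set"
    and smul :: "complex \<Rightarrow> 'h::{real_inner,banach} \<Rightarrow> 'h"
    and ip :: "'h \<Rightarrow> 'h \<Rightarrow> complex"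
  assumes scalars: "K = \<real> \<or> K = UNIV"
    and smul_of_real: "smul (of_real r) x = r *\<^sub>R x"
    and smul_add_left: "c \<in> K \<Longrightarrow> d \<in> K \<Longrightarrow> smul (c + d) x = smul c x + smul d x"
    and smul_add_right: "c \<in> K \<Longrightarrow> smul c (x + y) = smul c x + smul c y"
    and smul_smul: "c \<in> K \<Longrightarrow> d \<in> K \<Longrightarrow> smul c (smul d x) = smul (c * d) x"
    and ip_scalar: "ip x y \<in> K"
    and ip_add_left: "ip (x + y) z = ip x z + ip y z"
    and ip_smul_left: "c \<in> K \<Longrightarrow> ip (smul c x) y = c * ip x y"
    and ip_commute: "ip x y = cnj (ip y x)"
    and inner_eq_Re_ip: "inner x y = Re (ip x y)"

lemma hilbert_space_real:
  "hilbert_space \<real> (\<lambda>c x. Re c *\<^sub>R x) (\<lambda>x y :: 'h::{real_inner,banach}. of_real (inner x y))"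
  by unfold_locales
    (auto simp: algebra_simps inner_add_left inner_commute elim!: Reals_cases)

lemma hilbert_space_complex: "hilbert_space UNIV (*) (\<lambda>x y :: complex. x * cnj y)"
  by unfold_locales (auto simp: algebra_simps scaleR_conv_of_real inner_complex_def)

definition invertible_op :: "('h::real_normed_vector \<Rightarrow>\<^sub>L 'h) \<Rightarrow> bool" where
  "invertible_op A \<longleftrightarrow> (\<exists>B. A o\<^sub>L B = id_blinfun \<and> B o\<^sub>L A = id_blinfun)"

text \<open>
  The cone of bounded (\<open>K\<close>-linear) self-adjoint positive definite invertible operators. Since \<open>A\<close>
  is self-adjoint, \<open>ip (A x) x\<close> is real, so taking its real part loses nothing.
\<close>

definition pos_cone ::
  "complex set \<Rightarrow> (complex \<Rightarrow> 'h \<Rightarrow> 'h) \<Rightarrow> ('h \<Rightarrow> 'h \<Rightarrow> complex) \<Rightarrow>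
    ('h::{real_inner,banach} \<Rightarrow>\<^sub>L 'h) set" where
  "pos_cone K smul ip =
    {A. (\<forall>c\<in>K. \<forall>x. blinfun_apply A (smul c x) = smul c (blinfun_apply A x)) \<and>
        (\<forall>x y. ip (blinfun_apply A x) y = ip x (blinfun_apply A y)) \<and>
        (\<forall>x. x \<noteq> 0 \<longrightarrow> Re (ip (blinfun_apply A x) x) > 0) \<and>
        invertible_op A}"

text \<open>
  Continuous functional calculus for a self-adjoint operator \<open>A\<close>. The spectrum of such an operator
  is real, and \<open>f(A)\<close> is the limit in operator norm of \<open>p\<^sub>n(A)\<close> for real polynomials \<open>p\<^sub>n\<close>
  converging to \<open>f\<close> uniformly on the spectrum.
\<close>

definition real_spectrum :: "('h::real_normed_vector \<Rightarrow>\<^sub>L 'h) \<Rightarrow> real set" where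
  "real_spectrum A = {r. \<not> invertible_op (A - r *\<^sub>R id_blinfun)}"

definition poly_op :: "real poly \<Rightarrow> ('h::real_normed_vector \<Rightarrow>\<^sub>L 'h) \<Rightarrow> ('h \<Rightarrow>\<^sub>L 'h)" where
  "poly_op p A = (\<Sum>i\<le>degree p. coeff p i *\<^sub>R (((o\<^sub>L) A ^^ i) id_blinfun))"

definition fun_op :: "(real \<Rightarrow> real) \<Rightarrow> ('h::real_normed_vector \<Rightarrow>\<^sub>L 'h) \<Rightarrow> ('h \<Rightarrow>\<^sub>L 'h)" where
  "fun_op f A =
    (THE B. \<forall>p :: nat \<Rightarrow> real poly.
      uniform_limit (real_spectrum A) (\<lambda>n. poly (p n)) f sequentially \<longrightarrow>
      (\<lambda>n. poly_op (p n) A) \<longlonglongrightarrow> B)"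

definition log_op :: "('h::real_normed_vector \<Rightarrow>\<^sub>L 'h) \<Rightarrow> ('h \<Rightarrow>\<^sub>L 'h)" where
  "log_op A = fun_op ln A"

definition powr_op :: "('h::real_normed_vector \<Rightarrow>\<^sub>L 'h) \<Rightarrow> real \<Rightarrow> ('h \<Rightarrow>\<^sub>L 'h)" where
  "powr_op A t = fun_op (\<lambda>x. x powr t) A"

definition thompson_dist ::
  "('h::real_normed_vector \<Rightarrow>\<^sub>L 'h) \<Rightarrow> ('h \<Rightarrow>\<^sub>L 'h) \<Rightarrow> real" where
  "thompson_dist A B = norm (log_op (powr_op A (-1/2) o\<^sub>L B o\<^sub>L powr_op A (-1/2)))"

definition geodesic ::
  "('h::real_normed_vector \<Rightarrow>\<^sub>L 'h) \<Rightarrow> real \<Rightarrow> ('h \<Rightarrow>\<^sub>L 'h) \<Rightarrow> ('h \<Rightarrow>\<^sub>L 'h)" where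
  "geodesic A t B =
    powr_op A (1/2) o\<^sub>L powr_op (powr_op A (-1/2) o\<^sub>L B o\<^sub>L powr_op A (-1/2)) t o\<^sub>L powr_op A (1/2)"

definition log_at ::
  "('h::real_normed_vector \<Rightarrow>\<^sub>L 'h) \<Rightarrow> ('h \<Rightarrow>\<^sub>L 'h) \<Rightarrow> ('h \<Rightarrow>\<^sub>L 'h)" where
  "log_at X A =
    powr_op X (1/2) o\<^sub>L log_op (powr_op X (-1/2) o\<^sub>L A o\<^sub>L powr_op X (-1/2)) o\<^sub>L powr_op X (1/2)"

text \<open>The Karcher mean of \<open>\<mu> = (1/k) (\<delta>\<^bsub>A 1\<^esub> + \<dots> + \<delta>\<^bsub>A k\<^esub>)\<close>.\<close>

definition karcher_mean ::
  "complex set \<Rightarrow> (complex \<Rightarrow> 'h \<Rightarrow> 'h) \<Rightarrow> ('h \<Rightarrow> 'h \<Rightarrow> complex) \<Rightarrow>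
    nat \<Rightarrow> (nat \<Rightarrow> ('h::{real_inner,banach} \<Rightarrow>\<^sub>L 'h)) \<Rightarrow> ('h \<Rightarrow>\<^sub>L 'h)" where
  "karcher_mean K smul ip k A =
    (THE X. X \<in> pos_cone K smul ip \<and> (1 / real k) *\<^sub>R (\<Sum>i=1..k. log_at X (A i)) = 0)"

definition cyclic_index :: "nat \<Rightarrow> nat \<Rightarrow> nat" where
  "cyclic_index k n = (if n mod k = 0 then k else n mod k)"

end

theory Submission
  imports Defs "HOL-Computational_Algebra.Fundamental_Theorem_Algebra"
begin

text \<open>
  Write \<open>X #\<^sub>t A\<close> for the geodesic and \<open>d\<close> for the Thompson metric, and call \<open>(1/k) \<Sum>\<^sub>i log_at X (A i)\<close>
  the gradient at \<open>X\<close>. Two facts about a single step carry everything.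

  \<^item> Contraction: \<open>d(X #\<^sub>t A, Y #\<^sub>t A) \<le> (1 - t) d(X, Y)\<close> (\<open>thompson_dist_geodesic_le\<close>). The distance is at
    most \<open>\<alpha>\<close> iff \<open>exp (- \<alpha>) X \<le> Y \<le> exp \<alpha> X\<close> (\<open>thompson_dist_le_iff\<close>), and \<open>X #\<^sub>t A\<close> is monotone in
    \<open>X\<close>, by the Loewner-Heinz inequality, and homogeneous of degree \<open>1 - t\<close>.
  \<^item> Expansion: \<open>X #\<^sub>t A = X + t log_at X A + O(t\<^sup>2)\<close>, uniformly on bounded sets
    (\<open>geodesic_expansion\<close>), with \<open>log_at X A\<close> continuous in \<open>X\<close> (\<open>log_at_tendsto\<close>).

  For uniqueness and existence of the Karcher mean, consider the averaged map \<open>X \<mapsto> (1/k) \<Sum>\<^sub>i X #\<^sub>s A i\<close>.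
  It contracts by \<open>1 - s\<close> and moves \<open>X\<close> by \<open>s\<close> times the gradient up to \<open>O(s\<^sup>2)\<close>; for \<open>s \<rightarrow> 0\<close>
  this bounds \<open>d(X, Y)\<close> by a multiple of the sum of the gradients at \<open>X\<close> and \<open>Y\<close>
  (\<open>thompson_dist_le_gradients\<close>). So a zero of the gradient is unique, and almost fixed points of the
  averaged maps, found by iteration, converge to one (\<open>karcher_exists\<close>).

  For the convergence of \<open>S\<close> to the Karcher mean \<open>X\<close>, run the \<open>m\<close>-th cycle of \<open>k\<close> steps both from
  \<open>S (m k)\<close> and from \<open>X\<close>. The contraction factors telescope, so the results are at distance at most
  \<open>m / (m + 1) d(S (m k), X)\<close>. The cycle from \<open>X\<close> ends at \<open>X + (1 / (m k)) \<Sum>\<^sub>i log_at X (A i) + o(1 / m)\<close>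
  (\<open>cycle_expansion\<close>), where the sum vanishes. Hence
  \<open>(m + 1) d(S ((m + 1) k), X) \<le> m d(S (m k), X) + o(1)\<close>, and dividing by \<open>m\<close> gives
  \<open>d(S (m k), X) \<rightarrow> 0\<close> (\<open>cyclic_means_converge\<close>).

  The continuous functional calculus behind these facts rests on two properties of a self-adjoint
  operator \<open>T\<close>: the norm of \<open>p(T)\<close> is bounded by the supremum of \<open>\<bar>p\<bar>\<close> over the spectrum
  (\<open>norm_poly_op_le\<close>), and functions of two operators are intertwined by whatever intertwines the
  operators (\<open>fun_op_intertwine\<close>). The latter allows the arguments of \<open>A f(B / A)\<close>-type expressions to be
  exchanged (\<open>perspective_swap\<close>), so that the geodesic and the logarithm depend on the moving point
  linearly inside a single application of a function. Everything is done for the real structure of the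
  space; the Karcher mean is linear over the scalars because it commutes with every operator that
  commutes with the given ones.
\<close>

section \<open>Self-adjoint operators and their quadratic forms\<close>

definition selfadj :: "('h::real_inner \<Rightarrow>\<^sub>L 'h) \<Rightarrow> bool" where
  "selfadj T \<longleftrightarrow> (\<forall>x y. inner (T x) y = inner x (T y))"

definition op_le :: "('h::real_inner \<Rightarrow>\<^sub>L 'h) \<Rightarrow> ('h \<Rightarrow>\<^sub>L 'h) \<Rightarrow> bool"  (infix "\<sqsubseteq>" 50) where
  "S \<sqsubseteq> T \<longleftrightarrow> (\<forall>x. inner (S x) x \<le> inner (T x) x)"

definition between :: "real \<Rightarrow> real \<Rightarrow> ('h::real_inner \<Rightarrow>\<^sub>L 'h) \<Rightarrow> bool" where
  "between a b T \<longleftrightarrow> selfadj T \<and> a *\<^sub>R id_blinfun \<sqsubseteq> T \<and> T \<sqsubseteq> b *\<^sub>R id_blinfun"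

interpretation comp: bounded_bilinear "(o\<^sub>L)"
  by (rule bounded_bilinear_blinfun_compose)

lemmas op_linear =
  comp.add_left comp.add_right comp.diff_left comp.diff_right
  comp.scaleR_left comp.scaleR_right comp.zero_left comp.zero_right
  comp.minus_left comp.minus_right

lemmas op_apply = blinfun.add_left blinfun.diff_left blinfun.scaleR_left blinfun.minus_left
  blinfun.sum_left blinfun.add_right blinfun.diff_right blinfun.scaleR_right blinfun.minus_right

lemma op_assoc: "(S o\<^sub>L T) o\<^sub>L U = S o\<^sub>L (T o\<^sub>L U)"
  by (rule blinfun_eqI) simp

lemma op_id [simp]: "id_blinfun o\<^sub>L T = T" "T o\<^sub>L id_blinfun = T"
  by (auto intro: blinfun_eqI)

lemma selfadjD: "selfadj T \<Longrightarrow> inner (T x) y = inner x (T y)"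
  by (simp add: selfadj_def)

lemma selfadj_id [simp]: "selfadj id_blinfun"
  by (simp add: selfadj_def)

lemma selfadj_zero [simp]: "selfadj 0"
  by (simp add: selfadj_def)

lemma selfadj_add: "selfadj S \<Longrightarrow> selfadj T \<Longrightarrow> selfadj (S + T)"
  by (simp add: selfadj_def op_apply inner_add_left inner_add_right)

lemma selfadj_diff: "selfadj S \<Longrightarrow> selfadj T \<Longrightarrow> selfadj (S - T)"
  by (simp add: selfadj_def op_apply inner_diff_left inner_diff_right)

lemma selfadj_scaleR: "selfadj T \<Longrightarrow> selfadj (c *\<^sub>R T)"
  by (simp add: selfadj_def op_apply)

lemma selfadj_commuting:
  assumes "selfadj S" "selfadj T" "S o\<^sub>L T = T o\<^sub>L S"
  shows "selfadj (S o\<^sub>L T)"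
proof -
  have "inner ((S o\<^sub>L T) x) y = inner x ((T o\<^sub>L S) y)" for x y
    using assms(1,2) by (simp add: selfadj_def)
  then show ?thesis unfolding selfadj_def by (metis assms(3))
qed

lemma selfadj_conj:
  assumes "selfadj S" "selfadj T"
  shows "selfadj (S o\<^sub>L T o\<^sub>L S)"
  using assms by (simp add: selfadj_def)

lemma selfadj_tendsto:
  assumes "T \<longlonglongrightarrow> U" "\<And>n. selfadj (T n)"
  shows "selfadj U"
  unfolding selfadj_def
proof (intro allI)
  fix x y
  have "(\<lambda>n. inner (T n x) y) \<longlonglongrightarrow> inner (U x) y"
    by (intro tendsto_intros assms)
  moreover have "(\<lambda>n. inner (T n x) y) \<longlonglongrightarrow> inner x (U y)"
    using assms(2) by (simp add: selfadjD, intro tendsto_intros assms)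
  ultimately show "inner (U x) y = inner x (U y)"
    by (rule LIMSEQ_unique)
qed

lemma op_le_refl [simp]: "T \<sqsubseteq> T"
  by (simp add: op_le_def)

lemma op_le_trans [trans]: "S \<sqsubseteq> T \<Longrightarrow> T \<sqsubseteq> U \<Longrightarrow> S \<sqsubseteq> U"
  unfolding op_le_def by (meson order_trans)

lemma op_le_add: "S \<sqsubseteq> T \<Longrightarrow> U \<sqsubseteq> V \<Longrightarrow> S + U \<sqsubseteq> T + V"
  by (simp add: op_le_def op_apply inner_add_left add_mono)

lemma op_le_scaleR: "S \<sqsubseteq> T \<Longrightarrow> 0 \<le> c \<Longrightarrow> c *\<^sub>R S \<sqsubseteq> c *\<^sub>R T"
  by (simp add: op_le_def op_apply mult_left_mono)

lemma op_le_sum: "(\<And>i. i \<in> I \<Longrightarrow> S i \<sqsubseteq> T i) \<Longrightarrow> (\<Sum>i\<in>I. S i) \<sqsubseteq> (\<Sum>i\<in>I. T i)"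
  by (induction I rule: infinite_finite_induct) (auto intro: op_le_add)

lemma op_le_id_mono: "a \<le> b \<Longrightarrow> a *\<^sub>R id_blinfun \<sqsubseteq> b *\<^sub>R id_blinfun"
  by (simp add: op_le_def op_apply mult_right_mono)

lemma op_le_conj:
  assumes "S \<sqsubseteq> T" "selfadj C"
  shows "C o\<^sub>L S o\<^sub>L C \<sqsubseteq> C o\<^sub>L T o\<^sub>L C"
  using assms by (simp add: op_le_def selfadj_def)

lemma op_le_tendsto:
  assumes "S \<longlonglongrightarrow> S'" "T \<longlonglongrightarrow> T'" "\<forall>\<^sub>F n in sequentially. S n \<sqsubseteq> T n"
  shows "S' \<sqsubseteq> T'"
  unfolding op_le_def
proof
  fix x
  show "inner (S' x) x \<le> inner (T' x) x"
  proof (rule tendsto_le)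
    show "(\<lambda>n. inner (T n x) x) \<longlonglongrightarrow> inner (T' x) x" "(\<lambda>n. inner (S n x) x) \<longlonglongrightarrow> inner (S' x) x"
      by (intro tendsto_intros assms)+
    show "\<forall>\<^sub>F n in sequentially. inner (S n x) x \<le> inner (T n x) x"
      using assms(3) by eventually_elim (simp add: op_le_def)
  qed simp
qed

lemma op_le_norm: "T \<sqsubseteq> norm T *\<^sub>R id_blinfun" "- norm T *\<^sub>R id_blinfun \<sqsubseteq> T"
proof -
  have *: "\<bar>inner (T x) x\<bar> \<le> norm T * inner x x" for x
  proof -
    have "\<bar>inner (T x) x\<bar> \<le> norm (T x) * norm x"
      by (rule Cauchy_Schwarz_ineq2)
    also have "\<dots> \<le> norm T * norm x * norm x"
      by (intro mult_right_mono norm_blinfun) simp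
    also have "\<dots> = norm T * inner x x"
      by (simp add: dot_square_norm power2_eq_square)
    finally show ?thesis .
  qed
  show "T \<sqsubseteq> norm T *\<^sub>R id_blinfun" "- norm T *\<^sub>R id_blinfun \<sqsubseteq> T"
    using * by (auto simp: op_le_def op_apply abs_le_iff) (metis minus_le_iff)
qed

text \<open>Polarisation bounds the bilinear form of a self-adjoint operator by its quadratic form.\<close>

lemma norm_le_quadratic_form:
  assumes T: "selfadj T" and c: "c \<ge> 0"
    and "- c *\<^sub>R id_blinfun \<sqsubseteq> T" "T \<sqsubseteq> c *\<^sub>R id_blinfun"
  shows "norm T \<le> c"
proof (rule norm_blinfun_bound[OF c])
  fix x
  have q: "\<bar>inner (T z) z\<bar> \<le> c * (norm z)\<^sup>2" for z
    using assms(3,4) by (auto simp: op_le_def op_apply abs_le_iff dot_square_norm)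
      (metis minus_le_iff)
  show "norm (T x) \<le> c * norm x"
  proof (cases "T x = 0")
    case False
    define y where "y = (norm x / norm (T x)) *\<^sub>R T x"
    have ny: "norm y = norm x" using False by (simp add: y_def)
    have "4 * inner (T x) y = inner (T (x + y)) (x + y) - inner (T (x - y)) (x - y)"
      using selfadjD[OF T, of y x]
      by (simp add: op_apply inner_add_left inner_add_right inner_diff_left inner_diff_right
          inner_commute)
    also have "\<dots> \<le> c * (norm (x + y))\<^sup>2 + c * (norm (x - y))\<^sup>2"
      using q[of "x + y"] q[of "x - y"] by linarith
    also have "\<dots> = c * (4 * (norm x)\<^sup>2)"
      using ny by (simp add: power2_norm_eq_inner inner_add_left inner_add_right inner_diff_left
          inner_diff_right norm_eq algebra_simps)
    finally have "inner (T x) y \<le> c * norm x * norm x" by (simp add: power2_eq_square)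
    moreover have "inner (T x) y = norm x * norm (T x)"
      using False by (simp add: y_def dot_square_norm power2_eq_square)
    ultimately have *: "norm x * norm (T x) \<le> norm x * (c * norm x)" by (simp add: mult_ac)
    have "norm x > 0" using False by (auto simp: blinfun.zero_right)
    with * show ?thesis by simp
  qed (use c in simp)
qed

lemma between_selfadj: "between a b T \<Longrightarrow> selfadj T"
  by (simp add: between_def)

lemma between_norm: "selfadj T \<Longrightarrow> norm T \<le> c \<Longrightarrow> between (- c) c T"
  unfolding between_def
  using op_le_norm[of T] op_le_id_mono[of "norm T" c] op_le_id_mono[of "-c" "- norm T"]
  by (auto intro: op_le_trans)

lemma between_mono: "between a b T \<Longrightarrow> a' \<le> a \<Longrightarrow> b \<le> b' \<Longrightarrow> between a' b' T"
  unfolding between_def by (meson op_le_id_mono op_le_trans)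

lemma between_conj:
  assumes "selfadj S" "selfadj C" "a *\<^sub>R (C o\<^sub>L C) \<sqsubseteq> S" "S \<sqsubseteq> b *\<^sub>R (C o\<^sub>L C)"
    and D: "selfadj D" "C o\<^sub>L D = id_blinfun" "D o\<^sub>L C = id_blinfun"
  shows "between a b (D o\<^sub>L S o\<^sub>L D)"
proof -
  have "D o\<^sub>L (c *\<^sub>R (C o\<^sub>L C)) o\<^sub>L D = c *\<^sub>R ((D o\<^sub>L C) o\<^sub>L (C o\<^sub>L D))" for c
    by (simp only: op_linear op_assoc)
  then have "D o\<^sub>L (c *\<^sub>R (C o\<^sub>L C)) o\<^sub>L D = c *\<^sub>R id_blinfun" for c
    using D by simp
  then show ?thesis
    using op_le_conj[OF assms(3) D(1)] op_le_conj[OF assms(4) D(1)] assms(1) D(1)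
    by (simp add: between_def selfadj_conj)
qed

section \<open>Invertibility and the spectrum\<close>

lemma invertible_opI: "S o\<^sub>L T = id_blinfun \<Longrightarrow> T o\<^sub>L S = id_blinfun \<Longrightarrow> invertible_op S"
  by (auto simp: invertible_op_def)

lemma invertible_op_scaleR:
  assumes "invertible_op T" "c \<noteq> 0"
  shows "invertible_op (c *\<^sub>R T)"
proof -
  from assms(1) obtain S where S: "T o\<^sub>L S = id_blinfun" "S o\<^sub>L T = id_blinfun"
    by (auto simp: invertible_op_def)
  show ?thesis
    by (rule invertible_opI[of _ "(1 / c) *\<^sub>R S"]) (use S assms(2) in \<open>simp_all add: op_linear\<close>)
qed

lemma invertible_op_compose:
  assumes "invertible_op S" "invertible_op T"
  shows "invertible_op (S o\<^sub>L T)"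
proof -
  from assms obtain S' T' where *: "S o\<^sub>L S' = id_blinfun" "S' o\<^sub>L S = id_blinfun"
    "T o\<^sub>L T' = id_blinfun" "T' o\<^sub>L T = id_blinfun"
    by (auto simp: invertible_op_def)
  show ?thesis
  proof (rule invertible_opI[of _ "T' o\<^sub>L S'"])
    show "S o\<^sub>L T o\<^sub>L (T' o\<^sub>L S') = id_blinfun"
      by (metis * op_assoc op_id(1))
    show "T' o\<^sub>L S' o\<^sub>L (S o\<^sub>L T) = id_blinfun"
      by (metis * op_assoc op_id(1))
  qed
qed

lemma invertible_op_similar:
  fixes S C D :: "'h::real_normed_vector \<Rightarrow>\<^sub>L 'h"
  assumes "invertible_op S" "C o\<^sub>L D = id_blinfun" "D o\<^sub>L C = id_blinfun"
  shows "invertible_op (C o\<^sub>L S o\<^sub>L D)"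
  using invertible_opI[OF assms(2,3)] invertible_opI[OF assms(3,2)] assms(1)
  by (intro invertible_op_compose)

text \<open>The inverse is the Neumann series; multiplying it by \<open>Z\<close> on either side drops its first term.\<close>

lemma invertible_op_id_minus:
  fixes Z :: "'h::{real_inner,banach} \<Rightarrow>\<^sub>L 'h"
  assumes "norm Z < 1"
  shows "invertible_op (id_blinfun - Z)"
proof -
  define w where "w n = ((o\<^sub>L) Z ^^ n) id_blinfun" for n
  have w_Suc: "w (Suc n) = Z o\<^sub>L w n" for n by (simp add: w_def)
  have w_Suc': "w (Suc n) = w n o\<^sub>L Z" for n
      proof (induction n)
    case 0
    show ?case by (simp add: w_def)
  next
    case (Suc n)
    show ?case by (metis Suc op_assoc w_Suc)
  qed
  have nw: "norm (w n) \<le> norm Z ^ n" for n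
  proof (induction n)
    case 0
    then show ?case by (simp add: w_def norm_blinfun_id_le)
  next
    case (Suc n)
    have "norm (w (Suc n)) \<le> norm Z * norm (w n)"
      unfolding w_Suc by (rule norm_blinfun_compose)
    also have "\<dots> \<le> norm Z * norm Z ^ n" using Suc by (intro mult_left_mono) auto
    finally show ?case by simp
  qed
  have sw: "summable w"
    by (rule summable_comparison_test'[OF summable_geometric, of "norm Z" 0]) (use nw assms in auto)
  have tail: "(\<Sum>n. w (Suc n)) = suminf w - id_blinfun"
    using suminf_split_head[OF sw] by (simp add: w_def)
  have "Z o\<^sub>L suminf w = (\<Sum>n. w (Suc n))"
    unfolding w_Suc
    by (rule bounded_linear.suminf[OF bounded_bilinear.bounded_linear_right
          [OF bounded_bilinear_blinfun_compose] sw])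
  moreover have "suminf w o\<^sub>L Z = (\<Sum>n. w (Suc n))"
    unfolding w_Suc'
    by (rule bounded_linear.suminf[OF bounded_bilinear.bounded_linear_left
          [OF bounded_bilinear_blinfun_compose] sw])
  ultimately show ?thesis
    by (intro invertible_opI[of _ "suminf w"]) (simp_all add: op_linear tail)
qed

lemma invertible_op_scaleR_id_minus:
  fixes Z :: "'h::{real_inner,banach} \<Rightarrow>\<^sub>L 'h"
  assumes "norm Z < r"
  shows "invertible_op (r *\<^sub>R id_blinfun - Z)"
proof -
  have r: "r > 0" using assms norm_ge_zero[of Z] by linarith
  have "invertible_op (id_blinfun - (1 / r) *\<^sub>R Z)"
    using assms r by (intro invertible_op_id_minus) (simp add: field_simps)
  from invertible_op_scaleR[OF this, of r] r show ?thesis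
    by (simp add: scaleR_diff_right)
qed

text \<open>
  For large \<open>b\<close> the operator \<open>b - T\<close> has quadratic form between \<open>0\<close> and \<open>b - a\<close>, hence norm less
  than \<open>b\<close>, and \<open>T = b - (b - T)\<close> is inverted by the Neumann series.
\<close>

lemma coercive_invertible:
  fixes T :: "'h::{real_inner,banach} \<Rightarrow>\<^sub>L 'h"
  assumes T: "selfadj T" and a: "a > 0" "a *\<^sub>R id_blinfun \<sqsubseteq> T"
  shows "invertible_op T"
proof -
  define b where "b = norm T + a"
  have b: "b > 0" using a by (simp add: b_def add_nonneg_pos)
  have "norm (b *\<^sub>R id_blinfun - T) \<le> b - a"
  proof (rule norm_le_quadratic_form)
    show "selfadj (b *\<^sub>R id_blinfun - T)" by (intro selfadj_diff selfadj_scaleR T) simp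
    show "b *\<^sub>R id_blinfun - T \<sqsubseteq> (b - a) *\<^sub>R id_blinfun"
      using a(2) by (simp add: op_le_def op_apply inner_diff_left algebra_simps)
    have nb: "b \<le> b + norm T" "norm T \<le> b" using a by (auto simp: b_def)
    have "inner (T x) x \<le> (b - a + b) * inner x x" for x
    proof -
      have "inner (T x) x \<le> norm T * inner x x"
        using op_le_norm(1)[of T] by (simp add: op_le_def op_apply)
      also have "\<dots> \<le> (b - a + b) * inner x x"
        using nb by (intro mult_right_mono) (auto simp: b_def a less_imp_le)
      finally show ?thesis .
    qed
    then show "- (b - a) *\<^sub>R id_blinfun \<sqsubseteq> b *\<^sub>R id_blinfun - T"
      by (simp add: op_le_def op_apply inner_diff_left algebra_simps)
  qed (simp add: b_def)
  then have "invertible_op (b *\<^sub>R id_blinfun - (b *\<^sub>R id_blinfun - T))"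
    using a by (intro invertible_op_scaleR_id_minus) simp
  then show ?thesis by simp
qed

lemma spectrum_subset:
  fixes T :: "'h::{real_inner,banach} \<Rightarrow>\<^sub>L 'h"
  assumes "between a b T"
  shows "real_spectrum T \<subseteq> {a..b}"
proof
  fix r assume r: "r \<in> real_spectrum T"
  have sa: "selfadj (T - r *\<^sub>R id_blinfun)"
    using assms by (intro selfadj_diff selfadj_scaleR) (auto simp: between_def)
  have "\<not> r < a"
  proof
    assume "r < a"
    moreover have "(a - r) *\<^sub>R id_blinfun \<sqsubseteq> T - r *\<^sub>R id_blinfun"
      using assms by (simp add: between_def op_le_def op_apply inner_diff_left algebra_simps)
    ultimately have "invertible_op (T - r *\<^sub>R id_blinfun)"
      by (intro coercive_invertible[OF sa]) auto
    with r show False by (simp add: real_spectrum_def)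
  qed
  moreover have "\<not> b < r"
  proof
    assume "b < r"
    moreover have "(r - b) *\<^sub>R id_blinfun \<sqsubseteq> (-1) *\<^sub>R (T - r *\<^sub>R id_blinfun)"
      using assms by (simp add: between_def op_le_def op_apply inner_diff_left algebra_simps)
    ultimately have "invertible_op ((-1) *\<^sub>R (T - r *\<^sub>R id_blinfun))"
      by (intro coercive_invertible[OF selfadj_scaleR[OF sa]]) auto
    from invertible_op_scaleR[OF this, of "-1"]
    have "invertible_op (T - r *\<^sub>R id_blinfun)" by simp
    with r show False by (simp add: real_spectrum_def)
  qed
  ultimately show "r \<in> {a..b}" by simp
qed

text \<open>
  For self-adjoint \<open>T\<close> the number \<open>\<parallel>T\<parallel>\<^sup>2\<close> is an approximate eigenvalue of \<open>T\<^sup>2\<close>, because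
  \<open>\<parallel>(T\<^sup>2 - \<parallel>T\<parallel>\<^sup>2) x\<parallel>\<^sup>2 \<le> \<parallel>T\<parallel>\<^sup>4 \<parallel>x\<parallel>\<^sup>2 - \<parallel>T\<parallel>\<^sup>2 \<parallel>T x\<parallel>\<^sup>2\<close> becomes small where \<open>\<parallel>T x\<parallel>\<close> is nearly maximal.
\<close>

lemma norm_squared_in_spectrum:
  assumes T: "selfadj T" "T \<noteq> 0"
  shows "\<not> invertible_op ((T o\<^sub>L T) - (norm T)\<^sup>2 *\<^sub>R id_blinfun)"
proof
  define N where "N = norm T"
  have N: "N > 0" using T(2) by (simp add: N_def)
  assume "invertible_op ((T o\<^sub>L T) - (norm T)\<^sup>2 *\<^sub>R id_blinfun)"
  then obtain B where B: "B o\<^sub>L ((T o\<^sub>L T) - N\<^sup>2 *\<^sub>R id_blinfun) = id_blinfun"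
    by (auto simp: invertible_op_def N_def)
  define \<beta> where "\<beta> = norm B + 1"
  have \<beta>: "\<beta> > 0" by (simp add: \<beta>_def add_nonneg_pos)
  have bd: "(norm (T x))\<^sup>2 \<le> (N\<^sup>2 - 1 / (\<beta>\<^sup>2 * N\<^sup>2)) * (norm x)\<^sup>2" for x
  proof -
    define y where "y = T (T x) - N\<^sup>2 *\<^sub>R x"
    have "x = B y"
      using arg_cong[OF B, of "\<lambda>S. S x"] by (simp add: y_def op_apply)
    then have "norm x \<le> norm B * norm y" by (metis norm_blinfun)
    also have "\<dots> \<le> \<beta> * norm y" by (intro mult_right_mono) (auto simp: \<beta>_def)
    finally have "(norm x)\<^sup>2 \<le> \<beta>\<^sup>2 * (norm y)\<^sup>2"
      by (metis norm_ge_zero power_mono power_mult_distrib)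
    moreover have "(norm y)\<^sup>2 \<le> N^4 * (norm x)\<^sup>2 - N\<^sup>2 * (norm (T x))\<^sup>2"
    proof -
      have "norm (T (T x)) \<le> N * norm (T x)" unfolding N_def by (rule norm_blinfun)
      then have *: "(norm (T (T x)))\<^sup>2 \<le> N\<^sup>2 * (norm (T x))\<^sup>2"
        by (metis norm_ge_zero power_mono power_mult_distrib)
      have "(norm y)\<^sup>2 = (norm (T (T x)))\<^sup>2 - 2 * N\<^sup>2 * inner (T (T x)) x + N^4 * (norm x)\<^sup>2"
        unfolding y_def power2_norm_eq_inner
        by (simp add: inner_diff_left inner_diff_right inner_commute algebra_simps power4_eq_xxxx
            power2_eq_square)
      also have "inner (T (T x)) x = (norm (T x))\<^sup>2"
        using T by (simp add: selfadjD power2_norm_eq_inner)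
      finally show ?thesis using * by linarith
    qed
    ultimately have "(norm x)\<^sup>2 \<le> \<beta>\<^sup>2 * (N^4 * (norm x)\<^sup>2 - N\<^sup>2 * (norm (T x))\<^sup>2)"
      by (meson mult_left_mono order_trans zero_le_power2)
    then have "\<beta>\<^sup>2 * N\<^sup>2 * (norm (T x))\<^sup>2 \<le> \<beta>\<^sup>2 * N^4 * (norm x)\<^sup>2 - (norm x)\<^sup>2"
      by (simp add: algebra_simps)
    then have "(norm (T x))\<^sup>2 \<le> (\<beta>\<^sup>2 * N^4 * (norm x)\<^sup>2 - (norm x)\<^sup>2) / (\<beta>\<^sup>2 * N\<^sup>2)"
      using N \<beta> by (simp add: pos_le_divide_eq mult_ac)
    also have "\<dots> = (N\<^sup>2 - 1 / (\<beta>\<^sup>2 * N\<^sup>2)) * (norm x)\<^sup>2"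
      using N \<beta> by (simp add: field_simps power4_eq_xxxx power2_eq_square)
    finally show ?thesis .
  qed
  define c where "c = max 0 (N\<^sup>2 - 1 / (\<beta>\<^sup>2 * N\<^sup>2))"
  have "norm T \<le> sqrt c"
  proof (rule norm_blinfun_bound)
    fix x
    have "(norm (T x))\<^sup>2 \<le> c * (norm x)\<^sup>2"
      using bd[of x] by (rule order_trans) (auto simp: c_def intro!: mult_right_mono)
    then have "sqrt ((norm (T x))\<^sup>2) \<le> sqrt (c * (norm x)\<^sup>2)" by (rule real_sqrt_le_mono)
    then show "norm (T x) \<le> sqrt c * norm x" by (simp add: real_sqrt_mult)
  qed (simp add: c_def)
  moreover have "sqrt c < N"
  proof -
    have "c < N\<^sup>2" using N \<beta> by (simp add: c_def)
    then show ?thesis using N by (metis less_imp_le real_sqrt_less_mono real_sqrt_abs abs_of_pos)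
  qed
  ultimately show False by (simp add: N_def)
qed

section \<open>Polynomials of an operator\<close>

lemma poly_op_eq_sum:
  assumes "degree p \<le> n"
  shows "poly_op p T = (\<Sum>i\<le>n. coeff p i *\<^sub>R (((o\<^sub>L) T ^^ i) id_blinfun))"
  unfolding poly_op_def
  by (rule sum.mono_neutral_left) (use assms in \<open>auto simp: coeff_eq_0\<close>)

lemma poly_op_0 [simp]: "poly_op 0 T = 0"
  by (simp add: poly_op_def)

lemma poly_op_pCons [simp]: "poly_op (pCons c p) T = c *\<^sub>R id_blinfun + (T o\<^sub>L poly_op p T)"
proof -
  have "poly_op (pCons c p) T
      = (\<Sum>i\<le>Suc (degree p). coeff (pCons c p) i *\<^sub>R (((o\<^sub>L) T ^^ i) id_blinfun))"
    by (rule poly_op_eq_sum[OF degree_pCons_le])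
  also have "\<dots> = c *\<^sub>R id_blinfun + (T o\<^sub>L poly_op p T)"
    unfolding sum.atMost_Suc_shift poly_op_eq_sum[OF order_refl, of p]
    by (simp add: comp.sum_right comp.scaleR_right del: sum.atMost_Suc)
  finally show ?thesis .
qed

lemma poly_op_add: "poly_op (p + q) T = poly_op p T + poly_op q T"
proof -
  define n where "n = max (degree p) (degree q)"
  have "degree p \<le> n" "degree q \<le> n" "degree (p + q) \<le> n"
    by (auto simp: n_def degree_add_le)
  then show ?thesis
    by (simp add: poly_op_eq_sum[of _ n] scaleR_add_left sum.distrib)
qed

lemma poly_op_smult: "poly_op (smult c p) T = c *\<^sub>R poly_op p T"
  by (induction p) (auto simp: op_linear scaleR_add_right)

lemma poly_op_diff: "poly_op (p - q) T = poly_op p T - poly_op q T"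
  using poly_op_add[of p "smult (-1) q" T] unfolding poly_op_smult by simp

lemma poly_op_mult: "poly_op (p * q) T = poly_op p T o\<^sub>L poly_op q T"
  by (induction p) (auto simp: op_linear poly_op_add poly_op_smult op_assoc)

lemma poly_op_intertwine:
  assumes "T o\<^sub>L M = M o\<^sub>L U"
  shows "poly_op p T o\<^sub>L M = M o\<^sub>L poly_op p U"
proof (induction p)
  case (pCons c p)
  have "T o\<^sub>L (poly_op p T o\<^sub>L M) = M o\<^sub>L (U o\<^sub>L poly_op p U)"
    unfolding pCons by (metis assms op_assoc)
  then show ?case by (simp add: op_linear op_assoc)
qed simp

lemma selfadj_poly_op:
  assumes "selfadj T"
  shows "selfadj (poly_op p T)"
proof (induction p)
  case (pCons c p)
  have "T o\<^sub>L poly_op p T = poly_op p T o\<^sub>L T"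
    using poly_op_intertwine[of T T T p] by simp
  then show ?case
    using pCons assms by (simp add: selfadj_add selfadj_scaleR selfadj_commuting)
qed simp

lemma poly_op_tendsto: "T \<longlonglongrightarrow> U \<Longrightarrow> (\<lambda>n. poly_op p (T n)) \<longlonglongrightarrow> poly_op p U"
  by (induction p) (auto intro!: tendsto_intros comp.tendsto)

lemma poly_of_real_of_real:
  "poly (map_poly complex_of_real p) (of_real x) = of_real (poly p x)"
  by (induction p) (auto simp: map_poly_pCons)

lemma poly_of_real_add:
  "poly (map_poly complex_of_real (p + q)) z =
    poly (map_poly complex_of_real p) z + poly (map_poly complex_of_real q) z"
  by (induction p q rule: poly_induct2) (auto simp: map_poly_pCons algebra_simps)

lemma poly_of_real_smult:
  "poly (map_poly complex_of_real (smult c p)) z = of_real c * poly (map_poly complex_of_real p) z"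
  by (induction p) (auto simp: map_poly_pCons algebra_simps)

lemma poly_of_real_mult:
  "poly (map_poly complex_of_real (p * q)) z =
    poly (map_poly complex_of_real p) z * poly (map_poly complex_of_real q) z"
  by (induction p) (auto simp: map_poly_pCons poly_of_real_add poly_of_real_smult algebra_simps)

lemma real_quadratic_factor:
  fixes p :: "real poly"
  assumes "degree p > 0" and noroot: "\<And>x. poly p x \<noteq> 0"
  obtains u v q where "v \<noteq> 0" "p = [:u\<^sup>2 + v\<^sup>2, - 2 * u, 1:] * q"
proof -
  define P where "P = map_poly complex_of_real p"
  have "degree P > 0" using assms by (simp add: P_def degree_map_poly)
  then have "\<not> constant (poly P)" by (simp add: constant_degree)
  then obtain z where z: "poly P z = 0" using fundamental_theorem_of_algebra by blast
  define u v d where "u = Re z" and "v = Im z" and "d = [:u\<^sup>2 + v\<^sup>2, - 2 * u, 1:]"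
  have v: "v \<noteq> 0"
  proof
    assume "v = 0"
    then have "z = of_real u" by (simp add: u_def v_def complex_eq_iff)
    then have "complex_of_real (poly p u) = 0" using z by (simp add: P_def poly_of_real_of_real)
    then have "poly p u = 0" by (simp only: of_real_eq_0_iff)
    with noroot show False by blast
  qed
  define r where "r = p mod d"
  have d0: "d \<noteq> 0" "degree d = 2" by (simp_all add: d_def)
  have "degree r < 2"
    using degree_mod_less'[of d p] d0 by (cases "r = 0") (auto simp: r_def)
  then have "coeff r (Suc (Suc n)) = 0" for n by (intro coeff_eq_0) simp
  then have "r = [:coeff r 0, coeff r 1:]"
    by (intro poly_eqI) (auto simp: coeff_pCons split: nat.splits)
  then obtain a b where ab: "r = [:a, b:]" by blast
  have pd: "p = d * (p div d) + r" by (simp add: r_def)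
  have "poly (map_poly complex_of_real d) z = 0"
    by (simp add: d_def u_def v_def map_poly_pCons complex_eq_iff power2_eq_square algebra_simps)
  moreover have "poly P z = poly (map_poly complex_of_real d) z
      * poly (map_poly complex_of_real (p div d)) z + poly (map_poly complex_of_real r) z"
    unfolding P_def by (subst pd) (simp only: poly_of_real_add poly_of_real_mult)
  ultimately have "poly (map_poly complex_of_real r) z = 0" using z by simp
  then have "a + u * b = 0" "v * b = 0"
    by (auto simp: ab map_poly_pCons complex_eq_iff u_def v_def)
  with v have "r = 0" by (simp add: ab)
  with pd have "p = d * (p div d)" by simp
  then show ?thesis using that v unfolding d_def by blast
qed

text \<open>
  The spectral mapping theorem over the reals. A quadratic without real roots takes a self-adjoint
  operator to a coercive one, by completing the square, so only the real linear factors can destroy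
  invertibility, and these are invertible off the spectrum.
\<close>

lemma invertible_poly_op:
  fixes T :: "'h::{real_inner,banach} \<Rightarrow>\<^sub>L 'h"
  assumes T: "selfadj T"
  shows "p \<noteq> 0 \<Longrightarrow> (\<And>s. s \<in> real_spectrum T \<Longrightarrow> poly p s \<noteq> 0) \<Longrightarrow> invertible_op (poly_op p T)"
proof (induction "degree p" arbitrary: p rule: less_induct)
  case less
  have *: "invertible_op (poly_op p T)"
    if "p = d * q" "degree d > 0" "invertible_op (poly_op d T)" for d q
  proof -
    have "q \<noteq> 0" "d \<noteq> 0" using less.prems that by auto
    then have "degree q < degree p" using that by (simp add: degree_mult_eq)
    moreover have "poly q s \<noteq> 0" if "s \<in> real_spectrum T" for s
      using less.prems(2)[OF that] \<open>p = d * q\<close> by auto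
    ultimately have "invertible_op (poly_op q T)" using less.hyps \<open>q \<noteq> 0\<close> by blast
    then show ?thesis using that by (simp add: poly_op_mult invertible_op_compose)
  qed
  consider "degree p = 0" | s where "poly p s = 0" | "degree p > 0" "\<And>s. poly p s \<noteq> 0"
    by blast
  then show ?case
  proof cases
    case 1
    then obtain c where c: "p = [:c:]" by (metis degree_eq_zeroE)
    with less.prems have "c \<noteq> 0" by auto
    then show ?thesis
      using invertible_op_scaleR[OF invertible_opI[OF op_id(1) op_id(1)]] by (auto simp: c)
  next
    case 2
    then obtain q where q: "p = [:- s, 1:] * q" by (auto simp: poly_eq_0_iff_dvd)
    have "s \<notin> real_spectrum T" using less.prems(2) 2 by blast
    then have "invertible_op (poly_op [:- s, 1:] T)" by (simp add: real_spectrum_def)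
    then show ?thesis using *[OF q] by simp
  next
    case 3
    then obtain u v q where vq: "v \<noteq> 0" "p = [:u\<^sup>2 + v\<^sup>2, - 2 * u, 1:] * q"
      by (rule real_quadratic_factor) blast
    have "invertible_op (poly_op [:u\<^sup>2 + v\<^sup>2, - 2 * u, 1:] T)"
    proof (rule coercive_invertible[OF selfadj_poly_op[OF T]])
      show "v\<^sup>2 > 0" using vq by simp
      have "inner (poly_op [:u\<^sup>2 + v\<^sup>2, - 2 * u, 1:] T x) x = v\<^sup>2 * inner x x + (norm (T x - u *\<^sub>R x))\<^sup>2" for x
        using T unfolding power2_norm_eq_inner
        by (simp add: op_apply selfadjD inner_diff_left inner_diff_right
            inner_add_left inner_commute algebra_simps power2_eq_square)
      then show "v\<^sup>2 *\<^sub>R id_blinfun \<sqsubseteq> poly_op [:u\<^sup>2 + v\<^sup>2, - 2 * u, 1:] T"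
        unfolding op_le_def by (simp add: op_apply del: poly_op_pCons)
    qed
    then show ?thesis using *[OF vq(2)] by simp
  qed
qed

text \<open>
  With empty spectrum both factors of \<open>T\<^sup>2 - \<parallel>T\<parallel>\<^sup>2\<close> are invertible, which forces \<open>T = 0\<close>; and \<open>0\<close> is a
  spectral value of the zero operator unless the space is trivial.
\<close>

lemma spectrum_empty_imp_trivial:
  fixes T :: "'h::{real_inner,banach} \<Rightarrow>\<^sub>L 'h"
  assumes "selfadj T" "real_spectrum T = {}"
  shows "(id_blinfun :: 'h \<Rightarrow>\<^sub>L 'h) = 0"
proof -
  have "T = 0"
  proof (rule ccontr)
    assume "T \<noteq> 0"
    have "invertible_op (poly_op [:- (norm T)\<^sup>2, 0, 1:] T)"
      using assms by (intro invertible_poly_op) auto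
    with norm_squared_in_spectrum[OF assms(1) \<open>T \<noteq> 0\<close>] show False by simp
  qed
  have "0 \<notin> real_spectrum T" using assms by simp
  with \<open>T = 0\<close> show ?thesis by (auto simp: real_spectrum_def invertible_op_def comp.zero_left)
qed

text \<open>
  One of \<open>\<plusminus> \<parallel>p(T)\<parallel>\<close> lies in the spectrum of the self-adjoint operator \<open>p(T)\<close>, hence is a value of
  \<open>p\<close> on the spectrum of \<open>T\<close>.
\<close>

lemma norm_poly_op_le:
  fixes T :: "'h::{real_inner,banach} \<Rightarrow>\<^sub>L 'h"
  assumes T: "selfadj T" and c: "c \<ge> 0" "\<And>s. s \<in> real_spectrum T \<Longrightarrow> \<bar>poly p s\<bar> \<le> c"
  shows "norm (poly_op p T) \<le> c"
proof (rule ccontr)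
  define U where "U = poly_op p T"
  define N where "N = norm U"
  assume "\<not> norm (poly_op p T) \<le> c"
  then have N: "N > c" "U \<noteq> 0" using c by (auto simp: N_def U_def)
  have *: "invertible_op (U - r *\<^sub>R id_blinfun)" if "\<bar>r\<bar> = N" for r
  proof -
    have "p \<noteq> [:r:]"
    proof
      assume "p = [:r:]"
      have "real_spectrum T = {}"
        using N that c(2) by (force simp: \<open>p = [:r:]\<close>)
      from spectrum_empty_imp_trivial[OF T this] have "U = 0"
        using op_id(1)[of U] by (simp add: comp.zero_left)
      with N show False by simp
    qed
    then have "invertible_op (poly_op (p - [:r:]) T)"
      using N that c(2) by (intro invertible_poly_op[OF T]) force+
    then show ?thesis by (simp add: poly_op_diff U_def)
  qed
  have "invertible_op ((U - N *\<^sub>R id_blinfun) o\<^sub>L (U - (-N) *\<^sub>R id_blinfun))"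
    using N c by (intro invertible_op_compose *) auto
  moreover have "(U - N *\<^sub>R id_blinfun) o\<^sub>L (U - (-N) *\<^sub>R id_blinfun)
      = (U o\<^sub>L U) - N\<^sup>2 *\<^sub>R id_blinfun"
    by (simp add: op_linear power2_eq_square algebra_simps)
  ultimately show False
    using norm_squared_in_spectrum[of U] N selfadj_poly_op[OF T] by (simp add: N_def U_def)
qed

section \<open>Continuous functional calculus\<close>

lemma poly_approximation:
  fixes f :: "real \<Rightarrow> real"
  assumes "continuous_on {a..b} f"
  obtains p :: "nat \<Rightarrow> real poly" where "uniform_limit {a..b} (\<lambda>n. poly (p n)) f sequentially"
proof -
  have "\<exists>p. \<forall>x\<in>{a..b}. \<bar>f x - poly p x\<bar> < e" if "e > 0" for e
  proof -
    obtain g where g: "real_polynomial_function g" "\<And>x. x \<in> {a..b} \<Longrightarrow> \<bar>f x - g x\<bar> < e"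
      using Stone_Weierstrass_real_polynomial_function[OF compact_Icc assms \<open>e > 0\<close>] by blast
    then obtain c n where "g = (\<lambda>x. \<Sum>i\<le>n. c i * x ^ i)"
      by (auto simp: real_polynomial_function_iff_sum)
    then have "g x = poly (\<Sum>i\<le>n. monom (c i) i) x" for x
      by (simp add: poly_sum poly_monom)
    with g(2) show ?thesis by metis
  qed
  then have "\<forall>n. \<exists>p. \<forall>x\<in>{a..b}. \<bar>f x - poly p x\<bar> < 1 / real (Suc n)"
    by (simp del: of_nat_Suc)
  then obtain p where p: "\<And>n x. x \<in> {a..b} \<Longrightarrow> \<bar>f x - poly (p n) x\<bar> < 1 / real (Suc n)"
    by metis
  have "uniform_limit {a..b} (\<lambda>n. poly (p n)) f sequentially"
  proof (rule uniform_limitI)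
    fix e :: real assume "e > 0"
    then obtain N where N: "1 / real (Suc N) < e" using nat_approx_posE by metis
    show "\<forall>\<^sub>F n in sequentially. \<forall>x\<in>{a..b}. dist (poly (p n) x) (f x) < e"
    proof (rule eventually_sequentiallyI[of N], intro ballI)
      fix n x assume "N \<le> n" "x \<in> {a..b}"
      then have "\<bar>f x - poly (p n) x\<bar> < 1 / real (Suc n)" using p by blast
      also have "\<dots> \<le> 1 / real (Suc N)" using \<open>N \<le> n\<close> by (simp add: frac_le)
      finally show "dist (poly (p n) x) (f x) < e" using N by (simp add: dist_real_def abs_minus_commute)
    qed
  qed
  then show ?thesis by (rule that)
qed

text \<open>
  By the norm estimate, polynomials that are uniformly close on the spectrum have close values at
  \<open>T\<close>. Hence all approximating sequences share one limit, and the definite description in \<open>fun_op\<close>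
  denotes it. From here on, approximation on an interval containing the spectrum is sufficient.
\<close>

lemma fun_op_limit:
  fixes T :: "'h::{real_inner,banach} \<Rightarrow>\<^sub>L 'h"
  assumes T: "between a b T" and f: "continuous_on {a..b} f"
    and p: "uniform_limit {a..b} (\<lambda>n. poly (p n)) f sequentially"
  shows "(\<lambda>n. poly_op (p n) T) \<longlonglongrightarrow> fun_op f T"
proof -
  have sa: "selfadj T" using T by (rule between_selfadj)
  define \<sigma> where "\<sigma> = real_spectrum T"
  have pn: "norm (poly_op q T - poly_op q' T) \<le> 2 * e"
    if "\<And>x. x \<in> \<sigma> \<Longrightarrow> dist (poly q x) (f x) < e" "\<And>x. x \<in> \<sigma> \<Longrightarrow> dist (poly q' x) (f x) < e" "e > 0"
    for q q' e
    unfolding poly_op_diff[symmetric]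
  proof (rule norm_poly_op_le[OF sa])
    fix s assume "s \<in> real_spectrum T"
    then show "\<bar>poly (q - q') s\<bar> \<le> 2 * e"
      using that(1,2)[of s] by (simp add: \<sigma>_def dist_real_def)
  qed (use \<open>e > 0\<close> in simp)
  have close: "(\<lambda>n. poly_op (q n) T - poly_op (q' n) T) \<longlonglongrightarrow> 0"
    if q: "uniform_limit \<sigma> (\<lambda>n. poly (q n)) f sequentially"
      and q': "uniform_limit \<sigma> (\<lambda>n. poly (q' n)) f sequentially" for q q'
  proof (rule LIMSEQ_I)
    fix e :: real assume "e > 0"
    then have e: "e / 3 > 0" by simp
    have "\<forall>\<^sub>F n in sequentially. norm (poly_op (q n) T - poly_op (q' n) T) \<le> 2 * (e / 3)"
      using uniform_limitD[OF q e] uniform_limitD[OF q' e] by eventually_elim (use pn e in blast)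
    then show "\<exists>N. \<forall>n\<ge>N. norm (poly_op (q n) T - poly_op (q' n) T - 0) < e"
      using \<open>e > 0\<close> by (force simp: eventually_sequentially)
  qed
  have p\<sigma>: "uniform_limit \<sigma> (\<lambda>n. poly (p n)) f sequentially"
    using uniform_limit_on_subset[OF p] spectrum_subset[OF T] by (simp add: \<sigma>_def)
  have "Cauchy (\<lambda>n. poly_op (p n) T)"
  proof (rule metric_CauchyI)
    fix e :: real assume "e > 0"
    then have e: "e / 3 > 0" by simp
    obtain N where N: "\<And>n x. n \<ge> N \<Longrightarrow> x \<in> \<sigma> \<Longrightarrow> dist (poly (p n) x) (f x) < e / 3"
      using uniform_limitD[OF p\<sigma> e] by (auto simp: eventually_sequentially)
    have "dist (poly_op (p m) T) (poly_op (p n) T) < e" if "m \<ge> N" "n \<ge> N" for m n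
      using pn[of "p m" "e / 3" "p n"] N that \<open>e > 0\<close> by (force simp: dist_norm)
    then show "\<exists>M. \<forall>m\<ge>M. \<forall>n\<ge>M. dist (poly_op (p m) T) (poly_op (p n) T) < e" by blast
  qed
  then obtain B where B: "(\<lambda>n. poly_op (p n) T) \<longlonglongrightarrow> B"
    by (meson Cauchy_convergent convergent_def)
  have "fun_op f T = B"
    unfolding fun_op_def
  proof (rule the_equality, intro allI impI)
    fix q :: "nat \<Rightarrow> real poly"
    assume "uniform_limit (real_spectrum T) (\<lambda>n. poly (q n)) f sequentially"
    then have "(\<lambda>n. (poly_op (q n) T - poly_op (p n) T) + poly_op (p n) T) \<longlonglongrightarrow> 0 + B"
      using p\<sigma> B by (intro tendsto_add close) (simp_all add: \<sigma>_def)
    then show "(\<lambda>n. poly_op (q n) T) \<longlonglongrightarrow> B" by simp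
  next
    fix C
    assume "\<forall>q. uniform_limit (real_spectrum T) (\<lambda>n. poly (q n)) f sequentially \<longrightarrow>
      (\<lambda>n. poly_op (q n) T) \<longlonglongrightarrow> C"
    then have "(\<lambda>n. poly_op (p n) T) \<longlonglongrightarrow> C" using p\<sigma> by (simp add: \<sigma>_def)
    with B show "C = B" by (metis LIMSEQ_unique)
  qed
  with B show ?thesis by simp
qed

context
  fixes a b :: real and T :: "'h::{real_inner,banach} \<Rightarrow>\<^sub>L 'h"
  assumes T: "between a b T"
begin

lemma fun_op_poly: "fun_op (poly p) T = poly_op p T"
proof -
  have "(\<lambda>n::nat. poly_op p T) \<longlonglongrightarrow> fun_op (poly p) T"
    by (rule fun_op_limit[OF T]) (auto intro!: continuous_intros uniform_limit_const
        simp: uniform_limit_iff)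
  then show ?thesis by (simp add: LIMSEQ_const_iff)
qed

lemma fun_op_cong:
  assumes "continuous_on {a..b} f" "\<And>x. x \<in> {a..b} \<Longrightarrow> f x = g x"
  shows "fun_op f T = fun_op g T"
proof -
  obtain p where p: "uniform_limit {a..b} (\<lambda>n. poly (p n)) f sequentially"
    using poly_approximation[OF assms(1)] by blast
  have g: "continuous_on {a..b} g" using assms by (metis continuous_on_cong)
  have "uniform_limit {a..b} (\<lambda>n. poly (p n)) g sequentially"
    using p by (simp add: uniform_limit_iff assms(2))
  from fun_op_limit[OF T g this] fun_op_limit[OF T assms(1) p] show ?thesis
    by (metis LIMSEQ_unique)
qed

lemma fun_op_const: "fun_op (\<lambda>x. c) T = c *\<^sub>R id_blinfun"
proof -
  have "poly [:c:] = (\<lambda>x. c)" by auto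
  then show ?thesis using fun_op_poly[of "[:c:]"] by (simp add: comp.zero_right)
qed

lemma fun_op_ident: "fun_op (\<lambda>x. x) T = T"
proof -
  have "poly [:0, 1:] = (\<lambda>x. x :: real)" by (simp add: fun_eq_iff)
  then show ?thesis using fun_op_poly[of "[:0, 1:]"] by (simp add: comp.zero_right)
qed

lemma fun_op_add:
  assumes "continuous_on {a..b} f" "continuous_on {a..b} g"
  shows "fun_op (\<lambda>x. f x + g x) T = fun_op f T + fun_op g T"
proof -
  obtain p q where p: "uniform_limit {a..b} (\<lambda>n. poly (p n)) f sequentially"
    and q: "uniform_limit {a..b} (\<lambda>n. poly (q n)) g sequentially"
    using poly_approximation assms by metis
  have "uniform_limit {a..b} (\<lambda>n. poly (p n + q n)) (\<lambda>x. f x + g x) sequentially"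
    using uniform_limit_add[OF p q] by (simp add: uniform_limit_iff)
  then have "(\<lambda>n. poly_op (p n + q n) T) \<longlonglongrightarrow> fun_op (\<lambda>x. f x + g x) T"
    by (intro fun_op_limit[OF T] continuous_intros assms)
  moreover have "(\<lambda>n. poly_op (p n + q n) T) \<longlonglongrightarrow> fun_op f T + fun_op g T"
    unfolding poly_op_add by (intro tendsto_add fun_op_limit[OF T] assms p q)
  ultimately show ?thesis by (rule LIMSEQ_unique)
qed

lemma fun_op_mult:
  assumes "continuous_on {a..b} f" "continuous_on {a..b} g"
  shows "fun_op (\<lambda>x. f x * g x) T = fun_op f T o\<^sub>L fun_op g T"
proof -
  obtain p q where p: "uniform_limit {a..b} (\<lambda>n. poly (p n)) f sequentially"
    and q: "uniform_limit {a..b} (\<lambda>n. poly (q n)) g sequentially"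
    using poly_approximation assms by metis
  have "bounded (f ` {a..b})" "bounded (g ` {a..b})"
    by (intro compact_imp_bounded compact_continuous_image assms compact_Icc)+
  then have "uniform_limit {a..b} (\<lambda>n. poly (p n * q n)) (\<lambda>x. f x * g x) sequentially"
    using bounded_bilinear.bounded_uniform_limit[OF bounded_bilinear_mult p q]
    by (simp add: uniform_limit_iff)
  then have "(\<lambda>n. poly_op (p n * q n) T) \<longlonglongrightarrow> fun_op (\<lambda>x. f x * g x) T"
    by (intro fun_op_limit[OF T] continuous_intros assms)
  moreover have "(\<lambda>n. poly_op (p n * q n) T) \<longlonglongrightarrow> (fun_op f T o\<^sub>L fun_op g T)"
    unfolding poly_op_mult by (intro comp.tendsto fun_op_limit[OF T] assms p q)
  ultimately show ?thesis by (rule LIMSEQ_unique)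
qed

lemma fun_op_cmult:
  assumes "continuous_on {a..b} f"
  shows "fun_op (\<lambda>x. c * f x) T = c *\<^sub>R fun_op f T"
  using fun_op_mult[OF continuous_on_const assms] by (simp add: fun_op_const op_linear)

lemma fun_op_diff:
  assumes "continuous_on {a..b} f" "continuous_on {a..b} g"
  shows "fun_op (\<lambda>x. f x - g x) T = fun_op f T - fun_op g T"
  using fun_op_add[OF assms(1) continuous_on_mult[OF continuous_on_const assms(2)], of "-1"]
    fun_op_cmult[OF assms(2), of "-1"] by simp

lemma selfadj_fun_op: "continuous_on {a..b} f \<Longrightarrow> selfadj (fun_op f T)"
  by (metis poly_approximation fun_op_limit[OF T] selfadj_tendsto selfadj_poly_op between_selfadj[OF T])

lemma norm_fun_op_le:
  assumes f: "continuous_on {a..b} f" and c: "0 \<le> c" "\<And>x. x \<in> {a..b} \<Longrightarrow> \<bar>f x\<bar> \<le> c"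
  shows "norm (fun_op f T) \<le> c"
proof (rule field_le_epsilon)
  fix e :: real assume "e > 0"
  obtain p where p: "uniform_limit {a..b} (\<lambda>n. poly (p n)) f sequentially"
    using poly_approximation[OF f] by blast
  have "\<forall>\<^sub>F n in sequentially. norm (poly_op (p n) T) \<le> c + e"
    using uniform_limitD[OF p \<open>e > 0\<close>]
  proof eventually_elim
    case (elim n)
    show ?case
    proof (rule norm_poly_op_le[OF between_selfadj[OF T]])
      fix s assume "s \<in> real_spectrum T"
      then have "s \<in> {a..b}" using spectrum_subset[OF T] by blast
      then show "\<bar>poly (p n) s\<bar> \<le> c + e"
        using elim[rule_format, of s] c(2)[of s] by (simp add: dist_real_def)
    qed (use c \<open>e > 0\<close> in simp)
  qed
  then show "norm (fun_op f T) \<le> c + e"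
    by (rule tendsto_upperbound[OF tendsto_norm[OF fun_op_limit[OF T f p]]]) simp
qed

text \<open>
  An order bound is a norm bound after subtracting the midpoint of the interval.
\<close>

lemma between_fun_op:
  assumes f: "continuous_on {a..b} f" and "c \<le> d" "\<And>x. x \<in> {a..b} \<Longrightarrow> c \<le> f x \<and> f x \<le> d"
  shows "between c d (fun_op f T)"
proof -
  define m r where "m = (c + d) / 2" and "r = (d - c) / 2"
  have "norm (fun_op (\<lambda>x. f x - m) T) \<le> r"
    using assms by (intro norm_fun_op_le continuous_intros)
      (force simp: m_def r_def abs_le_iff field_simps)+
  then have "norm (fun_op f T - m *\<^sub>R id_blinfun) \<le> r"
    using fun_op_diff[OF f continuous_on_const] by (simp add: fun_op_const)
  then have "between (-r) r (fun_op f T - m *\<^sub>R id_blinfun)"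
    by (intro between_norm selfadj_diff selfadj_fun_op f selfadj_scaleR) simp_all
  then have "(m - r) *\<^sub>R id_blinfun \<sqsubseteq> fun_op f T" "fun_op f T \<sqsubseteq> (m + r) *\<^sub>R id_blinfun"
    by (auto simp: between_def op_le_def op_apply inner_diff_left algebra_simps)
  moreover have "m - r = c" "m + r = d" by (simp_all add: m_def r_def field_simps)
  ultimately show ?thesis using selfadj_fun_op[OF f] by (simp add: between_def)
qed

lemma fun_op_compose:
  assumes f: "continuous_on {a..b} f" and "c \<le> d" "\<And>x. x \<in> {a..b} \<Longrightarrow> c \<le> f x \<and> f x \<le> d"
    and g: "continuous_on {c..d} g"
  shows "fun_op g (fun_op f T) = fun_op (\<lambda>x. g (f x)) T"
proof -
  have fim: "f ` {a..b} \<subseteq> {c..d}" using assms by auto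
  have gf: "continuous_on {a..b} (\<lambda>x. g (f x))"
    using continuous_on_compose2[OF g f fim] .
  have cp: "continuous_on {a..b} (\<lambda>x. poly q (f x))" for q
    by (intro continuous_intros f)
  have poly: "poly_op q (fun_op f T) = fun_op (\<lambda>x. poly q (f x)) T" for q
  proof (induction q)
    case 0
    then show ?case by (simp add: fun_op_const)
  next
    case (pCons e q)
    then show ?case
      by (simp add: fun_op_add fun_op_mult fun_op_const continuous_on_mult f cp)
  qed
  obtain p where p: "uniform_limit {c..d} (\<lambda>n. poly (p n)) g sequentially"
    using poly_approximation[OF g] by blast
  have "(\<lambda>n. poly_op (p n) (fun_op f T)) \<longlonglongrightarrow> fun_op g (fun_op f T)"
    using assms(2,3) by (intro fun_op_limit[OF between_fun_op[OF f] g p])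
  moreover have "(\<lambda>n. poly_op (p n) (fun_op f T)) \<longlonglongrightarrow> fun_op (\<lambda>x. g (f x)) T"
    unfolding poly
  proof (rule LIMSEQ_I)
    fix e :: real assume "e > 0"
    then have e: "e / 2 > 0" by simp
    have "\<forall>\<^sub>F n in sequentially.
        norm (fun_op (\<lambda>x. poly (p n) (f x)) T - fun_op (\<lambda>x. g (f x)) T) \<le> e / 2"
      using uniform_limitD[OF p e]
    proof eventually_elim
      case (elim n)
      have "norm (fun_op (\<lambda>x. poly (p n) (f x) - g (f x)) T) \<le> e / 2"
        using elim fim e
        by (intro norm_fun_op_le continuous_intros f gf) (force simp: dist_real_def)+
      then show ?case by (simp add: fun_op_diff cp gf)
    qed
    then show "\<exists>N. \<forall>n\<ge>N. norm (fun_op (\<lambda>x. poly (p n) (f x)) T - fun_op (\<lambda>x. g (f x)) T) < e"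
      using \<open>e > 0\<close> by (force simp: eventually_sequentially)
  qed
  ultimately show ?thesis by (rule LIMSEQ_unique)
qed

end

lemma fun_op_intertwine:
  fixes T U M :: "'h::{real_inner,banach} \<Rightarrow>\<^sub>L 'h"
  assumes T: "between a b T" and U: "between a b U" and f: "continuous_on {a..b} f"
    and M: "T o\<^sub>L M = M o\<^sub>L U"
  shows "fun_op f T o\<^sub>L M = M o\<^sub>L fun_op f U"
proof -
  obtain p where p: "uniform_limit {a..b} (\<lambda>n. poly (p n)) f sequentially"
    using poly_approximation[OF f] by blast
  have "(\<lambda>n. poly_op (p n) T o\<^sub>L M) \<longlonglongrightarrow> (fun_op f T o\<^sub>L M)"
    by (intro comp.tendsto fun_op_limit[OF T] f p tendsto_const)
  moreover have "(\<lambda>n. M o\<^sub>L poly_op (p n) U) \<longlonglongrightarrow> (M o\<^sub>L fun_op f U)"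
    by (intro comp.tendsto fun_op_limit[OF U] f p tendsto_const)
  ultimately show ?thesis
    unfolding poly_op_intertwine[OF M] by (rule LIMSEQ_unique)
qed

text \<open>
  Polynomials are norm continuous, and \<open>f\<close> is approximated by them uniformly over all operators with
  the same bounds.
\<close>

lemma fun_op_tendsto:
  fixes T :: "nat \<Rightarrow> 'h::{real_inner,banach} \<Rightarrow>\<^sub>L 'h"
  assumes T: "\<forall>\<^sub>F n in sequentially. between a b (T n)" and U: "between a b U"
    and lim: "T \<longlonglongrightarrow> U"
    and f: "continuous_on {a..b} f"
  shows "(\<lambda>n. fun_op f (T n)) \<longlonglongrightarrow> fun_op f U"
proof (rule LIMSEQ_I)
  fix e :: real assume "e > 0"
  then have e: "e / 4 > 0" by simp
  obtain p where p: "uniform_limit {a..b} (\<lambda>n. poly (p n)) f sequentially"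
    using poly_approximation[OF f] by blast
  from eventually_happens'[OF sequentially_bot uniform_limitD[OF p e]]
  obtain q where q: "\<And>x. x \<in> {a..b} \<Longrightarrow> dist (poly q x) (f x) < e / 4" by blast
  have near: "norm (fun_op f V - poly_op q V) \<le> e / 4" if "between a b V"
    for V :: "'h \<Rightarrow>\<^sub>L 'h"
  proof -
    have "norm (fun_op (\<lambda>x. f x - poly q x) V) \<le> e / 4"
      using q e by (intro norm_fun_op_le[OF that] continuous_intros f)
        (force simp: dist_real_def abs_minus_commute)+
    moreover have "fun_op (\<lambda>x. f x - poly q x) V = fun_op f V - poly_op q V"
      by (subst fun_op_diff[OF that f]) (auto intro!: continuous_intros simp: fun_op_poly[OF that])
    ultimately show ?thesis by simp
  qed
  obtain N where N: "\<And>n. n \<ge> N \<Longrightarrow> norm (poly_op q (T n) - poly_op q U) < e / 4"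
    using LIMSEQ_D[OF poly_op_tendsto[OF lim] e] by blast
  obtain N' where N': "\<And>n. n \<ge> N' \<Longrightarrow> between a b (T n)"
    using T by (auto simp: eventually_sequentially)
  have "norm (fun_op f (T n) - fun_op f U) < e" if "n \<ge> max N N'" for n
  proof -
    have "norm (fun_op f (T n) - fun_op f U) \<le> norm (fun_op f (T n) - poly_op q (T n))
        + norm (poly_op q (T n) - poly_op q U) + norm (fun_op f U - poly_op q U)"
      using norm_triangle_ineq[of "fun_op f (T n) - poly_op q (T n)" "poly_op q (T n) - poly_op q U"]
        norm_triangle_ineq4[of "fun_op f (T n) - poly_op q U" "fun_op f U - poly_op q U"]
      by simp
    also have "\<dots> < e"
      using near[OF N', of n] near[OF U] N[of n] that \<open>e > 0\<close> by simp
    finally show ?thesis .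
  qed
  then show "\<exists>N. \<forall>n\<ge>N. norm (fun_op f (T n) - fun_op f U) < e" by blast
qed

section \<open>Functions of positive definite operators\<close>

text \<open>
  Coercivity. For self-adjoint operators this is positive definiteness together with invertibility,
  but it can be read off from bounds alone.
\<close>

definition posdef :: "('h::real_inner \<Rightarrow>\<^sub>L 'h) \<Rightarrow> bool" where
  "posdef T \<longleftrightarrow> (\<exists>a>0. \<exists>b. between a b T)"

lemma posdefI: "between a b T \<Longrightarrow> a > 0 \<Longrightarrow> posdef T"
  by (auto simp: posdef_def)

lemma posdefE:
  assumes "posdef T"
  obtains a b where "0 < a" "a \<le> b" "between a b T"
proof -
  from assms obtain a b where ab: "0 < a" "between a b T" by (auto simp: posdef_def)
  then have "between a (max a b) T" by (auto intro: between_mono)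
  with ab that show ?thesis by (meson max.cobounded1)
qed

lemma posdefE2:
  assumes "posdef S" "posdef T"
  obtains a b where "0 < a" "a \<le> b" "between a b S" "between a b T"
proof -
  obtain a b a' b' where *: "0 < a" "a \<le> b" "between a b S" "0 < a'" "a' \<le> b'" "between a' b' T"
    using assms by (metis posdefE)
  show ?thesis
    by (rule that[of "min a a'" "max b b'"]) (use * in \<open>auto intro: between_mono\<close>)
qed

lemma posdef_selfadj: "posdef T \<Longrightarrow> selfadj T"
  by (auto simp: posdef_def between_def)

lemma posdef_id: "posdef id_blinfun"
  by (rule posdefI[of 1 1]) (auto simp: between_def)

lemma posdef_scaleR: "posdef T \<Longrightarrow> 0 < c \<Longrightarrow> posdef (c *\<^sub>R T)"
proof -
  assume T: "posdef T" and c: "0 < c"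
  then obtain a b where *: "0 < a" "between a b T" by (auto simp: posdef_def)
  then have "between (c * a) (c * b) (c *\<^sub>R T)"
    using op_le_scaleR[of "a *\<^sub>R id_blinfun" T c] op_le_scaleR[of T "b *\<^sub>R id_blinfun" c] c
    by (simp add: between_def selfadj_scaleR)
  then show ?thesis by (rule posdefI) (use * c in simp)
qed

lemma continuous_on_pos:
  fixes f :: "real \<Rightarrow> real"
  assumes "continuous_on {0<..} f" "0 < a"
  shows "continuous_on {a..b} f"
  using assms(2) by (intro continuous_on_subset[OF assms(1)]) auto

lemma fun_op_pos_cong:
  fixes T :: "'h::{real_inner,banach} \<Rightarrow>\<^sub>L 'h"
  assumes "posdef T" "continuous_on {0<..} f" "\<And>x. x > 0 \<Longrightarrow> f x = g x"
  shows "fun_op f T = fun_op g T"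
  using assms by (elim posdefE) (rule fun_op_cong, auto intro: continuous_on_pos)

lemma fun_op_pos_mult:
  fixes T :: "'h::{real_inner,banach} \<Rightarrow>\<^sub>L 'h"
  assumes "posdef T" "continuous_on {0<..} f" "continuous_on {0<..} g"
  shows "fun_op (\<lambda>x. f x * g x) T = fun_op f T o\<^sub>L fun_op g T"
  using assms by (elim posdefE) (rule fun_op_mult, auto intro: continuous_on_pos)

lemma fun_op_pos_bounds:
  fixes T :: "'h::{real_inner,banach} \<Rightarrow>\<^sub>L 'h" and f :: "real \<Rightarrow> real"
  assumes "posdef T" and f: "continuous_on {0<..} f" "\<And>x. x > 0 \<Longrightarrow> f x > 0"
  obtains a b c d where "0 < a" "between a b T" "0 < c" "c \<le> d"
    "\<And>x. x \<in> {a..b} \<Longrightarrow> c \<le> f x \<and> f x \<le> d" "continuous_on {a..b} f"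
proof -
  obtain a b where ab: "0 < a" "a \<le> b" "between a b T" using assms(1) by (rule posdefE)
  have cont: "continuous_on {a..b} f" using f(1) ab(1) by (rule continuous_on_pos)
  obtain x where x: "x \<in> {a..b}" "\<And>y. y \<in> {a..b} \<Longrightarrow> f x \<le> f y"
    using continuous_attains_inf[OF compact_Icc _ cont] ab by auto
  obtain z where z: "z \<in> {a..b}" "\<And>y. y \<in> {a..b} \<Longrightarrow> f y \<le> f z"
    using continuous_attains_sup[OF compact_Icc _ cont] ab by auto
  show ?thesis
    by (rule that[of a b "f x" "f z"]) (use ab x z cont f(2) in auto)
qed

lemma posdef_fun_op:
  fixes T :: "'h::{real_inner,banach} \<Rightarrow>\<^sub>L 'h"
  assumes "posdef T" "continuous_on {0<..} f" "\<And>x. x > 0 \<Longrightarrow> f x > 0"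
  shows "posdef (fun_op f T)"
  using assms
proof (rule fun_op_pos_bounds)
  fix a b c d :: real
  assume *: "0 < a" "between a b T" "0 < c" "c \<le> d"
    "\<And>x. x \<in> {a..b} \<Longrightarrow> c \<le> f x \<and> f x \<le> d" "continuous_on {a..b} f"
  show ?thesis by (rule posdefI[OF between_fun_op[OF *(2,6,4,5)] *(3)])
qed

lemma fun_op_pos_compose:
  fixes T :: "'h::{real_inner,banach} \<Rightarrow>\<^sub>L 'h"
  assumes "posdef T" "continuous_on {0<..} f" "\<And>x. x > 0 \<Longrightarrow> f x > 0" and g: "continuous_on {0<..} g"
  shows "fun_op g (fun_op f T) = fun_op (\<lambda>x. g (f x)) T"
  using assms(1-3)
proof (rule fun_op_pos_bounds)
  fix a b c d :: real
  assume *: "0 < a" "between a b T" "0 < c" "c \<le> d"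
    "\<And>x. x \<in> {a..b} \<Longrightarrow> c \<le> f x \<and> f x \<le> d" "continuous_on {a..b} f"
  show ?thesis
    using fun_op_compose[OF *(2) *(6) *(4) *(5) continuous_on_pos[OF g \<open>0 < c\<close>]] .
qed

lemma fun_op_pos_intertwine:
  fixes T U M :: "'h::{real_inner,banach} \<Rightarrow>\<^sub>L 'h"
  assumes "posdef T" "posdef U" "continuous_on {0<..} f" "T o\<^sub>L M = M o\<^sub>L U"
  shows "fun_op f T o\<^sub>L M = M o\<^sub>L fun_op f U"
proof -
  obtain a b where ab: "0 < a" "between a b T" "between a b U" using assms by (metis posdefE2)
  show ?thesis
    by (rule fun_op_intertwine[OF ab(2,3) continuous_on_pos[OF assms(3) ab(1)] assms(4)])
qed

lemma continuous_on_powr_pos [continuous_intros]: "continuous_on {0<..} (\<lambda>x::real. x powr t)"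
  by (intro continuous_on_powr' continuous_intros) auto

lemma continuous_on_ln_pos [continuous_intros]: "continuous_on {0<..} (ln :: real \<Rightarrow> real)"
  by (intro continuous_on_ln continuous_intros) auto

lemma posdef_powr_op:
  fixes T :: "'h::{real_inner,banach} \<Rightarrow>\<^sub>L 'h"
  shows "posdef T \<Longrightarrow> posdef (powr_op T t)"
  unfolding powr_op_def by (intro posdef_fun_op continuous_intros) auto

lemma powr_op_add:
  fixes T :: "'h::{real_inner,banach} \<Rightarrow>\<^sub>L 'h"
  shows "posdef T \<Longrightarrow> powr_op T s o\<^sub>L powr_op T t = powr_op T (s + t)"
  unfolding powr_op_def powr_add
  by (rule fun_op_pos_mult[symmetric]) (auto intro!: continuous_intros)

lemma powr_op_1:
  fixes T :: "'h::{real_inner,banach} \<Rightarrow>\<^sub>L 'h"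
  assumes "posdef T"
  shows "powr_op T 1 = T"
proof -
  have "powr_op T 1 = fun_op (\<lambda>x. x) T"
    unfolding powr_op_def by (rule fun_op_pos_cong[OF assms]) (auto intro!: continuous_intros)
  with assms show ?thesis by (metis posdefE fun_op_ident)
qed

lemma powr_op_0:
  fixes T :: "'h::{real_inner,banach} \<Rightarrow>\<^sub>L 'h"
  assumes "posdef T"
  shows "powr_op T 0 = id_blinfun"
proof -
  have "powr_op T 0 = fun_op (\<lambda>x. 1) T"
    unfolding powr_op_def by (rule fun_op_pos_cong[OF assms continuous_on_powr_pos]) simp
  with assms show ?thesis by (metis posdefE fun_op_const scaleR_one)
qed

lemma powr_op_scaleR:
  fixes T :: "'h::{real_inner,banach} \<Rightarrow>\<^sub>L 'h"
  assumes T: "posdef T" and c: "c > 0"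
  shows "powr_op (c *\<^sub>R T) t = (c powr t) *\<^sub>R powr_op T t"
proof -
  obtain a b where ab: "0 < a" "between a b T" using T by (rule posdefE)
  have "c *\<^sub>R T = fun_op (\<lambda>x. c * x) T"
    using fun_op_cmult[OF ab(2), of "\<lambda>x. x"] fun_op_ident[OF ab(2)] by (simp add: continuous_on_id)
  then have "powr_op (c *\<^sub>R T) t = fun_op (\<lambda>x. (c * x) powr t) T"
    unfolding powr_op_def using c
    by (simp add: fun_op_pos_compose[OF T, of "\<lambda>x. c * x"] continuous_intros)
  also have "\<dots> = fun_op (\<lambda>x. c powr t * x powr t) T"
    by (rule fun_op_pos_cong[OF T])
      (use c in \<open>auto intro!: continuous_on_powr' continuous_intros simp: powr_mult\<close>)
  also have "\<dots> = (c powr t) *\<^sub>R powr_op T t"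
    unfolding powr_op_def
    by (rule fun_op_cmult[OF ab(2) continuous_on_pos[OF continuous_on_powr_pos ab(1)]])
  finally show ?thesis .
qed

lemma fun_op_id:
  "fun_op f id_blinfun = f 1 *\<^sub>R (id_blinfun :: 'h::{real_inner,banach} \<Rightarrow>\<^sub>L 'h)"
proof -
  have b: "between 1 1 (id_blinfun :: 'h \<Rightarrow>\<^sub>L 'h)" by (simp add: between_def)
  have "fun_op f id_blinfun = fun_op (\<lambda>x. f 1) (id_blinfun :: 'h \<Rightarrow>\<^sub>L 'h)"
    by (rule fun_op_cong[OF b]) auto
  then show ?thesis by (simp add: fun_op_const[OF b])
qed

definition sqrt_op :: "('h::real_normed_vector \<Rightarrow>\<^sub>L 'h) \<Rightarrow> ('h \<Rightarrow>\<^sub>L 'h)" where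
  "sqrt_op T = powr_op T (1/2)"

definition isqrt_op :: "('h::real_normed_vector \<Rightarrow>\<^sub>L 'h) \<Rightarrow> ('h \<Rightarrow>\<^sub>L 'h)" where
  "isqrt_op T = powr_op T (-1/2)"

context
  fixes T :: "'h::{real_inner,banach} \<Rightarrow>\<^sub>L 'h"
  assumes T: "posdef T"
begin

lemma sqrt_op_sqrt_op: "sqrt_op T o\<^sub>L sqrt_op T = T"
  unfolding sqrt_op_def by (simp add: powr_op_add T powr_op_1)

lemma sqrt_op_isqrt_op: "sqrt_op T o\<^sub>L isqrt_op T = id_blinfun"
  unfolding sqrt_op_def isqrt_op_def by (simp add: powr_op_add T powr_op_0)

lemma isqrt_op_sqrt_op: "isqrt_op T o\<^sub>L sqrt_op T = id_blinfun"
  unfolding sqrt_op_def isqrt_op_def by (simp add: powr_op_add T powr_op_0)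

lemma selfadj_sqrt_op: "selfadj (sqrt_op T)"
  by (simp add: sqrt_op_def posdef_selfadj posdef_powr_op T)

lemma selfadj_isqrt_op: "selfadj (isqrt_op T)"
  by (simp add: isqrt_op_def posdef_selfadj posdef_powr_op T)

lemma sqrt_op_cancel:
  "sqrt_op T o\<^sub>L (isqrt_op T o\<^sub>L S) = S" "isqrt_op T o\<^sub>L (sqrt_op T o\<^sub>L S) = S"
  "sqrt_op T o\<^sub>L (sqrt_op T o\<^sub>L S) = T o\<^sub>L S"
  by (simp_all add: op_assoc[symmetric] sqrt_op_isqrt_op isqrt_op_sqrt_op sqrt_op_sqrt_op)

end

section \<open>Operator perspectives\<close>

text \<open>
  The operator \<open>B\<close> seen in the coordinates that make \<open>A\<close> the identity; congruence by the square root
  of \<open>A\<close> goes back.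
\<close>

definition whiten :: "('h::real_normed_vector \<Rightarrow>\<^sub>L 'h) \<Rightarrow> ('h \<Rightarrow>\<^sub>L 'h) \<Rightarrow> ('h \<Rightarrow>\<^sub>L 'h)" where
  "whiten A B = isqrt_op A o\<^sub>L B o\<^sub>L isqrt_op A"

text \<open>The perspective of \<open>f\<close>; for commuting operators it is \<open>A f(B / A)\<close>.\<close>

definition perspective ::
  "(real \<Rightarrow> real) \<Rightarrow> ('h::real_normed_vector \<Rightarrow>\<^sub>L 'h) \<Rightarrow> ('h \<Rightarrow>\<^sub>L 'h) \<Rightarrow> ('h \<Rightarrow>\<^sub>L 'h)" where
  "perspective f A B = sqrt_op A o\<^sub>L fun_op f (whiten A B) o\<^sub>L sqrt_op A"

lemma geodesic_perspective: "geodesic A t B = perspective (\<lambda>x. x powr t) A B"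
  by (simp add: geodesic_def perspective_def whiten_def sqrt_op_def isqrt_op_def powr_op_def)

lemma log_at_perspective: "log_at X A = perspective ln X A"
  by (simp add: log_at_def perspective_def whiten_def sqrt_op_def isqrt_op_def log_op_def)

lemma thompson_dist_whiten: "thompson_dist A B = norm (fun_op ln (whiten A B))"
  by (simp add: thompson_dist_def whiten_def isqrt_op_def log_op_def)

lemma between_whiten:
  fixes A B :: "'h::{real_inner,banach} \<Rightarrow>\<^sub>L 'h"
  assumes A: "posdef A" and B: "selfadj B" and "a *\<^sub>R A \<sqsubseteq> B" "B \<sqsubseteq> b *\<^sub>R A"
  shows "between a b (whiten A B)"
  unfolding whiten_def
  by (rule between_conj[OF B selfadj_sqrt_op[OF A] _ _ selfadj_isqrt_op[OF A]])
    (use assms in \<open>simp_all add: sqrt_op_sqrt_op sqrt_op_isqrt_op isqrt_op_sqrt_op\<close>)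

lemma posdef_whiten:
  fixes A B :: "'h::{real_inner,banach} \<Rightarrow>\<^sub>L 'h"
  assumes A: "posdef A" and B: "posdef B"
  shows "posdef (whiten A B)"
proof -
  obtain a b where ab: "0 < a" "a \<le> b" "between a b A" "between a b B"
    using assms by (rule posdefE2)
  have "(a / b) *\<^sub>R A \<sqsubseteq> B"
  proof -
    have "(a / b) *\<^sub>R A \<sqsubseteq> (a / b) *\<^sub>R (b *\<^sub>R id_blinfun)"
      using ab by (intro op_le_scaleR) (auto simp: between_def)
    also have "\<dots> \<sqsubseteq> B" using ab by (simp add: between_def)
    finally show ?thesis .
  qed
  moreover have "B \<sqsubseteq> (b / a) *\<^sub>R A"
  proof -
    have "B \<sqsubseteq> (b / a) *\<^sub>R (a *\<^sub>R id_blinfun)" using ab by (simp add: between_def)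
    also have "\<dots> \<sqsubseteq> (b / a) *\<^sub>R A" using ab by (intro op_le_scaleR) (auto simp: between_def)
    finally show ?thesis .
  qed
  ultimately have "between (a / b) (b / a) (whiten A B)"
    by (intro between_whiten A posdef_selfadj[OF B])
  then show ?thesis by (rule posdefI) (use ab in simp)
qed

lemma posdef_conj_sqrt:
  fixes A T :: "'h::{real_inner,banach} \<Rightarrow>\<^sub>L 'h"
  assumes A: "posdef A" and T: "posdef T"
  shows "posdef (sqrt_op A o\<^sub>L T o\<^sub>L sqrt_op A)"
proof -
  obtain a b where ab: "0 < a" "a \<le> b" "between a b A" "between a b T"
    using assms by (rule posdefE2)
  have conj: "sqrt_op A o\<^sub>L (c *\<^sub>R id_blinfun) o\<^sub>L sqrt_op A = c *\<^sub>R A" for c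
    by (simp add: op_linear sqrt_op_sqrt_op A)
  have "(a * a) *\<^sub>R id_blinfun \<sqsubseteq> a *\<^sub>R A"
    using op_le_scaleR[of "a *\<^sub>R id_blinfun" A a] ab by (simp add: between_def)
  also have "\<dots> \<sqsubseteq> sqrt_op A o\<^sub>L T o\<^sub>L sqrt_op A"
    using op_le_conj[of "a *\<^sub>R id_blinfun" T "sqrt_op A"] ab
    by (simp add: conj selfadj_sqrt_op A between_def)
  finally have 1: "(a * a) *\<^sub>R id_blinfun \<sqsubseteq> sqrt_op A o\<^sub>L T o\<^sub>L sqrt_op A" .
  have "sqrt_op A o\<^sub>L T o\<^sub>L sqrt_op A \<sqsubseteq> b *\<^sub>R A"
    using op_le_conj[of T "b *\<^sub>R id_blinfun" "sqrt_op A"] ab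
    by (simp add: conj selfadj_sqrt_op A between_def)
  also have "\<dots> \<sqsubseteq> (b * b) *\<^sub>R id_blinfun"
    using op_le_scaleR[of A "b *\<^sub>R id_blinfun" b] ab by (simp add: between_def)
  finally have "sqrt_op A o\<^sub>L T o\<^sub>L sqrt_op A \<sqsubseteq> (b * b) *\<^sub>R id_blinfun" .
  with 1 have "between (a * a) (b * b) (sqrt_op A o\<^sub>L T o\<^sub>L sqrt_op A)"
    by (simp add: between_def selfadj_conj selfadj_sqrt_op[OF A] posdef_selfadj[OF T])
  then show ?thesis by (rule posdefI) (use ab in simp)
qed

text \<open>
  Put \<open>M = isqrt_op A o\<^sub>L sqrt_op B\<close>, with adjoint \<open>N\<close>. The two whitened operators are \<open>M N\<close> and the
  inverse of \<open>N M\<close>, and functions of \<open>M N\<close> and \<open>N M\<close> are intertwined by \<open>M\<close>. The gain is that the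
  argument that is going to vary can be moved to the second place, where a perspective depends on it
  through one linear map followed by one function.
\<close>

lemma perspective_swap:
  fixes A B :: "'h::{real_inner,banach} \<Rightarrow>\<^sub>L 'h"
  assumes A: "posdef A" and B: "posdef B" and f: "continuous_on {0<..} f"
  shows "perspective f A B = perspective (\<lambda>y. y * f (1 / y)) B A"
proof -
  define M V where "M = isqrt_op A o\<^sub>L sqrt_op B" and "V = whiten B A"
  have V: "posdef V" unfolding V_def using B A by (rule posdef_whiten)
  have inv: "continuous_on {0<..} (\<lambda>y::real. 1 / y)" by (intro continuous_intros) auto
  define U where "U = fun_op (\<lambda>y. 1 / y) V"
  have U: "posdef U" unfolding U_def using V inv by (rule posdef_fun_op) simp
  have cf: "continuous_on {0<..} (\<lambda>y. f (1 / y))"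
    by (rule continuous_on_compose2[OF f inv]) auto
  obtain a b where ab: "0 < a" "between a b V" using V by (rule posdefE)
  have "U o\<^sub>L V = fun_op (\<lambda>y. 1 / y * y) V"
    unfolding U_def using fun_op_ident[OF ab(2)]
    by (simp only: fun_op_pos_mult[OF V inv continuous_on_id])
  also have "\<dots> = fun_op (\<lambda>y. 1) V"
    by (rule fun_op_pos_cong[OF V continuous_on_mult[OF inv continuous_on_id]]) simp
  also have "\<dots> = id_blinfun" using fun_op_const[OF ab(2)] by simp
  finally have UV: "U o\<^sub>L V = id_blinfun" .
  \<comment> \<open>\<open>U\<close> is the other product of the two factors of \<open>whiten A B\<close>, as both are inverse to \<open>V\<close>.\<close>
  define U' where "U' = sqrt_op B o\<^sub>L isqrt_op A o\<^sub>L M"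
  have MV: "M o\<^sub>L (V o\<^sub>L sqrt_op B) = sqrt_op A"
  proof -
    have "M o\<^sub>L (V o\<^sub>L sqrt_op B) = isqrt_op A o\<^sub>L A"
      by (simp add: M_def V_def whiten_def op_assoc sqrt_op_cancel[OF B] isqrt_op_sqrt_op[OF B])
    also have "\<dots> = isqrt_op A o\<^sub>L (sqrt_op A o\<^sub>L sqrt_op A)"
      by (simp add: sqrt_op_sqrt_op[OF A])
    finally show ?thesis by (simp only: sqrt_op_cancel[OF A])
  qed
  have "V o\<^sub>L U' = isqrt_op B o\<^sub>L (A o\<^sub>L (isqrt_op A o\<^sub>L M))"
    by (simp add: U'_def V_def whiten_def op_assoc sqrt_op_cancel[OF B])
  also have "\<dots> = isqrt_op B o\<^sub>L (sqrt_op A o\<^sub>L (sqrt_op A o\<^sub>L (isqrt_op A o\<^sub>L M)))"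
    by (simp only: sqrt_op_cancel(3)[OF A])
  also have "\<dots> = id_blinfun"
    by (simp add: M_def sqrt_op_cancel[OF A] isqrt_op_sqrt_op[OF B])
  finally have "U' = U" using UV by (metis op_assoc op_id)
  have "sqrt_op B o\<^sub>L sqrt_op B = B" by (rule sqrt_op_sqrt_op[OF B])
  have WM: "whiten A B o\<^sub>L M = M o\<^sub>L U"
    unfolding \<open>U' = U\<close>[symmetric] U'_def
    by (simp add: whiten_def M_def op_assoc sqrt_op_cancel(3)[OF B])
  have "fun_op (\<lambda>y. y * f (1 / y)) V = fun_op (\<lambda>y. f (1 / y) * y) V"
    by (simp add: mult.commute)
  also have "\<dots> = fun_op f U o\<^sub>L V"
    unfolding U_def using fun_op_ident[OF ab(2)]
    by (simp add: fun_op_pos_mult[OF V cf continuous_on_id] fun_op_pos_compose[OF V inv _ f])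
  finally have "perspective (\<lambda>y. y * f (1 / y)) B A
      = sqrt_op A o\<^sub>L ((M o\<^sub>L fun_op f U) o\<^sub>L (V o\<^sub>L sqrt_op B))"
    by (simp add: perspective_def V_def[symmetric] M_def op_assoc sqrt_op_cancel[OF A])
  also have "M o\<^sub>L fun_op f U = fun_op f (whiten A B) o\<^sub>L M"
    by (rule fun_op_pos_intertwine[OF posdef_whiten[OF A B] U f WM, symmetric])
  also have "sqrt_op A o\<^sub>L (\<dots> o\<^sub>L (V o\<^sub>L sqrt_op B)) = perspective f A B"
    by (simp add: op_assoc MV perspective_def)
  finally show ?thesis ..
qed

lemma perspective_pos_cong:
  fixes A B :: "'h::{real_inner,banach} \<Rightarrow>\<^sub>L 'h"
  assumes "posdef A" "posdef B" "continuous_on {0<..} f" "\<And>x. x > 0 \<Longrightarrow> f x = g x"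
  shows "perspective f A B = perspective g A B"
  unfolding perspective_def
  using fun_op_pos_cong[OF posdef_whiten[OF assms(1,2)] assms(3,4)] by simp

lemma geodesic_swap:
  fixes A X :: "'h::{real_inner,banach} \<Rightarrow>\<^sub>L 'h"
  assumes "posdef X" "posdef A"
  shows "geodesic X t A = perspective (\<lambda>y. y powr (1 - t)) A X"
proof -
  have "geodesic X t A = perspective (\<lambda>y. y * (1 / y) powr t) A X"
    unfolding geodesic_perspective by (rule perspective_swap) (use assms in \<open>auto intro: continuous_intros\<close>)
  also have "\<dots> = perspective (\<lambda>y. y powr (1 - t)) A X"
    by (rule perspective_pos_cong)
      (use assms in \<open>auto intro!: continuous_intros simp: powr_diff powr_divide\<close>)
  finally show ?thesis .
qed

lemma log_at_swap:
  fixes A X :: "'h::{real_inner,banach} \<Rightarrow>\<^sub>L 'h"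
  assumes "posdef X" "posdef A"
  shows "log_at X A = perspective (\<lambda>y. y * ln (1 / y)) A X"
  unfolding log_at_perspective
  by (rule perspective_swap) (use assms in \<open>auto intro: continuous_intros\<close>)

lemma posdef_geodesic:
  fixes A X :: "'h::{real_inner,banach} \<Rightarrow>\<^sub>L 'h"
  shows "posdef X \<Longrightarrow> posdef A \<Longrightarrow> posdef (geodesic X t A)"
  unfolding geodesic_perspective perspective_def
  by (intro posdef_conj_sqrt posdef_fun_op posdef_whiten continuous_intros) auto

section \<open>Operator monotonicity of powers\<close>

lemma norm_compose_selfadj_le:
  fixes P R :: "'h::{real_inner,banach} \<Rightarrow>\<^sub>L 'h"
  assumes P: "selfadj P" and R: "selfadj R"
  shows "norm (P o\<^sub>L R) \<le> norm (R o\<^sub>L P)"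
proof (rule norm_blinfun_bound)
  fix x
  have "norm (P (R x)) * norm (P (R x)) = inner (P (R x)) (P (R x))"
    by (simp only: power2_norm_eq_inner[symmetric] power2_eq_square)
  also have "\<dots> = inner ((R o\<^sub>L P) (P (R x))) x"
    by (simp add: selfadjD[OF P, of "P (R x)"] selfadjD[OF R, of "P (P (R x))"])
  also have "\<dots> \<le> norm ((R o\<^sub>L P) (P (R x))) * norm x" by (rule norm_cauchy_schwarz)
  also have "\<dots> \<le> norm (R o\<^sub>L P) * norm (P (R x)) * norm x"
    by (intro mult_right_mono norm_blinfun) simp
  finally have "norm (P (R x)) * norm (P (R x)) \<le> norm (P (R x)) * (norm (R o\<^sub>L P) * norm x)"
    by (simp add: mult_ac)
  then show "norm ((P o\<^sub>L R) x) \<le> norm (R o\<^sub>L P) * norm x"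
    by (cases "P (R x) = 0") simp_all
qed simp

context
  fixes S T :: "'h::{real_inner,banach} \<Rightarrow>\<^sub>L 'h"
  assumes S: "posdef S" and T: "posdef T"
begin

lemma powr_op_le_imp_norm:
  assumes "powr_op S t \<sqsubseteq> powr_op T t"
  shows "norm (powr_op S (t/2) o\<^sub>L powr_op T (-t/2)) \<le> 1"
proof (rule norm_blinfun_bound)
  fix x
  define y where "y = powr_op T (-t/2) x"
  have x: "x = powr_op T (t/2) y"
    using arg_cong[OF powr_op_add[OF T, of "t/2" "-t/2"], of "\<lambda>U. U x"]
    unfolding y_def by (simp add: powr_op_0[OF T])
  have half: "(norm (powr_op U (t/2) y))\<^sup>2 = inner (powr_op U t y) y"
    if "posdef U" for U :: "'h \<Rightarrow>\<^sub>L 'h"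
  proof -
    have "powr_op U (t/2) (powr_op U (t/2) y) = powr_op U t y"
      using arg_cong[OF powr_op_add[OF that, of "t/2" "t/2"], of "\<lambda>U. U y"] by simp
    then show ?thesis
      using selfadjD[OF posdef_selfadj[OF posdef_powr_op[OF that, of "t/2"]], of "powr_op U (t/2) y" y]
      by (simp add: power2_norm_eq_inner)
  qed
  have "(norm (powr_op S (t/2) y))\<^sup>2 \<le> (norm x)\<^sup>2"
    unfolding x half[OF S] half[OF T] using assms by (simp add: op_le_def)
  then have "norm (powr_op S (t/2) y) \<le> norm x" by (rule power2_le_imp_le) simp
  then show "norm ((powr_op S (t/2) o\<^sub>L powr_op T (-t/2)) x) \<le> 1 * norm x"
    by (simp add: y_def)
qed simp

text \<open>
  Pedersen's argument. Let \<open>u = (s + t)/2\<close>. The self-adjoint operator \<open>Q = T^(-u/2) S^u T^(-u/2)\<close> is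
  similar to \<open>(T^(-s/2) S^(s/2)) (S^(t/2) T^(-t/2))\<close>, a product of two contractions. The norm of a
  self-adjoint operator is its spectral radius, which is invariant under similarity, so \<open>Q\<close> is a
  contraction too, and this is the claim for \<open>u\<close>.
\<close>

lemma powr_op_le_midpoint:
  assumes s: "powr_op S s \<sqsubseteq> powr_op T s" and t: "powr_op S t \<sqsubseteq> powr_op T t"
  shows "powr_op S ((s + t) / 2) \<sqsubseteq> powr_op T ((s + t) / 2)"
proof -
  define u where "u = (s + t) / 2"
  define Z where "Z = (powr_op T (-s/2) o\<^sub>L powr_op S (s/2)) o\<^sub>L (powr_op S (t/2) o\<^sub>L powr_op T (-t/2))"
  define Q where "Q = powr_op T (-u/2) o\<^sub>L powr_op S u o\<^sub>L powr_op T (-u/2)"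
  define C D where "C = powr_op T ((u - s)/2)" and "D = powr_op T ((s - u)/2)"
  have sa: "selfadj (powr_op S r)" "selfadj (powr_op T r)" for r
    by (simp_all add: posdef_selfadj posdef_powr_op S T)
  have Q: "selfadj Q" unfolding Q_def by (intro selfadj_conj sa)
  have "norm (powr_op T (-s/2) o\<^sub>L powr_op S (s/2)) \<le> norm (powr_op S (s/2) o\<^sub>L powr_op T (-s/2))"
    by (rule norm_compose_selfadj_le[OF sa(2) sa(1)])
  also have "\<dots> \<le> 1" by (rule powr_op_le_imp_norm[OF s])
  finally have "norm Z \<le> 1 * 1"
    unfolding Z_def using powr_op_le_imp_norm[OF t]
    by (intro order_trans[OF norm_blinfun_compose[of "powr_op T (-s/2) o\<^sub>L powr_op S (s/2)"]]
        mult_mono) simp_all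
  have CD: "C o\<^sub>L D = id_blinfun" "D o\<^sub>L C = id_blinfun"
    by (simp_all add: C_def D_def powr_op_add T powr_op_0 add_divide_distrib[symmetric])
  have "Z = powr_op T (-s/2) o\<^sub>L (powr_op S (s/2) o\<^sub>L powr_op S (t/2)) o\<^sub>L powr_op T (-t/2)"
    by (simp only: Z_def op_assoc)
  also have "powr_op S (s/2) o\<^sub>L powr_op S (t/2) = powr_op S u"
    by (simp add: powr_op_add S u_def add_divide_distrib)
  also have "powr_op T (-s/2) = C o\<^sub>L powr_op T (-u/2)"
    by (simp add: C_def powr_op_add T diff_divide_distrib)
  also have "powr_op T (-t/2) = powr_op T (-u/2) o\<^sub>L D"
    by (simp add: D_def powr_op_add T u_def field_simps)
  finally have ZQ: "Z = C o\<^sub>L (Q o\<^sub>L D)" by (simp only: Q_def op_assoc)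
  have "norm Q \<le> 1"
  proof (rule ccontr)
    define N where "N = norm Q"
    assume "\<not> norm Q \<le> 1"
    then have N: "N > 1" "Q \<noteq> 0" by (auto simp: N_def)
    have "norm (Z o\<^sub>L Z) \<le> norm Z * norm Z" by (rule norm_blinfun_compose)
    also have "\<dots> \<le> 1 * 1" using \<open>norm Z \<le> 1 * 1\<close> by (intro mult_mono) auto
    also have "\<dots> < N\<^sup>2" using N by simp
    finally have "invertible_op (N\<^sup>2 *\<^sub>R id_blinfun - (Z o\<^sub>L Z))"
      by (rule invertible_op_scaleR_id_minus)
    from invertible_op_scaleR[OF invertible_op_similar[OF this CD(2,1)], of "-1"]
    have "invertible_op (- (D o\<^sub>L (N\<^sup>2 *\<^sub>R id_blinfun - (Z o\<^sub>L Z)) o\<^sub>L C))" by simp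
    moreover have "D o\<^sub>L (Z o\<^sub>L Z) o\<^sub>L C = Q o\<^sub>L Q"
    proof -
      have "D o\<^sub>L (Z o\<^sub>L Z) o\<^sub>L C = (D o\<^sub>L C) o\<^sub>L Q o\<^sub>L (D o\<^sub>L C) o\<^sub>L Q o\<^sub>L (D o\<^sub>L C)"
        by (simp only: ZQ op_assoc)
      then show ?thesis by (simp add: CD)
    qed
    ultimately have "invertible_op ((Q o\<^sub>L Q) - N\<^sup>2 *\<^sub>R id_blinfun)"
      by (simp add: op_linear CD)
    with norm_squared_in_spectrum[OF Q \<open>Q \<noteq> 0\<close>] show False by (simp add: N_def)
  qed
  then have "Q \<sqsubseteq> 1 *\<^sub>R id_blinfun"
    using op_le_norm(1)[of Q] op_le_id_mono by (meson op_le_trans)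
  from op_le_conj[OF this sa(2), of "u/2"]
  have "(powr_op T (u/2) o\<^sub>L powr_op T (-u/2)) o\<^sub>L powr_op S u o\<^sub>L (powr_op T (-u/2) o\<^sub>L powr_op T (u/2))
      \<sqsubseteq> powr_op T (u/2) o\<^sub>L powr_op T (u/2)"
    by (simp add: Q_def op_assoc)
  then show ?thesis
    unfolding u_def[symmetric] by (simp add: powr_op_add T powr_op_0)
qed

end

lemma abs_exp_minus_1_le: "\<bar>exp u - 1\<bar> \<le> exp \<bar>u\<bar> - 1" for u :: real
proof (cases "u \<ge> 0")
  case False
  have "2 - exp u \<le> 1 / exp u"
    using zero_le_power2[of "exp u - 1"] by (simp add: field_simps power2_eq_square)
  with False show ?thesis by (simp add: exp_minus field_simps)
qed simp

lemma powr_op_tendsto: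
  fixes T :: "'h::{real_inner,banach} \<Rightarrow>\<^sub>L 'h"
  assumes T: "posdef T" and r: "r \<longlonglongrightarrow> t"
  shows "(\<lambda>n. powr_op T (r n)) \<longlonglongrightarrow> powr_op T t"
proof -
  obtain a b where ab: "0 < a" "a \<le> b" "between a b T" using T by (rule posdefE)
  define L where "L = max \<bar>ln a\<bar> \<bar>ln b\<bar>"
  have L: "\<bar>ln x\<bar> \<le> L" if "x \<in> {a..b}" for x
  proof -
    have "ln a \<le> ln x" "ln x \<le> ln b" using that ab(1) by auto
    then show ?thesis by (auto simp: L_def)
  qed
  have bd: "norm (powr_op T (r n) - powr_op T t) \<le> exp (\<bar>t\<bar> * L) * (exp (\<bar>r n - t\<bar> * L) - 1)" for n
  proof -
    have c: "continuous_on {a..b} (\<lambda>x. x powr s)" for s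
      by (rule continuous_on_pos[OF continuous_on_powr_pos ab(1)])
    have "norm (fun_op (\<lambda>x. x powr r n - x powr t) T) \<le> exp (\<bar>t\<bar> * L) * (exp (\<bar>r n - t\<bar> * L) - 1)"
    proof (rule norm_fun_op_le[OF ab(3) continuous_on_diff[OF c c]])
      have "0 \<le> L" by (simp add: L_def le_max_iff_disj)
      then show "0 \<le> exp (\<bar>t\<bar> * L) * (exp (\<bar>r n - t\<bar> * L) - 1)" by simp
      fix x assume x: "x \<in> {a..b}"
      then have "x > 0" using ab by auto
      have le: "\<bar>s * ln x\<bar> \<le> \<bar>s\<bar> * L" for s
        using L[OF x] by (simp add: abs_mult mult_left_mono)
      have "x powr r n - x powr t = x powr t * (exp ((r n - t) * ln x) - 1)"
        using \<open>x > 0\<close> by (simp add: powr_def algebra_simps exp_add[symmetric])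
      then have "\<bar>x powr r n - x powr t\<bar> = exp (t * ln x) * \<bar>exp ((r n - t) * ln x) - 1\<bar>"
        using \<open>x > 0\<close> by (simp add: abs_mult powr_def)
      also have "\<dots> \<le> exp (\<bar>t\<bar> * L) * (exp (\<bar>r n - t\<bar> * L) - 1)"
      proof (rule mult_mono)
        show "exp (t * ln x) \<le> exp (\<bar>t\<bar> * L)" using le[of t] by simp
        have "\<bar>exp ((r n - t) * ln x) - 1\<bar> \<le> exp \<bar>(r n - t) * ln x\<bar> - 1" by (rule abs_exp_minus_1_le)
        also have "\<dots> \<le> exp (\<bar>r n - t\<bar> * L) - 1" using le[of "r n - t"] by simp
        finally show "\<bar>exp ((r n - t) * ln x) - 1\<bar> \<le> exp (\<bar>r n - t\<bar> * L) - 1" .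
      qed auto
      finally show "\<bar>x powr r n - x powr t\<bar> \<le> exp (\<bar>t\<bar> * L) * (exp (\<bar>r n - t\<bar> * L) - 1)" .
    qed
    then show ?thesis by (simp add: powr_op_def fun_op_diff[OF ab(3) c c])
  qed
  have "(\<lambda>n. exp (\<bar>t\<bar> * L) * (exp (\<bar>r n - t\<bar> * L) - 1)) \<longlonglongrightarrow> exp (\<bar>t\<bar> * L) * (exp (\<bar>t - t\<bar> * L) - 1)"
    by (intro tendsto_intros r)
  then have "(\<lambda>n. exp (\<bar>t\<bar> * L) * (exp (\<bar>r n - t\<bar> * L) - 1)) \<longlonglongrightarrow> 0" by simp
  then have "(\<lambda>n. powr_op T (r n) - powr_op T t) \<longlonglongrightarrow> 0"
    by (rule Lim_null_comparison[OF always_eventually, rotated]) (use bd in blast)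
  then show ?thesis by (simp add: LIM_zero_iff)
qed

text \<open>
  The exponents \<open>t\<close> for which the claim holds include \<open>0\<close> and \<open>1\<close>, are closed under midpoints and,
  since powers depend continuously on the exponent, form a closed set.
\<close>

theorem loewner_heinz:
  fixes S T :: "'h::{real_inner,banach} \<Rightarrow>\<^sub>L 'h"
  assumes S: "posdef S" and T: "posdef T" and "S \<sqsubseteq> T" and t: "0 \<le> t" "t \<le> 1"
  shows "powr_op S t \<sqsubseteq> powr_op T t"
proof -
  have dyadic: "powr_op S (real i / 2 ^ n) \<sqsubseteq> powr_op T (real i / 2 ^ n)" if "i \<le> 2 ^ n" for i n
    using that
  proof (induction n arbitrary: i)
    case 0
    then consider "i = 0" | "i = 1" by fastforce
    then show ?case
      by cases (use \<open>S \<sqsubseteq> T\<close> in \<open>simp_all add: powr_op_0[OF S] powr_op_0[OF T] powr_op_1[OF S] powr_op_1[OF T]\<close>)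
  next
    case (Suc n)
    define j k where "j = i div 2" and "k = i - i div 2"
    have i: "i = j + k" by (simp add: j_def k_def)
    have "j \<le> 2 ^ n" "k \<le> 2 ^ n"
      using Suc.prems unfolding j_def k_def power_Suc by linarith+
    moreover have "real i / 2 ^ Suc n = (real j / 2 ^ n + real k / 2 ^ n) / 2"
      by (simp add: i add_divide_distrib)
    ultimately show ?case
      using powr_op_le_midpoint[OF S T Suc.IH[of j] Suc.IH[of k]] by (simp only:)
  qed
  \<comment> \<open>dyadic approximation of \<open>t\<close> from below\<close>
  define i r where "i n = nat \<lfloor>2 ^ n * t\<rfloor>" and "r n = real (i n) / 2 ^ n" for n
  have ri: "real (i n) \<le> 2 ^ n * t" "2 ^ n * t - 1 \<le> real (i n)" for n
  proof -
    have "0 \<le> 2 ^ n * t" using t(1) by simp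
    then show "real (i n) \<le> 2 ^ n * t" unfolding i_def by (rule of_nat_floor)
    have "2 ^ n * t - 1 \<le> of_int \<lfloor>2 ^ n * t\<rfloor>" using floor_correct[of "2 ^ n * t"] by linarith
    also have "\<dots> \<le> real (i n)" unfolding i_def by simp
    finally show "2 ^ n * t - 1 \<le> real (i n)" .
  qed
  have i_le: "i n \<le> 2 ^ n" for n
  proof -
    have "2 ^ n * t \<le> 2 ^ n * 1" using t(2) by (intro mult_left_mono) auto
    then have "real (i n) \<le> 2 ^ n" using ri(1)[of n] by linarith
    then show ?thesis by simp
  qed
  have bounds: "t - (1/2) ^ n \<le> r n" "r n \<le> t" for n
    using ri[of n] by (simp_all add: r_def pos_le_divide_eq pos_divide_le_eq power_one_over
        left_diff_distrib right_diff_distrib mult.commute)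
  have "(\<lambda>n. t - (1/2) ^ n) \<longlonglongrightarrow> t - 0"
    by (intro tendsto_intros LIMSEQ_realpow_zero) auto
  then have low: "(\<lambda>n. t - (1/2) ^ n) \<longlonglongrightarrow> t" by simp
  have lim: "r \<longlonglongrightarrow> t"
  proof (rule tendsto_sandwich)
    show "(\<lambda>n. t - (1/2) ^ n) \<longlonglongrightarrow> t" by (rule low)
    show "(\<lambda>n. t) \<longlonglongrightarrow> t" by (rule tendsto_const)
  qed (rule always_eventually, use bounds in blast)+
  have "powr_op S (r n) \<sqsubseteq> powr_op T (r n)" for n
    unfolding r_def by (rule dyadic[OF i_le])
  then show ?thesis
    by (intro op_le_tendsto[OF powr_op_tendsto[OF S lim] powr_op_tendsto[OF T lim]]
        always_eventually allI)
qed

section \<open>The Thompson metric as an order relation\<close>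

text \<open>
  The statement that the Thompson distance is at most \<open>\<alpha>\<close>, freed from logarithms: in this form it
  passes through monotone maps, sums and limits.
\<close>

definition near :: "real \<Rightarrow> ('h::real_inner \<Rightarrow>\<^sub>L 'h) \<Rightarrow> ('h \<Rightarrow>\<^sub>L 'h) \<Rightarrow> bool" where
  "near \<alpha> A B \<longleftrightarrow> exp (- \<alpha>) *\<^sub>R A \<sqsubseteq> B \<and> B \<sqsubseteq> exp \<alpha> *\<^sub>R A"

lemma near_sym:
  assumes "near \<alpha> A B"
  shows "near \<alpha> B A"
  using op_le_scaleR[of "exp (- \<alpha>) *\<^sub>R A" B "exp \<alpha>"] op_le_scaleR[of B "exp \<alpha> *\<^sub>R A" "exp (- \<alpha>)"] assms
  by (simp add: near_def exp_minus_inverse exp_minus)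

lemma near_trans:
  assumes "near \<alpha> A B" "near \<beta> B C"
  shows "near (\<alpha> + \<beta>) A C"
proof -
  have "exp (- (\<alpha> + \<beta>)) *\<^sub>R A = exp (- \<beta>) *\<^sub>R (exp (- \<alpha>) *\<^sub>R A)"
    by (simp add: exp_add[symmetric])
  also have "\<dots> \<sqsubseteq> exp (- \<beta>) *\<^sub>R B" using assms(1) by (intro op_le_scaleR) (auto simp: near_def)
  also have "\<dots> \<sqsubseteq> C" using assms(2) by (simp add: near_def)
  finally have 1: "exp (- (\<alpha> + \<beta>)) *\<^sub>R A \<sqsubseteq> C" .
  have "C \<sqsubseteq> exp \<beta> *\<^sub>R B" using assms(2) by (simp add: near_def)
  also have "\<dots> \<sqsubseteq> exp \<beta> *\<^sub>R (exp \<alpha> *\<^sub>R A)" using assms(1) by (intro op_le_scaleR) (auto simp: near_def)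
  also have "\<dots> = exp (\<alpha> + \<beta>) *\<^sub>R A" by (simp add: exp_add[symmetric] add.commute)
  finally show ?thesis using 1 by (simp add: near_def)
qed

lemma abs_ln_le:
  fixes x :: real
  assumes "exp (- \<alpha>) \<le> x" "x \<le> exp \<alpha>"
  shows "\<bar>ln x\<bar> \<le> \<alpha>"
proof -
  have "0 < x" using assms(1) by (meson exp_gt_zero less_le_trans)
  then have "ln (exp (- \<alpha>)) \<le> ln x" "ln x \<le> ln (exp \<alpha>)"
    using assms by (subst ln_le_cancel_iff; simp)+
  then show ?thesis by simp
qed

lemma conj_whiten:
  fixes A B :: "'h::{real_inner,banach} \<Rightarrow>\<^sub>L 'h"
  assumes "posdef A"
  shows "sqrt_op A o\<^sub>L whiten A B o\<^sub>L sqrt_op A = B"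
  by (simp add: whiten_def op_assoc sqrt_op_cancel[OF assms] isqrt_op_sqrt_op[OF assms])

lemma thompson_dist_le_iff:
  fixes A B :: "'h::{real_inner,banach} \<Rightarrow>\<^sub>L 'h"
  assumes A: "posdef A" and B: "posdef B" and \<alpha>: "0 \<le> \<alpha>"
  shows "thompson_dist A B \<le> \<alpha> \<longleftrightarrow> near \<alpha> A B"
proof
  define W where "W = whiten A B"
  have W: "posdef W" unfolding W_def using A B by (rule posdef_whiten)
  assume "thompson_dist A B \<le> \<alpha>"
  then have "norm (fun_op ln W) \<le> \<alpha>" by (simp add: thompson_dist_whiten W_def)
  obtain a b where ab: "0 < a" "a \<le> b" "between a b W" using W by (rule posdefE)
  have cln: "continuous_on {a..b} ln" by (rule continuous_on_pos[OF continuous_on_ln_pos ab(1)])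
  have Z: "between (- \<alpha>) \<alpha> (fun_op ln W)"
    by (rule between_norm[OF selfadj_fun_op[OF ab(3) cln] \<open>norm _ \<le> \<alpha>\<close>])
  have "fun_op exp (fun_op ln W) = fun_op (\<lambda>x. exp (ln x)) W"
    using ab(1,2) by (intro fun_op_compose[OF ab(3) cln, of "ln a" "ln b"]) (auto intro: continuous_intros)
  also have "\<dots> = fun_op (\<lambda>x. x) W"
    by (rule fun_op_pos_cong[OF W]) (auto intro!: continuous_on_exp continuous_on_ln_pos)
  also have "\<dots> = W" by (rule fun_op_ident[OF ab(3)])
  finally have "between (exp (- \<alpha>)) (exp \<alpha>) W"
    using between_fun_op[OF Z, of exp "exp (- \<alpha>)" "exp \<alpha>"] \<alpha> by (simp add: continuous_on_exp)
  then have "sqrt_op A o\<^sub>L (exp (- \<alpha>) *\<^sub>R id_blinfun) o\<^sub>L sqrt_op A \<sqsubseteq> sqrt_op A o\<^sub>L W o\<^sub>L sqrt_op A"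
    "sqrt_op A o\<^sub>L W o\<^sub>L sqrt_op A \<sqsubseteq> sqrt_op A o\<^sub>L (exp \<alpha> *\<^sub>R id_blinfun) o\<^sub>L sqrt_op A"
    by (auto intro!: op_le_conj selfadj_sqrt_op A simp: between_def)
  then show "near \<alpha> A B"
    by (simp add: near_def W_def conj_whiten A op_linear sqrt_op_sqrt_op)
next
  assume "near \<alpha> A B"
  then have W: "between (exp (- \<alpha>)) (exp \<alpha>) (whiten A B)"
    unfolding near_def by (intro between_whiten A posdef_selfadj[OF B]) auto
  have "norm (fun_op ln (whiten A B)) \<le> \<alpha>"
  proof (rule norm_fun_op_le[OF W _ \<alpha>])
    show "continuous_on {exp (- \<alpha>)..exp \<alpha>} ln"
      by (rule continuous_on_pos[OF continuous_on_ln_pos]) simp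
    fix x assume x: "x \<in> {exp (- \<alpha>)..exp \<alpha>}"
    then show "\<bar>ln x\<bar> \<le> \<alpha>" by (intro abs_ln_le) auto
  qed
  then show "thompson_dist A B \<le> \<alpha>" by (simp add: thompson_dist_whiten)
qed

lemma thompson_dist_nonneg: "0 \<le> thompson_dist A B"
  by (simp add: thompson_dist_whiten)

lemma near_thompson_dist:
  fixes A B :: "'h::{real_inner,banach} \<Rightarrow>\<^sub>L 'h"
  shows "posdef A \<Longrightarrow> posdef B \<Longrightarrow> near (thompson_dist A B) A B"
  by (simp add: thompson_dist_le_iff[symmetric] thompson_dist_nonneg)

lemma thompson_dist_commute:
  fixes A B :: "'h::{real_inner,banach} \<Rightarrow>\<^sub>L 'h"
  assumes "posdef A" "posdef B"
  shows "thompson_dist A B = thompson_dist B A"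
  by (rule antisym; subst thompson_dist_le_iff)
    (simp_all add: assms thompson_dist_nonneg near_sym near_thompson_dist)

lemma thompson_dist_triangle:
  fixes A B C :: "'h::{real_inner,banach} \<Rightarrow>\<^sub>L 'h"
  assumes "posdef A" "posdef B" "posdef C"
  shows "thompson_dist A C \<le> thompson_dist A B + thompson_dist B C"
  by (subst thompson_dist_le_iff)
    (use assms in \<open>auto intro: near_trans near_thompson_dist simp: thompson_dist_nonneg\<close>)

lemma thompson_dist_self:
  fixes A :: "'h::{real_inner,banach} \<Rightarrow>\<^sub>L 'h"
  assumes "posdef A"
  shows "thompson_dist A A = 0"
proof -
  have "near 0 A A" by (simp add: near_def)
  then show ?thesis
    using thompson_dist_le_iff[OF assms assms, of 0] thompson_dist_nonneg[of A A] by simp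
qed

text \<open>
  After a swap, \<open>X #\<^sub>t A\<close> is the power \<open>1 - t\<close> of an operator linear in \<open>X\<close>, so it is monotone in \<open>X\<close>
  by the Loewner-Heinz inequality and homogeneous of degree \<open>1 - t\<close>. Monotone maps that are homogeneous
  of degree less than \<open>1\<close> are strict contractions of the Thompson metric.
\<close>

lemma geodesic_le:
  fixes A X Y :: "'h::{real_inner,banach} \<Rightarrow>\<^sub>L 'h"
  assumes p: "posdef X" "posdef Y" "posdef A" and t: "0 \<le> t" "t \<le> 1"
    and c: "c > 0" and le: "X \<sqsubseteq> c *\<^sub>R Y"
  shows "geodesic X t A \<sqsubseteq> (c powr (1 - t)) *\<^sub>R geodesic Y t A"
proof -
  have "whiten A X \<sqsubseteq> isqrt_op A o\<^sub>L (c *\<^sub>R Y) o\<^sub>L isqrt_op A"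
    unfolding whiten_def by (intro op_le_conj le selfadj_isqrt_op p)
  also have "\<dots> = c *\<^sub>R whiten A Y" by (simp add: whiten_def op_linear)
  finally have "powr_op (whiten A X) (1 - t) \<sqsubseteq> powr_op (c *\<^sub>R whiten A Y) (1 - t)"
    using t by (intro loewner_heinz posdef_whiten posdef_scaleR p c) auto
  also have "\<dots> = (c powr (1 - t)) *\<^sub>R powr_op (whiten A Y) (1 - t)"
    by (intro powr_op_scaleR posdef_whiten p c)
  finally have "sqrt_op A o\<^sub>L powr_op (whiten A X) (1 - t) o\<^sub>L sqrt_op A
      \<sqsubseteq> sqrt_op A o\<^sub>L ((c powr (1 - t)) *\<^sub>R powr_op (whiten A Y) (1 - t)) o\<^sub>L sqrt_op A"
    by (intro op_le_conj selfadj_sqrt_op p)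
  then show ?thesis
    using p by (simp add: geodesic_swap perspective_def powr_op_def op_linear)
qed

lemma near_geodesic:
  fixes A X Y :: "'h::{real_inner,banach} \<Rightarrow>\<^sub>L 'h"
  assumes p: "posdef X" "posdef Y" "posdef A" and t: "0 \<le> t" "t \<le> 1" and n: "near \<alpha> X Y"
  shows "near ((1 - t) * \<alpha>) (geodesic X t A) (geodesic Y t A)"
proof (rule near_sym)
  have e: "exp \<alpha> powr (1 - t) = exp ((1 - t) * \<alpha>)" by (simp add: powr_def)
  have 1: "geodesic Y t A \<sqsubseteq> exp ((1 - t) * \<alpha>) *\<^sub>R geodesic X t A"
    using geodesic_le[OF p(2,1,3) t, of "exp \<alpha>"] n by (simp add: near_def e)
  have 2: "geodesic X t A \<sqsubseteq> exp ((1 - t) * \<alpha>) *\<^sub>R geodesic Y t A"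
    using geodesic_le[OF p(1,2,3) t, of "exp \<alpha>"] near_sym[OF n] by (simp add: near_def e)
  have "exp (- ((1 - t) * \<alpha>)) *\<^sub>R geodesic Y t A
      \<sqsubseteq> exp (- ((1 - t) * \<alpha>)) *\<^sub>R (exp ((1 - t) * \<alpha>) *\<^sub>R geodesic X t A)"
    by (intro op_le_scaleR 1) simp
  with 2 show "near ((1 - t) * \<alpha>) (geodesic Y t A) (geodesic X t A)"
    by (simp add: near_def exp_minus_inverse exp_minus)
qed

lemma thompson_dist_geodesic_le:
  fixes A X Y :: "'h::{real_inner,banach} \<Rightarrow>\<^sub>L 'h"
  assumes "posdef X" "posdef Y" "posdef A" "0 \<le> t" "t \<le> 1"
  shows "thompson_dist (geodesic X t A) (geodesic Y t A) \<le> (1 - t) * thompson_dist X Y"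
  using assms
  by (subst thompson_dist_le_iff)
    (auto intro!: near_geodesic near_thompson_dist posdef_geodesic simp: thompson_dist_nonneg)

section \<open>Comparison with the norm on bounded sets\<close>

text \<open>
  The ball of radius \<open>R\<close> around the identity in the Thompson metric.
\<close>

definition in_ball :: "real \<Rightarrow> ('h::real_inner \<Rightarrow>\<^sub>L 'h) \<Rightarrow> bool" where
  "in_ball R X \<longleftrightarrow> between (exp (- R)) (exp R) X"

lemma in_ball_posdef: "in_ball R X \<Longrightarrow> posdef X"
  unfolding in_ball_def by (erule posdefI) simp

lemma in_ball_mono: "in_ball R X \<Longrightarrow> R \<le> R' \<Longrightarrow> in_ball R' X"
  unfolding in_ball_def by (erule between_mono) auto

lemma in_ball_iff_dist:
  fixes X :: "'h::{real_inner,banach} \<Rightarrow>\<^sub>L 'h"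
  assumes "posdef X" "0 \<le> R"
  shows "in_ball R X \<longleftrightarrow> thompson_dist id_blinfun X \<le> R"
  using assms
  by (simp add: thompson_dist_le_iff[OF posdef_id] near_def in_ball_def between_def posdef_selfadj)

lemma in_ball_near:
  assumes "in_ball R X" "near \<alpha> X Y" "selfadj Y"
  shows "in_ball (R + \<alpha>) Y"
proof -
  have "near R id_blinfun X" using assms(1) by (simp add: in_ball_def between_def near_def)
  from near_trans[OF this assms(2)] assms(3) show ?thesis
    by (simp add: in_ball_def between_def near_def)
qed

lemma norm_diff_le_near:
  assumes X: "in_ball R X" and Y: "selfadj Y" and n: "near \<alpha> X Y" and \<alpha>: "0 \<le> \<alpha>"
  shows "norm (Y - X) \<le> (exp \<alpha> - 1) * exp R"
proof (rule norm_le_quadratic_form)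
  show "selfadj (Y - X)" using X Y by (auto intro: selfadj_diff simp: in_ball_def between_def)
  have e: "1 \<le> exp \<alpha>" using \<alpha> by simp
  then show "0 \<le> (exp \<alpha> - 1) * exp R" by simp
  \<comment> \<open>so the lower bound \<open>exp (- \<alpha>) - 1\<close> is no worse than \<open>- (exp \<alpha> - 1)\<close>\<close>
  have sum: "2 \<le> exp \<alpha> + exp (- \<alpha>)"
  proof -
    have "0 \<le> (exp \<alpha> - 1)\<^sup>2 / exp \<alpha>" by simp
    then show ?thesis by (simp add: exp_minus field_simps power2_eq_square)
  qed
  have q: "0 \<le> inner (X x) x" "inner (X x) x \<le> exp R * inner x x" for x
  proof -
    have "0 \<le> exp (- R) * inner x x" by simp
    also have "\<dots> \<le> inner (X x) x" using X by (simp add: in_ball_def between_def op_le_def op_apply)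
    finally show "0 \<le> inner (X x) x" .
    show "inner (X x) x \<le> exp R * inner x x"
      using X by (simp add: in_ball_def between_def op_le_def op_apply)
  qed
  have up: "(exp \<alpha> - 1) * inner (X x) x \<le> (exp \<alpha> - 1) * exp R * inner x x" for x
    using q(2)[of x] e by (simp add: mult.assoc mult_left_mono)
  have lo: "- ((exp \<alpha> - 1) * inner (X x) x) \<le> (exp (- \<alpha>) - 1) * inner (X x) x" for x
    using mult_right_mono[OF sum q(1)[of x]] by (simp add: algebra_simps)
  have "inner (Y x) x \<le> exp \<alpha> * inner (X x) x" "exp (- \<alpha>) * inner (X x) x \<le> inner (Y x) x" for x
    using n by (auto simp: near_def op_le_def op_apply)
  then show "Y - X \<sqsubseteq> ((exp \<alpha> - 1) * exp R) *\<^sub>R id_blinfun"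
    "- ((exp \<alpha> - 1) * exp R) *\<^sub>R id_blinfun \<sqsubseteq> Y - X"
    unfolding op_le_def op_apply inner_diff_left
  proof -
    fix x :: 'a
    assume *: "\<And>x. inner (Y x) x \<le> exp \<alpha> * inner (X x) x"
      "\<And>x. exp (- \<alpha>) * inner (X x) x \<le> inner (Y x) x"
    show "\<forall>x. inner (Y x) x - inner (X x) x \<le> inner (((exp \<alpha> - 1) * exp R) *\<^sub>R id_blinfun x) x"
    proof
      fix x
      show "inner (Y x) x - inner (X x) x \<le> inner (((exp \<alpha> - 1) * exp R) *\<^sub>R id_blinfun x) x"
        using up[of x] *(1)[of x] by (simp add: left_diff_distrib)
    qed
    show "\<forall>x. inner (- ((exp \<alpha> - 1) * exp R) *\<^sub>R id_blinfun x) x \<le> inner (Y x) x - inner (X x) x"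
    proof
      fix x
      show "inner (- ((exp \<alpha> - 1) * exp R) *\<^sub>R id_blinfun x) x \<le> inner (Y x) x - inner (X x) x"
        using up[of x] lo[of x] *(2)[of x] by (simp add: left_diff_distrib)
    qed
  qed
qed

lemma near_if_norm_diff_le:
  assumes X: "in_ball R X" and n: "norm (Y - X) \<le> \<eta>" and \<eta>: "\<eta> * exp R \<le> 1/2"
  shows "near (2 * \<eta> * exp R) X Y"
proof -
  define v where "v = \<eta> * exp R"
  have "0 \<le> \<eta>" using n norm_ge_zero order_trans by blast
  then have v: "0 \<le> v" "v \<le> 1/2" using \<eta> by (auto simp: v_def)
  have q: "\<bar>inner (Y x) x - inner (X x) x\<bar> \<le> v * inner (X x) x" for x
  proof -
    have "\<bar>inner (Y x) x - inner (X x) x\<bar> = \<bar>inner ((Y - X) x) x\<bar>"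
      by (simp add: op_apply inner_diff_left)
    also have "\<dots> \<le> norm ((Y - X) x) * norm x" by (rule Cauchy_Schwarz_ineq2)
    also have "\<dots> \<le> (\<eta> * norm x) * norm x"
      by (intro mult_right_mono order_trans[OF norm_blinfun] n) auto
    also have "\<dots> = v * (exp (- R) * inner x x)"
      by (simp add: v_def exp_minus dot_square_norm power2_eq_square)
    also have "\<dots> \<le> v * inner (X x) x"
      using X v(1) by (intro mult_left_mono) (auto simp: in_ball_def between_def op_le_def op_apply)
    finally show ?thesis .
  qed
  have q0: "0 \<le> inner (X x) x" for x
  proof -
    have "0 \<le> exp (- R) * inner x x" by simp
    also have "\<dots> \<le> inner (X x) x" using X by (simp add: in_ball_def between_def op_le_def op_apply)
    finally show ?thesis .
  qed
  have up: "1 + v \<le> exp (2 * v)" using exp_ge_add_one_self[of "2 * v"] v by linarith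
  have lo: "exp (- (2 * v)) \<le> 1 - v"
  proof -
    have "1 \<le> (1 - v) * (1 + 2 * v)"
      using mult_nonneg_nonneg[of v "1 - 2 * v"] v by (simp add: algebra_simps)
    also have "\<dots> \<le> (1 - v) * exp (2 * v)"
      using v exp_ge_add_one_self[of "2 * v"] by (intro mult_left_mono) auto
    finally show ?thesis by (simp add: exp_minus field_simps)
  qed
  have "exp (- (2 * v)) * inner (X x) x \<le> inner (Y x) x" "inner (Y x) x \<le> exp (2 * v) * inner (X x) x" for x
    using q[of x] mult_right_mono[OF up q0[of x]] mult_right_mono[OF lo q0[of x]]
    by (auto simp: abs_le_iff algebra_simps)
  then have "near (2 * v) X Y" by (simp add: near_def op_le_def op_apply)
  then show ?thesis by (simp add: v_def mult.assoc)
qed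

lemma near_norm_eventually:
  fixes X :: "'h::{real_inner,banach} \<Rightarrow>\<^sub>L 'h"
  assumes X: "in_ball R X" and Z: "Z \<longlonglongrightarrow> X"
  shows "\<forall>\<^sub>F n in sequentially. near (2 * exp R * norm (Z n - X)) X (Z n)"
proof -
  have "(\<lambda>n. norm (Z n - X) * exp R) \<longlonglongrightarrow> norm (X - X) * exp R" by (intro tendsto_intros Z)
  from order_tendstoD(2)[OF this, of "1/2"]
  have "\<forall>\<^sub>F n in sequentially. norm (Z n - X) * exp R < 1/2" by simp
  then show ?thesis
  proof eventually_elim
    case (elim n)
    show ?case
      using near_if_norm_diff_le[OF X order_refl, of "Z n"] elim by (simp add: mult_ac)
  qed
qed

lemma in_ball_eventually:
  fixes X :: "'h::{real_inner,banach} \<Rightarrow>\<^sub>L 'h"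
  assumes X: "in_ball R X" and Z: "Z \<longlonglongrightarrow> X" "\<And>n. selfadj (Z n)"
  shows "\<forall>\<^sub>F n in sequentially. in_ball (R + 1) (Z n)"
proof -
  have "(\<lambda>n. 2 * exp R * norm (Z n - X)) \<longlonglongrightarrow> 2 * exp R * norm (X - X)" by (intro tendsto_intros Z)
  from order_tendstoD(2)[OF this, of 1]
  have "\<forall>\<^sub>F n in sequentially. 2 * exp R * norm (Z n - X) < 1" by simp
  with near_norm_eventually[OF X Z(1)] show ?thesis
  proof eventually_elim
    case (elim n)
    from in_ball_near[OF X elim(1) Z(2)] show ?case by (rule in_ball_mono) (use elim(2) in simp)
  qed
qed

lemma between_whiten_in_ball:
  fixes X A :: "'h::{real_inner,banach} \<Rightarrow>\<^sub>L 'h"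
  assumes X: "in_ball R X" and A: "in_ball R A"
  shows "between (exp (- (2 * R))) (exp (2 * R)) (whiten X A)"
proof (rule between_whiten)
  have e: "exp (2 * R) = exp R * exp R" "exp (- (2 * R)) = exp (- R) * exp (- R)"
    by (simp_all add: exp_add[symmetric])
  have "near R id_blinfun X" and A': "near R id_blinfun A"
    using X A by (auto simp: in_ball_def between_def near_def)
  from near_trans[OF near_sym[OF this(1)] A']
  have "near (2 * R) X A" by simp
  then show "exp (- (2 * R)) *\<^sub>R X \<sqsubseteq> A" "A \<sqsubseteq> exp (2 * R) *\<^sub>R X" by (simp_all add: near_def)
qed (use X A in \<open>auto intro: in_ball_posdef simp: in_ball_def between_def\<close>)

section \<open>First-order expansion of the geodesic\<close>

lemma norm_sqrt_op_le:
  fixes X :: "'h::{real_inner,banach} \<Rightarrow>\<^sub>L 'h"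
  assumes "in_ball R X"
  shows "norm (sqrt_op X) \<le> exp (R / 2)"
  unfolding sqrt_op_def powr_op_def
proof (rule norm_fun_op_le)
  show "between (exp (- R)) (exp R) X" using assms by (simp add: in_ball_def)
  show "continuous_on {exp (- R)..exp R} (\<lambda>x. x powr (1 / 2))"
    by (rule continuous_on_pos[OF continuous_on_powr_pos]) simp
  fix x assume x: "x \<in> {exp (- R)..exp R}"
  then have "x > 0" by (meson atLeastAtMost_iff exp_gt_zero less_le_trans)
  then have "x powr (1/2) \<le> exp R powr (1/2)" using x by (intro powr_mono2) auto
  then show "\<bar>x powr (1 / 2)\<bar> \<le> exp (R / 2)" by (simp add: powr_def)
qed simp

lemma abs_exp_taylor_le: "\<bar>exp u - 1 - u\<bar> \<le> u\<^sup>2 * exp \<bar>u\<bar>" for u :: real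
  using Taylor_exp_field[of u 1] by (simp add: power2_eq_square mult_ac diff_diff_eq)

text \<open>
  The functional calculus at \<open>whiten X A\<close> reduces this to \<open>x^t = 1 + t ln x + O(t\<^sup>2)\<close>, where
  \<open>\<bar>ln x\<bar> \<le> 2 R\<close> because two points of the ball are at distance at most \<open>2 R\<close>. The constant depends
  on the ball only, which is what makes the expansion usable along sequences.
\<close>

lemma geodesic_expansion:
  fixes X A :: "'h::{real_inner,banach} \<Rightarrow>\<^sub>L 'h"
  assumes R: "0 \<le> R" and X: "in_ball R X" and A: "in_ball R A" and t: "0 \<le> t" "t \<le> 1"
  shows "norm (geodesic X t A - X - t *\<^sub>R log_at X A) \<le> (exp R * ((2 * R)\<^sup>2 * exp (2 * R))) * t\<^sup>2"
proof -
  define W a b where "W = whiten X A" and "a = exp (- (2 * R))" and "b = exp (2 * R)"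
  have W: "between a b W"
    unfolding W_def a_def b_def by (rule between_whiten_in_ball[OF X A])
  have a: "0 < a" by (simp add: a_def)
  have cp: "continuous_on {a..b} (\<lambda>x. x powr t)" and cl: "continuous_on {a..b} ln"
    using a by (auto intro: continuous_on_pos continuous_intros)
  define F where "F = fun_op (\<lambda>x. x powr t - 1 - t * ln x) W"
  have F: "F = fun_op (\<lambda>x. x powr t) W - id_blinfun - t *\<^sub>R fun_op ln W"
    unfolding F_def using fun_op_const[OF W, of 1]
    by (simp add: fun_op_diff[OF W] fun_op_cmult[OF W cl] continuous_on_diff continuous_on_mult cp cl)
  have "norm F \<le> t\<^sup>2 * ((2 * R)\<^sup>2 * exp (2 * R))"
    unfolding F_def
  proof (rule norm_fun_op_le[OF W])
    show "continuous_on {a..b} (\<lambda>x. x powr t - 1 - t * ln x)"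
      by (intro continuous_intros cp cl)
    fix x assume x: "x \<in> {a..b}"
    then have x0: "x > 0" using a by auto
    define u where "u = t * ln x"
    have l: "\<bar>ln x\<bar> \<le> 2 * R" using x by (intro abs_ln_le) (auto simp: a_def b_def)
    have u: "\<bar>u\<bar> \<le> t * (2 * R)" unfolding u_def using l t by (simp add: abs_mult mult_left_mono)
    have "t * (2 * R) \<le> 1 * (2 * R)" using t R by (intro mult_right_mono) auto
    then have u': "\<bar>u\<bar> \<le> 2 * R" using u by simp
    have "u\<^sup>2 \<le> (t * (2 * R))\<^sup>2" using u by (metis abs_ge_zero power2_abs power_mono)
    have "\<bar>x powr t - 1 - t * ln x\<bar> = \<bar>exp u - 1 - u\<bar>" using x0 by (simp add: u_def powr_def)
    also have "\<dots> \<le> u\<^sup>2 * exp \<bar>u\<bar>" by (rule abs_exp_taylor_le)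
    also have "\<dots> \<le> (t * (2 * R))\<^sup>2 * exp (2 * R)"
      using \<open>u\<^sup>2 \<le> (t * (2 * R))\<^sup>2\<close> u' by (intro mult_mono) auto
    finally show "\<bar>x powr t - 1 - t * ln x\<bar> \<le> t\<^sup>2 * ((2 * R)\<^sup>2 * exp (2 * R))"
      by (simp add: power_mult_distrib)
  qed simp
  have Xp: "posdef X" using X by (rule in_ball_posdef)
  have "geodesic X t A - X - t *\<^sub>R log_at X A = sqrt_op X o\<^sub>L F o\<^sub>L sqrt_op X"
    by (simp add: F op_linear geodesic_perspective log_at_perspective perspective_def W_def
        sqrt_op_sqrt_op Xp)
  also have "norm \<dots> \<le> norm (sqrt_op X) * norm F * norm (sqrt_op X)"
    by (intro order_trans[OF norm_blinfun_compose] mult_right_mono norm_blinfun_compose) auto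
  also have "\<dots> \<le> exp (R / 2) * (t\<^sup>2 * ((2 * R)\<^sup>2 * exp (2 * R))) * exp (R / 2)"
    using norm_sqrt_op_le[OF X] \<open>norm F \<le> _\<close> by (intro mult_mono) auto
  also have "\<dots> = (exp (R / 2) * exp (R / 2)) * ((2 * R)\<^sup>2 * exp (2 * R)) * t\<^sup>2" by simp
  also have "exp (R / 2) * exp (R / 2) = exp R" by (simp add: exp_add[symmetric])
  finally show ?thesis by (simp only: mult.assoc)
qed

text \<open>
  In the defining formula the variable point enters through its square root as well; after a swap it
  enters linearly, inside a single application of the functional calculus.
\<close>

lemma log_at_tendsto:
  fixes X A :: "'h::{real_inner,banach} \<Rightarrow>\<^sub>L 'h"
  assumes X: "in_ball R X" and A: "in_ball R A" and Z: "Z \<longlonglongrightarrow> X"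
    and ball: "\<forall>\<^sub>F n in sequentially. in_ball R (Z n)"
  shows "(\<lambda>n. log_at (Z n) A) \<longlonglongrightarrow> log_at X A"
proof -
  define g where "g = (\<lambda>y::real. y * ln (1 / y))"
  have g: "continuous_on {exp (- (2 * R))..exp (2 * R)} g"
  proof (rule continuous_on_pos)
    have "continuous_on {0<..} (\<lambda>y::real. y * - ln y)" by (intro continuous_intros)
    then show "continuous_on {0<..} g"
      by (rule continuous_on_eq) (auto simp: g_def ln_div)
  qed simp
  have W: "(\<lambda>n. whiten A (Z n)) \<longlonglongrightarrow> whiten A X"
    unfolding whiten_def by (intro comp.tendsto tendsto_const Z)
  have "\<forall>\<^sub>F n in sequentially. between (exp (- (2 * R))) (exp (2 * R)) (whiten A (Z n))"
    using ball by eventually_elim (rule between_whiten_in_ball[OF A])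
  then have "(\<lambda>n. perspective g A (Z n)) \<longlonglongrightarrow> perspective g A X"
    unfolding perspective_def
    by (intro comp.tendsto tendsto_const fun_op_tendsto[OF _ between_whiten_in_ball[OF A X] W g])
  moreover have "\<forall>\<^sub>F n in sequentially. perspective g A (Z n) = log_at (Z n) A"
    using ball by eventually_elim (simp add: log_at_swap in_ball_posdef[OF A] in_ball_posdef g_def)
  ultimately show ?thesis
    using in_ball_posdef[OF A] in_ball_posdef[OF X]
    by (simp add: log_at_swap g_def tendsto_cong)
qed

lemma posdef_in_ball:
  fixes X :: "'h::{real_inner,banach} \<Rightarrow>\<^sub>L 'h"
  assumes "posdef X" "thompson_dist id_blinfun X \<le> R"
  shows "in_ball R X"
  using assms in_ball_iff_dist[OF assms(1)] thompson_dist_nonneg order_trans by blast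

lemma geodesic_quotient_tendsto:
  fixes X A :: "'h::{real_inner,banach} \<Rightarrow>\<^sub>L 'h"
  assumes X: "posdef X" and A: "posdef A" and Z: "Z \<longlonglongrightarrow> X" "\<And>n. posdef (Z n)"
    and t: "t \<longlonglongrightarrow> 0" "\<And>n. 0 < t n" "\<And>n. t n \<le> 1"
  shows "(\<lambda>n. (1 / t n) *\<^sub>R (geodesic (Z n) (t n) A - Z n)) \<longlonglongrightarrow> log_at X A"
proof -
  \<comment> \<open>the extra \<open>1\<close> makes room for the points \<open>Z n\<close> close to \<open>X\<close>\<close>
  define R where "R = max (thompson_dist id_blinfun X) (thompson_dist id_blinfun A) + 1"
  have R: "0 \<le> R" using thompson_dist_nonneg[of id_blinfun X] by (simp add: R_def)
  have X0: "in_ball (R - 1) X" and XA: "in_ball R X" "in_ball R A"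
    using X A by (auto intro!: posdef_in_ball simp: R_def)
  have ball: "\<forall>\<^sub>F n in sequentially. in_ball R (Z n)"
    using in_ball_eventually[OF X0 Z(1)] Z(2) by (simp add: posdef_selfadj)
  define C where "C = exp R * ((2 * R)\<^sup>2 * exp (2 * R))"
  have "\<forall>\<^sub>F n in sequentially.
      norm ((1 / t n) *\<^sub>R (geodesic (Z n) (t n) A - Z n) - log_at (Z n) A) \<le> C * t n"
    using ball
  proof eventually_elim
    case (elim n)
    have "(1 / t n) *\<^sub>R (geodesic (Z n) (t n) A - Z n) - log_at (Z n) A
        = (1 / t n) *\<^sub>R (geodesic (Z n) (t n) A - Z n - t n *\<^sub>R log_at (Z n) A)"
      using t(2)[of n] by (simp add: scaleR_diff_right)
    also have "norm \<dots> = (1 / t n) * norm (geodesic (Z n) (t n) A - Z n - t n *\<^sub>R log_at (Z n) A)"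
      using t(2)[of n] by simp
    also have "\<dots> \<le> (1 / t n) * (C * (t n)\<^sup>2)"
      unfolding C_def using t(2,3)[of n]
      by (intro mult_left_mono geodesic_expansion R elim XA) auto
    also have "\<dots> = C * t n" using t(2)[of n] by (simp add: power2_eq_square)
    finally show ?case .
  qed
  moreover have "(\<lambda>n. C * t n) \<longlonglongrightarrow> 0" using tendsto_mult_right_zero[OF t(1)] by simp
  ultimately have "(\<lambda>n. (1 / t n) *\<^sub>R (geodesic (Z n) (t n) A - Z n) - log_at (Z n) A) \<longlonglongrightarrow> 0"
    by (rule Lim_null_comparison)
  from tendsto_add[OF this log_at_tendsto[OF XA Z(1) ball]] show ?thesis by simp
qed

section \<open>Existence and uniqueness of the Karcher mean\<close>

lemma posdef_add:
  assumes "posdef S" "posdef T"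
  shows "posdef (S + T)"
proof -
  obtain a b a' b' where *: "0 < a" "between a b S" "0 < a'" "between a' b' T"
    using assms by (auto simp: posdef_def)
  then have "between (a + a') (b + b') (S + T)"
    by (auto simp: between_def selfadj_add scaleR_add_left op_le_add)
  then show ?thesis by (rule posdefI) (use * in simp)
qed

lemma posdef_sum:
  assumes "finite I" "I \<noteq> {}" "\<And>i. i \<in> I \<Longrightarrow> posdef (T i)"
  shows "posdef (\<Sum>i\<in>I. T i)"
  using assms by (induction I rule: finite_ne_induct) (auto intro: posdef_add)

lemma near_average:
  assumes "\<And>i. i \<in> I \<Longrightarrow> near \<beta> (S i) (T i)" "0 \<le> c"
  shows "near \<beta> (c *\<^sub>R (\<Sum>i\<in>I. S i)) (c *\<^sub>R (\<Sum>i\<in>I. T i))"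
proof -
  have "(\<Sum>i\<in>I. exp (- \<beta>) *\<^sub>R S i) \<sqsubseteq> (\<Sum>i\<in>I. T i)" "(\<Sum>i\<in>I. T i) \<sqsubseteq> (\<Sum>i\<in>I. exp \<beta> *\<^sub>R S i)"
    using assms(1) by (auto intro!: op_le_sum simp: near_def)
  from this[THEN op_le_scaleR[OF _ assms(2)]] show ?thesis
    by (simp add: near_def scaleR_sum_right[symmetric] mult.commute)
qed

lemma compose_commute:
  assumes "S o\<^sub>L M = M o\<^sub>L S" "T o\<^sub>L M = M o\<^sub>L T"
  shows "(S o\<^sub>L T) o\<^sub>L M = M o\<^sub>L (S o\<^sub>L T)"
  by (metis assms op_assoc)

lemma geodesic_commute:
  fixes X A M :: "'h::{real_inner,banach} \<Rightarrow>\<^sub>L 'h"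
  assumes X: "posdef X" "X o\<^sub>L M = M o\<^sub>L X" and A: "posdef A" "A o\<^sub>L M = M o\<^sub>L A"
  shows "geodesic X t A o\<^sub>L M = M o\<^sub>L geodesic X t A"
proof -
  have p: "powr_op T s o\<^sub>L M = M o\<^sub>L powr_op T s" if "posdef T" "T o\<^sub>L M = M o\<^sub>L T" for T s
    unfolding powr_op_def
    by (rule fun_op_pos_intertwine[OF that(1,1) continuous_on_powr_pos that(2)])
  have "posdef (powr_op X (- 1 / 2) o\<^sub>L A o\<^sub>L powr_op X (- 1 / 2))"
    using posdef_whiten[OF X(1) A(1)] by (simp add: whiten_def isqrt_op_def)
  then show ?thesis
    unfolding geodesic_def by (intro compose_commute p X A)
qed

locale operator_family =
  fixes k :: nat and A :: "nat \<Rightarrow> 'h::{real_inner,banach} \<Rightarrow>\<^sub>L 'h"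
  assumes k: "k \<ge> 1" and A: "\<And>i. i \<in> {1..k} \<Longrightarrow> posdef (A i)"
begin

definition gradient :: "('h \<Rightarrow>\<^sub>L 'h) \<Rightarrow> ('h \<Rightarrow>\<^sub>L 'h)" where
  "gradient X = (1 / real k) *\<^sub>R (\<Sum>i=1..k. log_at X (A i))"

text \<open>The map whose fixed points are the power means of Lim and Palfia.\<close>

definition step :: "real \<Rightarrow> ('h \<Rightarrow>\<^sub>L 'h) \<Rightarrow> ('h \<Rightarrow>\<^sub>L 'h)" where
  "step s X = (1 / real k) *\<^sub>R (\<Sum>i=1..k. geodesic X s (A i))"

lemma posdef_step: "posdef X \<Longrightarrow> posdef (step s X)"
  unfolding step_def using k by (intro posdef_scaleR posdef_sum posdef_geodesic A) auto

lemma thompson_dist_step_le: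
  assumes "posdef X" "posdef Y" "0 \<le> s" "s \<le> 1"
  shows "thompson_dist (step s X) (step s Y) \<le> (1 - s) * thompson_dist X Y"
proof (subst thompson_dist_le_iff)
  show "near ((1 - s) * thompson_dist X Y) (step s X) (step s Y)"
    unfolding step_def using assms
    by (intro near_average near_geodesic near_thompson_dist A) auto
qed (use assms in \<open>auto intro: posdef_step simp: thompson_dist_nonneg\<close>)

lemma sum_const_average: "(1 / real k) *\<^sub>R (\<Sum>i=1..k. X) = (X :: 'h \<Rightarrow>\<^sub>L 'h)"
  using k by (simp add: sum_constant_scaleR)

lemma step_expansion:
  assumes R: "0 \<le> R" and ball: "in_ball R X" "\<And>i. i \<in> {1..k} \<Longrightarrow> in_ball R (A i)"
    and s: "0 \<le> s" "s \<le> 1"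
  shows "norm (step s X - X - s *\<^sub>R gradient X) \<le> (exp R * ((2 * R)\<^sup>2 * exp (2 * R))) * s\<^sup>2"
proof -
  define C where "C = exp R * ((2 * R)\<^sup>2 * exp (2 * R))"
  have "step s X - X - s *\<^sub>R gradient X
      = (1 / real k) *\<^sub>R (\<Sum>i=1..k. geodesic X s (A i) - X - s *\<^sub>R log_at X (A i))"
    using sum_const_average[of X]
    by (simp add: step_def gradient_def sum_subtractf scaleR_diff_right scaleR_sum_right[symmetric]
        scaleR_left_commute)
  also have "norm \<dots> \<le> (1 / real k) * (\<Sum>i=1..k. C * s\<^sup>2)"
    unfolding norm_scaleR C_def using k
    by (intro mult_mono order_trans[OF norm_sum] sum_mono geodesic_expansion R ball s sum_nonneg) auto
  also have "\<dots> = C * s\<^sup>2" using k by simp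
  finally show ?thesis by (simp add: C_def)
qed

text \<open>
  The size of the Karcher gradient controls the distance: the contraction \<open>step s\<close> moves \<open>X\<close> and \<open>Y\<close>
  by at most \<open>O(s)\<close> times their gradients, yet brings them closer by \<open>s d(X, Y)\<close>.
\<close>

lemma thompson_dist_le_gradients:
  assumes R: "0 \<le> R" and X: "in_ball R X" and Y: "in_ball R Y"
    and AR: "\<And>i. i \<in> {1..k} \<Longrightarrow> in_ball R (A i)"
  shows "thompson_dist X Y \<le> 2 * exp R * (norm (gradient X) + norm (gradient Y))"
proof -
  define C where "C = exp R * ((2 * R)\<^sup>2 * exp (2 * R))"
  define s where "s n = inverse (real (Suc n))" for n
  have s: "0 < s n" "s n \<le> 1" for n by (auto simp: s_def field_simps)
  have s0: "s \<longlonglongrightarrow> 0" unfolding s_def by (rule LIMSEQ_inverse_real_of_nat)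
  have p: "posdef X" "posdef Y" using X Y by (auto intro: in_ball_posdef)
  have move: "\<forall>\<^sub>F n in sequentially.
      thompson_dist Z (step (s n) Z) \<le> 2 * exp R * (s n * (norm (gradient Z) + C * s n))"
    if Z: "in_ball R Z" for Z
  proof -
    define \<eta> where "\<eta> n = s n * (norm (gradient Z) + C * s n)" for n
    have "(\<lambda>n. \<eta> n * exp R) \<longlonglongrightarrow> 0 * (norm (gradient Z) + C * 0) * exp R"
      unfolding \<eta>_def by (intro tendsto_intros s0)
    from order_tendstoD(2)[OF this, of "1/2"]
    have "\<forall>\<^sub>F n in sequentially. \<eta> n * exp R < 1/2" by simp
    then show ?thesis
    proof eventually_elim
      case (elim n)
      have "norm (step (s n) Z - Z)
          \<le> norm (step (s n) Z - Z - s n *\<^sub>R gradient Z) + norm (s n *\<^sub>R gradient Z)"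
        by (rule norm_triangle_sub[of "step (s n) Z - Z" "s n *\<^sub>R gradient Z", THEN order_trans]) simp
      also have "\<dots> \<le> C * (s n)\<^sup>2 + s n * norm (gradient Z)"
        unfolding C_def using s[of n] by (intro add_mono step_expansion R Z AR) auto
      also have "\<dots> = \<eta> n" by (simp add: \<eta>_def power2_eq_square algebra_simps)
      finally have *: "near (2 * \<eta> n * exp R) Z (step (s n) Z)"
        using elim by (intro near_if_norm_diff_le Z) auto
      have "0 \<le> C" by (simp add: C_def)
      then have "0 \<le> \<eta> n" using s(1)[of n] by (simp add: \<eta>_def)
      then have "thompson_dist Z (step (s n) Z) \<le> 2 * \<eta> n * exp R"
        using * in_ball_posdef[OF Z] by (subst thompson_dist_le_iff) (auto intro: posdef_step)
      then show ?case by (simp add: \<eta>_def mult_ac)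
    qed
  qed
  have "\<forall>\<^sub>F n in sequentially. thompson_dist X Y
      \<le> 2 * exp R * (norm (gradient X) + C * s n + (norm (gradient Y) + C * s n))"
    using move[OF X] move[OF Y]
  proof eventually_elim
    case (elim n)
    define D where "D = thompson_dist X Y"
    have "D \<le> thompson_dist X (step (s n) X) + thompson_dist (step (s n) X) Y"
      unfolding D_def by (intro thompson_dist_triangle p posdef_step)
    also have "thompson_dist (step (s n) X) Y
        \<le> thompson_dist (step (s n) X) (step (s n) Y) + thompson_dist (step (s n) Y) Y"
      by (intro thompson_dist_triangle p posdef_step)
    also have "thompson_dist (step (s n) Y) Y = thompson_dist Y (step (s n) Y)"
      by (intro thompson_dist_commute p posdef_step)
    also have "thompson_dist (step (s n) X) (step (s n) Y) \<le> (1 - s n) * D"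
      unfolding D_def using s[of n] by (intro thompson_dist_step_le p) auto
    finally have "s n * D \<le> thompson_dist X (step (s n) X) + thompson_dist Y (step (s n) Y)"
      by (simp add: algebra_simps)
    also have "\<dots> \<le> s n * (2 * exp R * (norm (gradient X) + C * s n + (norm (gradient Y) + C * s n)))"
      using elim by (simp add: algebra_simps)
    finally show ?case using s(1)[of n] unfolding D_def by simp
  qed
  moreover have "(\<lambda>n. 2 * exp R * (norm (gradient X) + C * s n + (norm (gradient Y) + C * s n)))
      \<longlonglongrightarrow> 2 * exp R * (norm (gradient X) + C * 0 + (norm (gradient Y) + C * 0))"
    by (intro tendsto_intros s0)
  ultimately have "thompson_dist X Y
      \<le> 2 * exp R * (norm (gradient X) + C * 0 + (norm (gradient Y) + C * 0))"
    by (intro tendsto_lowerbound) auto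
  then show ?thesis by simp
qed

lemma common_ball:
  obtains R where "0 \<le> R" "\<And>i. i \<in> {1..k} \<Longrightarrow> in_ball R (A i)"
proof
  define R where "R = (\<Sum>i=1..k. thompson_dist id_blinfun (A i))"
  show "0 \<le> R" unfolding R_def by (intro sum_nonneg thompson_dist_nonneg)
  fix i assume i: "i \<in> {1..k}"
  then have "thompson_dist id_blinfun (A i) \<le> R"
    unfolding R_def by (intro member_le_sum thompson_dist_nonneg) auto
  with i show "in_ball R (A i)" by (intro posdef_in_ball A)
qed

lemma thompson_dist_0_imp_eq:
  fixes X Y :: "'h \<Rightarrow>\<^sub>L 'h"
  assumes "posdef X" "posdef Y" "thompson_dist X Y \<le> 0"
  shows "X = Y"
proof -
  have n: "near 0 X Y" using assms by (simp add: thompson_dist_le_iff)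
  have "norm (Y - X) \<le> (exp 0 - 1) * exp (thompson_dist id_blinfun X)"
    by (rule norm_diff_le_near[OF posdef_in_ball[OF assms(1) order_refl] posdef_selfadj[OF assms(2)] n]) simp
  then show ?thesis by simp
qed

lemma karcher_unique:
  assumes "posdef X" "gradient X = 0" "posdef Y" "gradient Y = 0"
  shows "X = Y"
proof -
  obtain R where R: "0 \<le> R" "\<And>i. i \<in> {1..k} \<Longrightarrow> in_ball R (A i)" by (rule common_ball) blast
  define R' where "R' = max R (max (thompson_dist id_blinfun X) (thompson_dist id_blinfun Y))"
  have "thompson_dist X Y \<le> 2 * exp R' * (norm (gradient X) + norm (gradient Y))"
    by (rule thompson_dist_le_gradients)
      (use R(1) in_ball_mono[OF R(2), of _ R'] assms in \<open>auto intro: posdef_in_ball simp: R'_def\<close>)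
  with assms show ?thesis by (intro thompson_dist_0_imp_eq) simp_all
qed

text \<open>
  The gradient equation determines the mean within all real-linear positive definite operators. That
  the solution is linear over the scalars of the Hilbert space is obtained by tracking that it commutes
  with everything that commutes with the given operators.
\<close>

definition bicommutant :: "('h \<Rightarrow>\<^sub>L 'h) set" where
  "bicommutant = {X. \<forall>M. (\<forall>i\<in>{1..k}. A i o\<^sub>L M = M o\<^sub>L A i) \<longrightarrow> X o\<^sub>L M = M o\<^sub>L X}"

lemma bicommutant_step:
  assumes "posdef X" "X \<in> bicommutant"
  shows "step s X \<in> bicommutant"
  unfolding bicommutant_def
proof (intro CollectI allI impI)
  fix M assume M: "\<forall>i\<in>{1..k}. A i o\<^sub>L M = M o\<^sub>L A i"
  then have "X o\<^sub>L M = M o\<^sub>L X" using assms by (auto simp: bicommutant_def)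
  then have "(\<Sum>i=1..k. geodesic X s (A i) o\<^sub>L M) = (\<Sum>i=1..k. M o\<^sub>L geodesic X s (A i))"
    using M by (intro sum.cong refl geodesic_commute A assms) auto
  then show "step s X o\<^sub>L M = M o\<^sub>L step s X"
    by (simp add: step_def op_linear comp.sum_left comp.sum_right)
qed

lemma dist_id_step_id:
  assumes R: "0 \<le> R" "\<And>i. i \<in> {1..k} \<Longrightarrow> in_ball R (A i)" and s: "0 \<le> s" "s \<le> 1"
  shows "thompson_dist id_blinfun (step s id_blinfun) \<le> s * R"
proof -
  have near: "near (s * R) id_blinfun (geodesic id_blinfun s (A i))" if i: "i \<in> {1..k}" for i
  proof -
    have "geodesic id_blinfun s (A i) = fun_op (\<lambda>x. x powr s) (A i)"
      by (simp add: geodesic_perspective perspective_def whiten_def sqrt_op_def isqrt_op_def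
          powr_op_def fun_op_id)
    also have "between (exp (- (s * R))) (exp (s * R)) \<dots>"
    proof (rule between_fun_op)
      show "between (exp (- R)) (exp R) (A i)" using R(2)[OF i] by (simp add: in_ball_def)
      show "continuous_on {exp (- R)..exp R} (\<lambda>x. x powr s)"
        by (rule continuous_on_pos[OF continuous_on_powr_pos]) simp
      have "0 \<le> s * R" using R(1) s by simp
      then show "exp (- (s * R)) \<le> exp (s * R)" by simp
      fix x assume x: "x \<in> {exp (- R)..exp R}"
      then have "0 < x" by (meson atLeastAtMost_iff exp_gt_zero less_le_trans)
      have "exp (- R) powr s \<le> x powr s" "x powr s \<le> exp R powr s"
        using x s \<open>0 < x\<close> by (auto intro: powr_mono2)
      then show "exp (- (s * R)) \<le> x powr s \<and> x powr s \<le> exp (s * R)"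
        by (simp add: powr_def)
    qed
    finally show ?thesis by (simp add: between_def near_def)
  qed
  have "near (s * R) ((1 / real k) *\<^sub>R (\<Sum>i=1..k. id_blinfun)) (step s id_blinfun)"
    unfolding step_def by (intro near_average near) auto
  then have "near (s * R) id_blinfun (step s id_blinfun)"
    unfolding sum_const_average .
  moreover have "0 \<le> s * R" using R(1) s by simp
  ultimately show ?thesis by (simp add: thompson_dist_le_iff posdef_id posdef_step)
qed

text \<open>
  Iterating the contraction \<open>step s\<close> from the identity never leaves the ball, and eventually moves the
  point by less than \<open>s\<^sup>2\<close>. Since \<open>step s\<close> moves a point by \<open>s\<close> times its gradient up to \<open>O(s\<^sup>2)\<close>, the
  gradient is then of order \<open>s\<close>.
\<close>

lemma approximate_karcher_mean:
  assumes R: "0 \<le> R" "\<And>i. i \<in> {1..k} \<Longrightarrow> in_ball R (A i)" and s: "0 < s" "s \<le> 1"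
  obtains X where "in_ball R X" "X \<in> bicommutant"
    "norm (gradient X) \<le> (exp R * ((2 * R)\<^sup>2 * exp (2 * R)) + 2 * exp R) * s"
proof -
  define C where "C = exp R * ((2 * R)\<^sup>2 * exp (2 * R))"
  define Z where "Z n = (step s ^^ n) id_blinfun" for n
  have Z_Suc: "Z (Suc n) = step s (Z n)" for n by (simp add: Z_def)
  have Z0: "Z 0 = id_blinfun" by (simp add: Z_def)
  have pZ: "posdef (Z n)" for n
    by (induction n) (simp_all add: Z0 Z_Suc posdef_id posdef_step)
  have cZ: "Z n \<in> bicommutant" for n
    by (induction n) (simp_all add: Z_Suc bicommutant_step pZ, simp add: Z0 bicommutant_def)
  have bZ: "thompson_dist id_blinfun (Z n) \<le> R" for n
  proof (induction n)
    case 0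
    then show ?case using R by (simp add: Z0 thompson_dist_self posdef_id)
  next
    case (Suc n)
    have "thompson_dist id_blinfun (Z (Suc n)) \<le> thompson_dist id_blinfun (step s id_blinfun)
        + thompson_dist (step s id_blinfun) (step s (Z n))"
      unfolding Z_Suc by (intro thompson_dist_triangle posdef_id posdef_step pZ)
    also have "\<dots> \<le> s * R + (1 - s) * thompson_dist id_blinfun (Z n)"
      using s by (intro add_mono dist_id_step_id R thompson_dist_step_le posdef_id pZ) auto
    also have "\<dots> \<le> s * R + (1 - s) * R" using Suc s by (intro add_left_mono mult_left_mono) auto
    finally show ?case by (simp add: algebra_simps)
  qed
  have decay: "thompson_dist (Z n) (Z (Suc n)) \<le> (1 - s) ^ n * thompson_dist (Z 0) (Z 1)" for n
  proof (induction n)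
    case (Suc n)
    have "thompson_dist (Z (Suc n)) (Z (Suc (Suc n))) \<le> (1 - s) * thompson_dist (Z n) (Z (Suc n))"
      unfolding Z_Suc using s by (intro thompson_dist_step_le pZ posdef_step) auto
    also have "\<dots> \<le> (1 - s) * ((1 - s) ^ n * thompson_dist (Z 0) (Z 1))"
      using s by (intro mult_left_mono Suc) auto
    finally show ?case by simp
  qed simp
  have "(\<lambda>n. (1 - s) ^ n * thompson_dist (Z 0) (Z 1)) \<longlonglongrightarrow> 0 * thompson_dist (Z 0) (Z 1)"
    using s by (intro tendsto_mult tendsto_const LIMSEQ_realpow_zero) auto
  from order_tendstoD(2)[OF this, of "s\<^sup>2"] s
  have "\<forall>\<^sub>F n in sequentially. (1 - s) ^ n * thompson_dist (Z 0) (Z 1) < s\<^sup>2" by simp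
  from eventually_happens'[OF sequentially_bot this]
  obtain n where "(1 - s) ^ n * thompson_dist (Z 0) (Z 1) < s\<^sup>2" by blast
  with decay[of n] have "thompson_dist (Z n) (step s (Z n)) \<le> s\<^sup>2" by (simp add: Z_Suc)
  then have near: "near (s\<^sup>2) (Z n) (step s (Z n))"
    by (simp add: thompson_dist_le_iff pZ posdef_step)
  have ball: "in_ball R (Z n)" by (rule posdef_in_ball[OF pZ bZ])
  have "norm (step s (Z n) - Z n) \<le> (exp (s\<^sup>2) - 1) * exp R"
    by (rule norm_diff_le_near[OF ball posdef_selfadj[OF posdef_step[OF pZ]] near]) simp
  also have "\<dots> \<le> (2 * s\<^sup>2) * exp R"
  proof (rule mult_right_mono)
    have s2: "s\<^sup>2 \<le> 1" "0 \<le> s\<^sup>2" using s by (auto simp: power_le_one)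
    have "exp (s\<^sup>2) \<le> 1 + s\<^sup>2 + (s\<^sup>2)\<^sup>2" by (rule exp_bound[OF s2(2,1)])
    moreover have "(s\<^sup>2)\<^sup>2 \<le> s\<^sup>2"
      unfolding power2_eq_square[of "s\<^sup>2"] by (rule mult_left_le[OF s2])
    ultimately show "exp (s\<^sup>2) - 1 \<le> 2 * s\<^sup>2" by linarith
  qed simp
  finally have 1: "norm (step s (Z n) - Z n) \<le> (2 * s\<^sup>2) * exp R" .
  have 2: "norm (step s (Z n) - Z n - s *\<^sub>R gradient (Z n)) \<le> C * s\<^sup>2"
    unfolding C_def using s by (intro step_expansion R ball) auto
  have "s * norm (gradient (Z n)) = norm (s *\<^sub>R gradient (Z n))" using s by simp
  also have "\<dots> \<le> norm (step s (Z n) - Z n) + norm (step s (Z n) - Z n - s *\<^sub>R gradient (Z n))"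
    using norm_triangle_ineq4[of "step s (Z n) - Z n" "step s (Z n) - Z n - s *\<^sub>R gradient (Z n)"]
    by simp
  also have "\<dots> \<le> s * ((C + 2 * exp R) * s)"
    using 1 2 by (simp add: algebra_simps power2_eq_square)
  finally have "norm (gradient (Z n)) \<le> (C + 2 * exp R) * s" using s by simp
  with ball cZ show ?thesis using that unfolding C_def by blast
qed

text \<open>
  Approximate solutions form a Cauchy sequence, because distances are controlled by gradients, and the
  gradient is continuous.
\<close>

theorem karcher_exists:
  obtains X where "posdef X" "gradient X = 0" "X \<in> bicommutant"
proof -
  obtain R where R: "0 \<le> R" "\<And>i. i \<in> {1..k} \<Longrightarrow> in_ball R (A i)" by (rule common_ball) blast
  define K where "K = exp R * ((2 * R)\<^sup>2 * exp (2 * R)) + 2 * exp R"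
  define s where "s n = inverse (real (Suc n))" for n
  have s: "0 < s n" "s n \<le> 1" for n by (auto simp: s_def field_simps)
  have s0: "s \<longlonglongrightarrow> 0" unfolding s_def by (rule LIMSEQ_inverse_real_of_nat)
  have "\<forall>n. \<exists>X. in_ball R X \<and> X \<in> bicommutant \<and> norm (gradient X) \<le> K * s n"
    using approximate_karcher_mean[OF R s] unfolding K_def by metis
  then obtain X where X: "\<And>n. in_ball R (X n)" "\<And>n. X n \<in> bicommutant"
    "\<And>n. norm (gradient (X n)) \<le> K * s n" by metis
  have K: "0 \<le> K" by (simp add: K_def)
  define c where "c n = 4 * exp R * K * s n" for n
  have c0: "0 \<le> c n" for n using K s(1)[of n] by (simp add: c_def)
  have close: "norm (X m - X n) \<le> (exp (c N) - 1) * exp R" if "m \<ge> N" "n \<ge> N" for m n N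
  proof (rule norm_diff_le_near[OF X(1)])
    show "selfadj (X m)" using X(1) by (simp add: in_ball_def between_def)
    have "s j \<le> s N" if "j \<ge> N" for j using that by (simp add: s_def field_simps)
    then have "K * s m \<le> K * s N" "K * s n \<le> K * s N" using K that by (auto intro: mult_left_mono)
    then have "norm (gradient (X n)) + norm (gradient (X m)) \<le> 2 * (K * s N)"
      using X(3)[of m] X(3)[of n] by linarith
    then have "2 * exp R * (norm (gradient (X n)) + norm (gradient (X m))) \<le> 2 * exp R * (2 * (K * s N))"
      by (intro mult_left_mono) auto
    also have "2 * exp R * (2 * (K * s N)) = c N" by (simp add: c_def)
    finally have "thompson_dist (X n) (X m) \<le> c N"
      using thompson_dist_le_gradients[OF R(1) X(1) X(1) R(2), of n m] by linarith
    then show "near (c N) (X n) (X m)"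
      using X(1) c0 by (subst thompson_dist_le_iff[symmetric]) (auto intro: in_ball_posdef)
  qed (rule c0)
  have "Cauchy X"
  proof (rule metric_CauchyI)
    fix e :: real assume "e > 0"
    have "(\<lambda>N. (exp (c N) - 1) * exp R) \<longlonglongrightarrow> (exp (4 * exp R * K * 0) - 1) * exp R"
      unfolding c_def by (intro tendsto_intros s0)
    from order_tendstoD(2)[OF this, of e] \<open>e > 0\<close>
    have "\<forall>\<^sub>F N in sequentially. (exp (c N) - 1) * exp R < e" by simp
    from eventually_happens'[OF sequentially_bot this]
    obtain N where "(exp (c N) - 1) * exp R < e" by blast
    then have "dist (X m) (X n) < e" if "m \<ge> N" "n \<ge> N" for m n
      using close[OF that] by (simp add: dist_norm)
    then show "\<exists>M. \<forall>m\<ge>M. \<forall>n\<ge>M. dist (X m) (X n) < e" by blast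
  qed
  then obtain Y where Y: "X \<longlonglongrightarrow> Y" by (meson Cauchy_convergent convergent_def)
  have ball: "in_ball R Y"
    unfolding in_ball_def between_def
  proof (intro conjI)
    show "selfadj Y" using X(1) by (intro selfadj_tendsto[OF Y]) (simp add: in_ball_def between_def)
    show "exp (- R) *\<^sub>R id_blinfun \<sqsubseteq> Y"
      using X(1) by (intro op_le_tendsto[OF tendsto_const Y]) (simp add: in_ball_def between_def)
    show "Y \<sqsubseteq> exp R *\<^sub>R id_blinfun"
      using X(1) by (intro op_le_tendsto[OF Y tendsto_const]) (simp add: in_ball_def between_def)
  qed
  have "(\<lambda>n. gradient (X n)) \<longlonglongrightarrow> gradient Y"
    unfolding gradient_def
    by (intro tendsto_scaleR tendsto_const tendsto_sum log_at_tendsto[OF ball _ Y] R always_eventually allI X(1))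
  moreover have "(\<lambda>n. gradient (X n)) \<longlonglongrightarrow> 0"
    by (rule Lim_null_comparison[of _ "\<lambda>n. K * s n"])
      (use X(3) tendsto_mult_right_zero[OF s0] in auto)
  ultimately have "gradient Y = 0" by (rule LIMSEQ_unique)
  moreover have "Y \<in> bicommutant"
    unfolding bicommutant_def
  proof (intro CollectI allI impI)
    fix M assume "\<forall>i\<in>{1..k}. A i o\<^sub>L M = M o\<^sub>L A i"
    then have eq: "X n o\<^sub>L M = M o\<^sub>L X n" for n using X(2) by (auto simp: bicommutant_def)
    have "(\<lambda>n. X n o\<^sub>L M) \<longlonglongrightarrow> (Y o\<^sub>L M)" by (intro comp.tendsto Y tendsto_const)
    moreover have "(\<lambda>n. X n o\<^sub>L M) \<longlonglongrightarrow> (M o\<^sub>L Y)" unfolding eq by (intro comp.tendsto Y tendsto_const)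
    ultimately show "Y o\<^sub>L M = M o\<^sub>L Y" by (rule LIMSEQ_unique)
  qed
  ultimately show ?thesis using that in_ball_posdef[OF ball] by blast
qed

end

section \<open>Convergence of the cyclic inductive means\<close>

text \<open>
  With \<open>d m = a m / m\<close> the hypothesis reads \<open>d (m + 1) \<le> m / (m + 1) * d m + b m / (m + 1)\<close>, and \<open>d m\<close>
  is bounded by an average of \<open>b\<close>.
\<close>

lemma cesaro_null:
  fixes a b :: "nat \<Rightarrow> real"
  assumes a: "\<And>m. 0 \<le> a m" "\<And>m. m \<ge> 1 \<Longrightarrow> a (Suc m) \<le> a m + b m" and b: "b \<longlonglongrightarrow> 0"
  shows "(\<lambda>m. a m / real m) \<longlonglongrightarrow> 0"
proof (rule LIMSEQ_I)
  fix e :: real assume e: "e > 0"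
  have "\<forall>\<^sub>F m in sequentially. b m < e / 2" using order_tendstoD(2)[OF b, of "e / 2"] e by simp
  then obtain N0 where N0: "\<And>m. m \<ge> N0 \<Longrightarrow> b m < e / 2" by (auto simp: eventually_sequentially)
  define N where "N = Suc N0"
  have bd: "a (N + j) \<le> a N + real j * (e / 2)" for j
  proof (induction j)
    case (Suc j)
    have "a (Suc (N + j)) \<le> a (N + j) + b (N + j)" by (rule a(2)) (simp add: N_def)
    also have "\<dots> \<le> a N + real j * (e / 2) + e / 2"
      using Suc N0[of "N + j"] by (simp add: N_def)
    finally show ?case by (simp add: algebra_simps add_divide_distrib)
  qed simp
  obtain M :: nat where M: "2 * a N / e < real M" using reals_Archimedean2 by blast
  have "norm (a m / real m - 0) < e" if m: "m \<ge> max N (Suc M)" for m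
  proof -
    have m0: "real m > 0" "m \<ge> N" using m by (auto simp: N_def)
    have "a m \<le> a N + real (m - N) * (e / 2)" using bd[of "m - N"] m0(2) by simp
    also have "\<dots> \<le> a N + real m * (e / 2)"
      using e by (intro add_left_mono mult_right_mono) auto
    also have "a N < real m * (e / 2)"
    proof -
      have "2 * a N / e < real m" using M m by simp
      then show ?thesis using e by (simp add: field_simps)
    qed
    finally have "a m < e * real m" by (simp add: algebra_simps)
    then show ?thesis using m0(1) a(1)[of m] by (simp add: pos_divide_less_eq)
  qed
  then show "\<exists>N. \<forall>m\<ge>N. norm (a m / real m - 0) < e" by blast
qed

lemma cyclic_index_block: "j < k \<Longrightarrow> cyclic_index k (m * k + j + 1) = j + 1"
proof -
  assume j: "j < k"
  have "(m * k + j + 1) mod k = (j + 1) mod k" by (metis add.assoc mod_mult_self3)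
  with j show ?thesis by (cases "j + 1 = k") (auto simp: cyclic_index_def)
qed

lemma thompson_dist_eventually_le:
  fixes X :: "'h::{real_inner,banach} \<Rightarrow>\<^sub>L 'h"
  assumes X: "posdef X" and Z: "Z \<longlonglongrightarrow> X" "\<And>n. posdef (Z n)"
  shows "\<forall>\<^sub>F n in sequentially. thompson_dist (Z n) X
    \<le> 2 * exp (thompson_dist id_blinfun X) * norm (Z n - X)"
  using near_norm_eventually[OF posdef_in_ball[OF X order_refl] Z(1)]
  by eventually_elim (auto simp: thompson_dist_le_iff Z(2) X dest: near_sym)

lemma thompson_dist_tendsto_0:
  fixes X :: "'h::{real_inner,banach} \<Rightarrow>\<^sub>L 'h"
  assumes X: "posdef X" and Z: "Z \<longlonglongrightarrow> X" "\<And>n. posdef (Z n)"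
  shows "(\<lambda>n. thompson_dist (Z n) X) \<longlonglongrightarrow> 0"
proof (rule Lim_null_comparison)
  show "\<forall>\<^sub>F n in sequentially. norm (thompson_dist (Z n) X)
      \<le> 2 * exp (thompson_dist id_blinfun X) * norm (Z n - X)"
    using thompson_dist_eventually_le[OF assms] by (simp add: thompson_dist_nonneg)
  have "(\<lambda>n. 2 * exp (thompson_dist id_blinfun X) * norm (Z n - X))
      \<longlonglongrightarrow> 2 * exp (thompson_dist id_blinfun X) * norm (X - X)"
    by (intro tendsto_intros Z)
  then show "(\<lambda>n. 2 * exp (thompson_dist id_blinfun X) * norm (Z n - X)) \<longlonglongrightarrow> 0" by simp
qed

context operator_family
begin

text \<open>One cycle of the inductive means, restarted at \<open>X\<close> with the step sizes that follow time \<open>m k\<close>.\<close>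

primrec cycle :: "('h \<Rightarrow>\<^sub>L 'h) \<Rightarrow> nat \<Rightarrow> nat \<Rightarrow> ('h \<Rightarrow>\<^sub>L 'h)" where
  "cycle X m 0 = X"
| "cycle X m (Suc j) = geodesic (cycle X m j) (1 / real (m * k + j + 1)) (A (Suc j))"

lemma posdef_cycle: "posdef X \<Longrightarrow> j \<le> k \<Longrightarrow> posdef (cycle X m j)"
  by (induction j) (auto intro!: posdef_geodesic A)

text \<open>
  Within a cycle all points stay close to \<open>X\<close> and all step sizes are asymptotic to \<open>1 / (m k)\<close>, so to
  first order the logarithms at \<open>X\<close> simply add up.
\<close>

lemma cycle_expansion:
  assumes X: "posdef X"
  shows "j \<le> k \<Longrightarrow> (\<lambda>m. cycle X m j) \<longlonglongrightarrow> X \<and>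
    (\<lambda>m. real (m * k) *\<^sub>R (cycle X m j - X)) \<longlonglongrightarrow> (\<Sum>i=1..j. log_at X (A i))"
proof (induction j)
  case (Suc j)
  then have IH: "(\<lambda>m. cycle X m j) \<longlonglongrightarrow> X"
    "(\<lambda>m. real (m * k) *\<^sub>R (cycle X m j - X)) \<longlonglongrightarrow> (\<Sum>i=1..j. log_at X (A i))" by auto
  define t where "t m = 1 / real (m * k + j + 1)" for m
  define q where "q m = (1 / t m) *\<^sub>R (cycle X m (Suc j) - cycle X m j)" for m
  have "0 < 1 / real (n + 1)" "1 / real (n + 1) \<le> 1" for n by simp_all
  then have t: "0 < t m" "t m \<le> 1" for m by (simp_all only: t_def)
  have k0: "k > 0" using k by simp
  have inf: "filterlim (\<lambda>m. real (m * k + j + 1)) at_top sequentially"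
  proof (rule filterlim_at_top_mono[OF filterlim_real_sequentially])
    have "m * 1 \<le> m * k" for m using k by (intro mult_le_mono2)
    then have "real m \<le> real (m * k + j + 1)" for m
      unfolding of_nat_le_iff by (simp add: le_SucI trans_le_add1)
    then show "\<forall>\<^sub>F m in sequentially. real m \<le> real (m * k + j + 1)"
      by (intro always_eventually allI)
  qed
  have t0: "t \<longlonglongrightarrow> 0"
    unfolding t_def by (rule real_tendsto_divide_at_top[OF tendsto_const inf])
  have "(\<lambda>m. 1 - real (j + 1) * t m) \<longlonglongrightarrow> 1 - real (j + 1) * 0"
    by (intro tendsto_intros t0)
  moreover have mk: "real (m * k) * t m = 1 - real (j + 1) * t m" for m
  proof -
    have "real (m * k + j + 1) * t m = 1"
      using t(1)[of m] by (simp add: t_def del: of_nat_add of_nat_mult of_nat_Suc)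
    moreover have "real (m * k + j + 1) = real (m * k) + real (j + 1)" by simp
    ultimately have "(real (m * k) + real (j + 1)) * t m = 1" by (simp only:)
    then show ?thesis unfolding distrib_right by linarith
  qed
  ultimately have mk1: "(\<lambda>m. real (m * k) * t m) \<longlonglongrightarrow> 1" by simp
  have q: "q \<longlonglongrightarrow> log_at X (A (Suc j))"
    unfolding q_def using Suc.prems t
    by (simp only: cycle.simps t_def[symmetric])
      (intro geodesic_quotient_tendsto X A IH(1) posdef_cycle t0; simp)
  have eq: "cycle X m (Suc j) = cycle X m j + t m *\<^sub>R q m" for m
    using t(1)[of m] by (simp add: q_def del: cycle.simps)
  have "(\<lambda>m. cycle X m j + t m *\<^sub>R q m) \<longlonglongrightarrow> X + 0 *\<^sub>R log_at X (A (Suc j))"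
    by (intro tendsto_intros IH(1) t0 q)
  moreover have "(\<lambda>m. real (m * k) *\<^sub>R (cycle X m j - X) + (real (m * k) * t m) *\<^sub>R q m)
      \<longlonglongrightarrow> (\<Sum>i=1..j. log_at X (A i)) + 1 *\<^sub>R log_at X (A (Suc j))"
    by (intro tendsto_add IH(2) tendsto_scaleR mk1 q)
  moreover have "real (m * k) *\<^sub>R (cycle X m j - X) + (real (m * k) * t m) *\<^sub>R q m
      = real (m * k) *\<^sub>R (cycle X m (Suc j) - X)" for m
    unfolding eq by (simp add: scaleR_add_right scaleR_diff_right)
  ultimately show ?case unfolding eq[symmetric] by simp
qed simp

text \<open>
  Over the \<open>m\<close>-th cycle the contraction factors \<open>1 - 1 / (n + 1)\<close> telescope to \<open>m / (m + 1)\<close>, while the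
  cycle moves the solution \<open>X\<close> itself only by \<open>o(1 / m)\<close>, since the first-order term is the gradient.
  Hence \<open>m d(S (m k), X)\<close> grows by increments that tend to zero.
\<close>

theorem cyclic_means_converge:
  assumes X: "posdef X" "gradient X = 0"
    and S1: "S 1 = A 1"
    and S: "\<And>n. n \<ge> 1 \<Longrightarrow> S (n + 1) = geodesic (S n) (1 / real (n + 1)) (A (cyclic_index k (n + 1)))"
  shows "(\<lambda>n. thompson_dist (S n) X) \<longlonglongrightarrow> 0"
proof -
  have k0: "k > 0" using k by simp
  have pS: "posdef (S n)" if "n \<ge> 1" for n
    using that
  proof (induction n rule: dec_induct)
    case base
    then show ?case using k A S1 by simp
  next
    case (step n)
    have "cyclic_index k (n + 1) \<in> {1..k}" using k0
      by (auto simp: cyclic_index_def Suc_le_eq less_imp_le)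
    then show ?case using S[of n] step by (simp add: posdef_geodesic A)
  qed
  have block: "thompson_dist (S (m * k + j)) (cycle X m j)
      \<le> real (m * k) / real (m * k + j) * thompson_dist (S (m * k)) X"
    if m: "m \<ge> 1" and "j \<le> k" for m j
    using \<open>j \<le> k\<close>
  proof (induction j)
    case 0
    show ?case using m k0 by simp
  next
    case (Suc j)
    define n where "n = m * k + j"
    have n: "n \<ge> 1" using m k0 by (simp add: n_def Suc_le_eq)
    have "S (n + 1) = geodesic (S n) (1 / real (n + 1)) (A (Suc j))"
      using S[OF n] cyclic_index_block[of j k m] Suc.prems by (simp add: n_def)
    then have "thompson_dist (S (n + 1)) (cycle X m (Suc j))
        \<le> (1 - 1 / real (n + 1)) * thompson_dist (S n) (cycle X m j)"
      using n Suc.prems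
      by (simp add: n_def[symmetric] del: of_nat_Suc of_nat_add)
        (intro thompson_dist_geodesic_le pS posdef_cycle X A; simp)
    also have "\<dots> \<le> (1 - 1 / real (n + 1)) * (real (m * k) / real n * thompson_dist (S (m * k)) X)"
    proof (rule mult_left_mono)
      show "thompson_dist (S n) (cycle X m j) \<le> real (m * k) / real n * thompson_dist (S (m * k)) X"
        using Suc unfolding n_def by simp
      show "0 \<le> 1 - 1 / real (n + 1)" by simp
    qed
    also have "(1 - 1 / real (n + 1)) * (real (m * k) / real n * thompson_dist (S (m * k)) X)
        = real (m * k) / real (n + 1) * thompson_dist (S (m * k)) X"
    proof -
      have "1 - 1 / real (n + 1) = real n / real (n + 1)" by (simp add: field_simps)
      then show ?thesis using n by simp
    qed
    finally show ?case by (simp add: n_def)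
  qed
  have sum0: "(\<Sum>i=1..k. log_at X (A i)) = 0" using X(2) k by (simp add: gradient_def)
  define \<epsilon> where "\<epsilon> m j = thompson_dist (cycle X m j) X" for m j
  have \<epsilon>0: "(\<lambda>m. \<epsilon> m j) \<longlonglongrightarrow> 0" if "j \<le> k" for j
    unfolding \<epsilon>_def using cycle_expansion[OF X(1) that] posdef_cycle[OF X(1) that]
    by (intro thompson_dist_tendsto_0 X) auto
  have m\<epsilon>: "(\<lambda>m. real (Suc m) * \<epsilon> m k) \<longlonglongrightarrow> 0"
  proof (rule Lim_null_comparison)
    define c where "c = 2 * exp (thompson_dist id_blinfun X)"
    have "\<forall>\<^sub>F m in sequentially. \<epsilon> m k \<le> c * norm (cycle X m k - X)"
      unfolding \<epsilon>_def c_def using cycle_expansion[OF X(1), of k] posdef_cycle[OF X(1), of k]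
      by (intro thompson_dist_eventually_le X) auto
    then show "\<forall>\<^sub>F m in sequentially. norm (real (Suc m) * \<epsilon> m k)
        \<le> 2 * c * norm (real (m * k) *\<^sub>R (cycle X m k - X))"
      using eventually_ge_at_top[of 1]
    proof eventually_elim
      case (elim m)
      have "1 * m \<le> m * k" using k by simp
      then have "Suc m \<le> 2 * (m * k)" using elim(2) by linarith
      then have "real (Suc m) \<le> 2 * real (m * k)" by (metis of_nat_le_iff of_nat_mult of_nat_numeral)
      then have "real (Suc m) * \<epsilon> m k \<le> (2 * real (m * k)) * (c * norm (cycle X m k - X))"
        using elim(1) by (intro mult_mono) (auto simp: \<epsilon>_def thompson_dist_nonneg)
      then show ?case by (simp add: \<epsilon>_def thompson_dist_nonneg mult_ac)
    qed
    have "(\<lambda>m. 2 * c * norm (real (m * k) *\<^sub>R (cycle X m k - X))) \<longlonglongrightarrow> 2 * c * norm (0 :: 'h \<Rightarrow>\<^sub>L 'h)"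
      using cycle_expansion[OF X(1), of k] unfolding sum0 by (intro tendsto_intros) auto
    then show "(\<lambda>m. 2 * c * norm (real (m * k) *\<^sub>R (cycle X m k - X))) \<longlonglongrightarrow> 0" by simp
  qed
  define D where "D m = thompson_dist (S (m * k)) X" for m
  have near_cycle: "thompson_dist (S (m * k + j)) X
      \<le> real (m * k) / real (m * k + j) * D m + \<epsilon> m j" if m: "m \<ge> 1" and j: "j \<le> k" for m j
  proof -
    have "m * k + j \<ge> 1" using m k0 by (simp add: Suc_le_eq)
    then have "thompson_dist (S (m * k + j)) X
        \<le> thompson_dist (S (m * k + j)) (cycle X m j) + thompson_dist (cycle X m j) X"
      by (intro thompson_dist_triangle pS posdef_cycle X j)
    with block[OF m j] show ?thesis by (simp add: D_def \<epsilon>_def)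
  qed
  have "(\<lambda>m. (real m * D m) / real m) \<longlonglongrightarrow> 0"
  proof (rule cesaro_null[OF _ _ m\<epsilon>])
    show "0 \<le> real m * D m" for m by (simp add: D_def thompson_dist_nonneg)
    fix m :: nat assume m: "m \<ge> 1"
    have "D (Suc m) \<le> real (m * k) / real (m * k + k) * D m + \<epsilon> m k"
      using near_cycle[OF m order_refl] by (simp add: D_def add.commute)
    also have "real (m * k) / real (m * k + k) = real m / real (Suc m)"
    proof -
      have "real (m * k + k) = real (Suc m) * real k" by (simp add: algebra_simps)
      then show ?thesis using k0 by (simp del: of_nat_Suc of_nat_add)
    qed
    finally have "real (Suc m) * D (Suc m) \<le> real (Suc m) * (real m / real (Suc m) * D m + \<epsilon> m k)"
      by (intro mult_left_mono) auto
    also have "\<dots> = real m * D m + real (Suc m) * \<epsilon> m k"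
      by (simp add: distrib_left del: of_nat_Suc)
    finally show "real (Suc m) * D (Suc m) \<le> real m * D m + real (Suc m) * \<epsilon> m k" .
  qed
  moreover have "\<forall>\<^sub>F m in sequentially. (real m * D m) / real m = D m"
    using eventually_ge_at_top[of 1] by eventually_elim simp
  ultimately have D0: "D \<longlonglongrightarrow> 0" by (simp add: tendsto_cong)
  define E where "E m = D m + (\<Sum>j\<le>k. \<epsilon> m j)" for m
  have "E \<longlonglongrightarrow> 0 + (\<Sum>j\<le>k. 0)"
    unfolding E_def by (intro tendsto_add D0 tendsto_sum \<epsilon>0) auto
  then have "E \<longlonglongrightarrow> 0" by simp
  then have lim: "(\<lambda>n. E (n div k)) \<longlonglongrightarrow> 0"
    by (rule filterlim_compose) (rule filterlim_at_top_div_const_nat[OF k0])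
  show ?thesis
  proof (rule Lim_null_comparison[OF _ lim])
    show "\<forall>\<^sub>F n in sequentially. norm (thompson_dist (S n) X) \<le> E (n div k)"
      using eventually_ge_at_top[of k]
    proof eventually_elim
      case (elim n)
      define m j where "m = n div k" and "j = n mod k"
      have n: "n = m * k + j" by (simp add: m_def j_def)
      have m: "m \<ge> 1" using elim k0 by (simp add: m_def div_greater_zero_iff Suc_le_eq)
      have j: "j \<le> k" using k0 by (simp add: j_def less_imp_le)
      have "thompson_dist (S n) X \<le> real (m * k) / real (m * k + j) * D m + \<epsilon> m j"
        unfolding n by (rule near_cycle[OF m j])
      also have "\<dots> \<le> 1 * D m + (\<Sum>j\<le>k. \<epsilon> m j)"
      proof (intro add_mono mult_right_mono)
        have "0 < m * k + j" using m k0 by simp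
        then have "0 < real (m * k + j)" by (simp only: of_nat_0_less_iff)
        then show "real (m * k) / real (m * k + j) \<le> 1"
          by (simp only: divide_le_eq_1_pos of_nat_le_iff le_add1)
        show "0 \<le> D m" by (simp add: D_def thompson_dist_nonneg)
        show "\<epsilon> m j \<le> (\<Sum>j\<le>k. \<epsilon> m j)"
          using j by (intro member_le_sum) (auto simp: \<epsilon>_def thompson_dist_nonneg)
      qed
      finally show ?case by (simp add: E_def m_def thompson_dist_nonneg)
    qed
  qed
qed

end

section \<open>The cone of the Hilbert space\<close>

text \<open>
  A positive operator with \<open>T \<le> N\<close> satisfies \<open>T\<^sup>2 \<le> N T\<close>, so that \<open>\<parallel>T x\<parallel>\<^sup>2\<close>, which invertibility bounds
  from below, is dominated by the quadratic form.
\<close>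

lemma coercive_if_positive_invertible:
  fixes T :: "'h::{real_inner,banach} \<Rightarrow>\<^sub>L 'h"
  assumes T: "selfadj T" and pos: "\<And>x. x \<noteq> 0 \<Longrightarrow> inner (T x) x > 0" and inv: "invertible_op T"
  shows "posdef T"
proof -
  obtain B where B: "B o\<^sub>L T = id_blinfun" using inv by (auto simp: invertible_op_def)
  define N where "N = norm T + 1"
  have N: "N > 0" by (simp add: N_def add_nonneg_pos)
  have "0 \<le> inner (T x) x" for x using pos[of x] by (cases "x = 0") auto
  then have bT: "between 0 N T"
    using T op_le_norm(1)[of T] op_le_id_mono[of "norm T" N]
    by (auto simp: between_def N_def op_le_def[of 0] intro: op_le_trans)
  have sq: "(norm (T x))\<^sup>2 \<le> N * inner (T x) x" for x
  proof -
    have c: "continuous_on {0..N} (\<lambda>x. N * x - x * x)" by (intro continuous_intros)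
    have "fun_op (\<lambda>x. N * x - x * x) T = fun_op (\<lambda>x. N * x) T - fun_op (\<lambda>x. x * x) T"
      by (rule fun_op_diff[OF bT]) (intro continuous_intros)+
    also have "\<dots> = N *\<^sub>R T - (T o\<^sub>L T)"
      by (simp add: fun_op_cmult[OF bT] fun_op_mult[OF bT] fun_op_ident[OF bT] continuous_on_id)
    finally have eq: "fun_op (\<lambda>x. N * x - x * x) T = N *\<^sub>R T - (T o\<^sub>L T)" .
    have "between 0 (N * N) (N *\<^sub>R T - (T o\<^sub>L T))"
      unfolding eq[symmetric]
    proof (rule between_fun_op[OF bT c])
      show "0 \<le> N * N" using N by simp
      fix x assume x: "x \<in> {0..N}"
      then have "0 \<le> x * (N - x)" "N * x \<le> N * N" by (auto intro: mult_left_mono)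
      then show "0 \<le> N * x - x * x \<and> N * x - x * x \<le> N * N"
        using zero_le_square[of x] by (auto simp: algebra_simps intro: order_trans)
    qed
    then have "0 \<le> inner ((N *\<^sub>R T - (T o\<^sub>L T)) x) x"
      by (simp add: between_def op_le_def)
    then show ?thesis
      by (simp add: op_apply inner_diff_left power2_norm_eq_inner selfadjD[OF T])
  qed
  define \<beta> where "\<beta> = norm B + 1"
  have \<beta>: "\<beta> > 0" by (simp add: \<beta>_def add_nonneg_pos)
  have "1 / (\<beta>\<^sup>2 * N) * inner x x \<le> inner (T x) x" for x
  proof -
    have "x = B (T x)" using arg_cong[OF B, of "\<lambda>S. S x"] by simp
    then have "norm x \<le> norm B * norm (T x)" by (metis norm_blinfun)
    also have "\<dots> \<le> \<beta> * norm (T x)" by (intro mult_right_mono) (auto simp: \<beta>_def)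
    finally have "(norm x)\<^sup>2 \<le> \<beta>\<^sup>2 * (norm (T x))\<^sup>2"
      by (metis norm_ge_zero power_mono power_mult_distrib)
    also have "\<dots> \<le> \<beta>\<^sup>2 * (N * inner (T x) x)" using sq by (intro mult_left_mono) auto
    finally show ?thesis using \<beta> N by (simp add: dot_square_norm field_simps)
  qed
  then have "between (1 / (\<beta>\<^sup>2 * N)) N T"
    using bT by (simp add: between_def op_le_def[of "_ *\<^sub>R _" T] op_apply)
  then show ?thesis by (rule posdefI) (use \<beta> N in simp)
qed

context hilbert_space
begin

definition scalar_op :: "complex \<Rightarrow> ('h \<Rightarrow>\<^sub>L 'h)" where
  "scalar_op c = Blinfun (smul c)"

lemma scalar_op_apply:
  assumes c: "c \<in> K"
  shows "scalar_op c x = smul c x"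
proof -
  have real: "complex_of_real r \<in> K" for r using scalars by auto
  have "bounded_linear (smul c)"
  proof (rule bounded_linear_intro[where K = "cmod c"])
    show "smul c (x + y) = smul c x + smul c y" for x y by (rule smul_add_right[OF c])
    show "smul c (r *\<^sub>R x) = r *\<^sub>R smul c x" for r x
      using smul_smul[OF c real] smul_smul[OF real c] by (simp add: smul_of_real[symmetric] mult.commute)
    show "norm (smul c x) \<le> norm x * cmod c" for x
    proof -
      have "ip (smul c x) (smul c x) = c * cnj (ip (smul c x) x)"
        using ip_smul_left[OF c] ip_commute by metis
      also have "\<dots> = (c * cnj c) * ip x x"
        using ip_smul_left[OF c] ip_commute[of x x] by simp
      also have "c * cnj c = of_real ((cmod c)\<^sup>2)" by (rule complex_norm_square[symmetric])
      finally have "(norm (smul c x))\<^sup>2 = (cmod c)\<^sup>2 * (norm x)\<^sup>2"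
        by (simp add: power2_norm_eq_inner inner_eq_Re_ip)
      then have "(norm (smul c x))\<^sup>2 = (norm x * cmod c)\<^sup>2" by (simp add: power_mult_distrib mult.commute)
      then have "norm (smul c x) = norm x * cmod c" by (simp add: power2_eq_iff_nonneg)
      then show ?thesis by simp
    qed
  qed
  then show ?thesis by (simp add: scalar_op_def bounded_linear_Blinfun_apply)
qed

text \<open>
  This replaces the scalar field by a commutation condition over the reals. Self-adjointness for \<open>ip\<close>
  follows from that for its real part, since the imaginary part is the real part after multiplication by
  \<open>\<i>\<close>.
\<close>

lemma pos_cone_iff:
  "X \<in> pos_cone K smul ip \<longleftrightarrow> posdef X \<and> (\<forall>c\<in>K. X o\<^sub>L scalar_op c = scalar_op c o\<^sub>L X)"
proof
  assume X: "X \<in> pos_cone K smul ip"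
  have "posdef X"
    by (rule coercive_if_positive_invertible)
      (use X in \<open>auto simp: pos_cone_def selfadj_def inner_eq_Re_ip\<close>)
  moreover have "X o\<^sub>L scalar_op c = scalar_op c o\<^sub>L X" if "c \<in> K" for c
    using X that by (intro blinfun_eqI) (auto simp: pos_cone_def scalar_op_apply)
  ultimately show "posdef X \<and> (\<forall>c\<in>K. X o\<^sub>L scalar_op c = scalar_op c o\<^sub>L X)" by blast
next
  assume X: "posdef X \<and> (\<forall>c\<in>K. X o\<^sub>L scalar_op c = scalar_op c o\<^sub>L X)"
  have lin: "X (smul c x) = smul c (X x)" if "c \<in> K" for c x
  proof -
    have "X o\<^sub>L scalar_op c = scalar_op c o\<^sub>L X" using X that by blast
    from arg_cong[OF this, of "\<lambda>T. T x"] show ?thesis using that by (simp add: scalar_op_apply)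
  qed
  have sa: "inner (X x) y = inner x (X y)" for x y using X by (simp add: posdef_selfadj selfadjD)
  have "Im (ip (X x) y) = Im (ip x (X y))" for x y
  proof (cases "K = UNIV")
    case True
    have Im_ip: "Im (ip u v) = - inner (smul \<i> u) v" for u v
      using ip_smul_left[of \<i> u v] True by (simp add: inner_eq_Re_ip)
    show ?thesis using lin[of \<i> x] sa[of "smul \<i> x" y] True by (simp add: Im_ip)
  next
    case False
    then have "K = \<real>" using scalars by blast
    then have "ip u v \<in> \<real>" for u v using ip_scalar by simp
    then show ?thesis by (simp add: complex_is_Real_iff)
  qed
  then have "ip (X x) y = ip x (X y)" for x y
    using sa by (simp add: complex_eq_iff inner_eq_Re_ip[symmetric])
  moreover obtain a b where ab: "0 < a" "between a b X" using X by (auto simp: posdef_def)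
  then have "invertible_op X" by (intro coercive_invertible) (auto simp: between_def)
  moreover have "Re (ip (X x) x) > 0" if "x \<noteq> 0" for x
  proof -
    have "0 < a * inner x x" using ab that by simp
    also have "\<dots> \<le> inner (X x) x" using ab by (simp add: between_def op_le_def op_apply)
    finally show ?thesis by (simp add: inner_eq_Re_ip)
  qed
  ultimately show "X \<in> pos_cone K smul ip" using lin by (simp add: pos_cone_def)
qed

end

section \<open>The deterministic law of large numbers\<close>

theorem theorem5p6:
  fixes K :: "complex set"
    and smul :: "complex \<Rightarrow> 'h::{real_inner,banach} \<Rightarrow> 'h"
    and ip :: "'h \<Rightarrow> 'h \<Rightarrow> complex"
    and k :: nat
    and A S :: "nat \<Rightarrow> ('h \<Rightarrow>\<^sub>L 'h)"
  assumes "hilbert_space K smul ip"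
    and "k \<ge> 1"
    and "\<And>i. i \<in> {1..k} \<Longrightarrow> A i \<in> pos_cone K smul ip"
    and "S 1 = A 1"
    and "\<And>n. n \<ge> 1 \<Longrightarrow> S (n + 1) = geodesic (S n) (1 / real (n + 1)) (A (cyclic_index k (n + 1)))"
  shows "(\<lambda>n. thompson_dist (S n) (karcher_mean K smul ip k A)) \<longlonglongrightarrow> 0"
proof -
  interpret hilbert_space K smul ip by (rule assms(1))
  have cone: "posdef (A i)" "\<And>c. c \<in> K \<Longrightarrow> A i o\<^sub>L scalar_op c = scalar_op c o\<^sub>L A i"
    if "i \<in> {1..k}" for i
    using assms(3)[OF that] by (auto simp: pos_cone_iff)
  interpret operator_family k A by unfold_locales (use assms(2) cone in auto)
  obtain X where X: "posdef X" "gradient X = 0" "X \<in> bicommutant" by (rule karcher_exists)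
  have "X \<in> pos_cone K smul ip"
    using X(1,3) cone(2) by (auto simp: pos_cone_iff bicommutant_def)
  then have "karcher_mean K smul ip k A = X"
    unfolding karcher_mean_def gradient_def[symmetric]
    using X by (intro the_equality) (auto simp: pos_cone_iff intro: karcher_unique)
  then show ?thesis
    using cyclic_means_converge[OF X(1,2) assms(4,5)] by simp
qed

end
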